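(* The quotient curve $\Gamma_{T_1}\backslash\mathbb{D}_{T_1}$ is compact. In particular, it is not isogenous to $\mathrm{PSL}(2,\mathbb{Z})\backslash\mathbb{H}$.
   Context: For a smooth complex cubic fourfold $X$, $\Lambda_0=H^4(X,\mathbb{Z})_{prim}$ is the orthogonal complement in $H^4(X,\mathbb{Z})$ of the square of the hyperplane class; as a lattice $\Lambda_0\cong E_8^{\oplus2}\oplus U^{\oplus2}\oplus A_2$, of signature $(20,2)$. Let $\mathbb{D}=\{x\in\mathbb{P}(\Lambda_0\otimes\mathbb{C}):(x,x)=0,(x,\bar x)<0\}^+$, where $^+$ means one of the two connected components, and $\widehat\Gamma=\{g\in \mathrm{O}(\Lambda_0): g \text{ acts trivially on the discriminant group of }\Lambda_0,\ g(\mathbb{D})=\mathbb{D}\}$. Take $X$ with group of symplectic automorphisms (automorphisms acting trivially on $H^{3,1}(X)$) isomorphic to $G=L_2(7)=\mathrm{PSL}(2,\mathbb{F}_7)$. Then $G\subset\widehat\Gamma$; $T_1=\Lambda_0^G$ is the invariant sublattice, of signature $(1,2)$; it has an integral basis with Gram matrix $\begin{pmatrix}-2&1&0\\1&10&0\\0&0&-28\end{pmatrix}$. The local period domain is $\mathbb{D}_{T_1}=\{x\in\mathbb{P}(T_1\otimes\mathbb{C}):(x,x)=0,(x,\bar x)<0\}^+$, isomorphic to the upper half plane $\mathbb{H}$. $\Gamma_{T_1}$ is the image in $\mathrm{O}(T_1)$, by restriction, of the normalizer of $G$ in $\widehat\Gamma$; it acts on $\mathbb{D}_{T_1}$. Two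 arithmetic quotients of $\mathbb{H}$ are isogenous if the corresponding arithmetic groups (their images in $\mathrm{PSL}(2,\mathbb{R})$) are commensurable after conjugation. *)

theory Defs
  imports "HOL-Complex_Analysis.Complex_Analysis" "HOL-Algebra.Group_Action"
    "HOL-Library.Numeral_Type"
begin

text \<open>
  A lattice is given by a subgroup \<open>L\<close> of \<open>\<int>\<^sup>n\<close> together with the integral symmetric bilinear form on
  \<open>\<int>\<^sup>n\<close> that has Gram matrix \<open>Q\<close>. For a field \<open>K\<close> of characteristic \<open>0\<close>, the space \<open>L \<otimes> K\<close> is the
  \<open>K\<close>-span of \<open>L\<close> in \<open>K\<^sup>n\<close>.
\<close>

definition embed :: "int^'n \<Rightarrow> ('a::ring_1)^'n" where
  "embed v = (\<chi> i. of_int (v $ i))"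

definition extend_scalars :: "(int^'n) set \<Rightarrow> ('a::field^'n) set" where
  "extend_scalars L = vec.span (embed ` L)"

definition bform :: "int^'n^'n \<Rightarrow> ('a::comm_ring_1)^'n \<Rightarrow> 'a^'n \<Rightarrow> 'a" where
  "bform Q x y = (\<Sum>i\<in>UNIV. \<Sum>j\<in>UNIV. of_int (Q $ i $ j) * x $ i * y $ j)"

definition integral_basis :: "int^'n^'k \<Rightarrow> (int^'n) set \<Rightarrow> bool" where
  "integral_basis b L \<longleftrightarrow> bij_betw (\<lambda>c::int^'k. \<Sum>i\<in>UNIV. c $ i *s b $ i) UNIV L"

subsection \<open>The primitive cohomology lattice of a cubic fourfold\<close>

text \<open>
  The cubic fourfold enters only through its primitive lattice, identified by a marking with
  \<open>E\<^sub>8\<^sup>2 \<oplus> U\<^sup>2 \<oplus> A\<^sub>2\<close>, and through the action of its symplectic automorphisms on that lattice.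
\<close>

definition direct_sum_gram :: "int^'m^'m \<Rightarrow> int^'n^'n \<Rightarrow> int^('m + 'n)^('m + 'n)"
    (infixr \<open>\<oplus>\<^sub>L\<close> 65) where
  "A \<oplus>\<^sub>L B = (\<chi> i j. case (i, j) of
      (Inl k, Inl l) \<Rightarrow> A $ k $ l
    | (Inr k, Inr l) \<Rightarrow> B $ k $ l
    | _ \<Rightarrow> 0)"

definition hyperbolic_gram :: "int^2^2" where
  "hyperbolic_gram = vector [vector [0, 1], vector [1, 0]]"

definition A2_gram :: "int^2^2" where
  "A2_gram = vector [vector [2, -1], vector [-1, 2]]"

text \<open>
  Positive definite, as are all root lattices here. The Dynkin diagram is the chain from \<open>1\<close> to \<open>7\<close>
  with the node \<open>8\<close> attached to \<open>5\<close>, so the arms at \<open>5\<close> have \<open>4\<close>, \<open>2\<close> and \<open>1\<close> further nodes.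
\<close>

definition E8_gram :: "int^8^8" where
  "E8_gram = (\<chi> i j. if i = j then 2
     else if {i, j} \<in> {{1, 2}, {2, 3}, {3, 4}, {4, 5}, {5, 6}, {6, 7}, {5, 8}} then -1
     else 0)"

type_synonym prim_index = "8 + 8 + 2 + 2 + 2"

definition prim_gram :: "int^prim_index^prim_index" where
  "prim_gram = E8_gram \<oplus>\<^sub>L E8_gram \<oplus>\<^sub>L hyperbolic_gram \<oplus>\<^sub>L hyperbolic_gram \<oplus>\<^sub>L A2_gram"

definition T1_gram :: "int^3^3" where
  "T1_gram = vector [vector [-2, 1, 0], vector [1, 10, 0], vector [0, 0, -28]]"

subsection \<open>Isometries\<close>

definition isometries :: "int^'n^'n \<Rightarrow> (int^'n) set \<Rightarrow> (int^'n \<Rightarrow> int^'n) set" where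
  "isometries Q L = {g \<in> Bij L.
     (\<forall>x\<in>L. \<forall>y\<in>L. g (x + y) = g x + g y) \<and>
     (\<forall>x\<in>L. \<forall>y\<in>L. bform Q (g x) (g y) = bform Q x y)}"

text \<open>
  The \<open>K\<close>-linear extension of an additive map \<open>g\<close> on \<open>L\<close>. Since vectors of \<open>\<int>\<^sup>n\<close> that are independent
  over \<open>\<int>\<close> stay independent over \<open>K\<close>, an \<open>f\<close> as below exists, and its values on \<open>L \<otimes> K\<close>, the only ones
  used, do not depend on the choice.
\<close>

definition linear_ext :: "(int^'n) set \<Rightarrow> (int^'n \<Rightarrow> int^'n) \<Rightarrow> 'a::field_char_0^'n \<Rightarrow> 'a^'n" where
  "linear_ext L g = (SOME f. Vector_Spaces.linear (*s) (*s) f \<and> (\<forall>v\<in>L. f (embed v) = embed (g v)))"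

definition dual_lattice :: "int^'n^'n \<Rightarrow> (int^'n) set \<Rightarrow> (rat^'n) set" where
  "dual_lattice Q L = {x \<in> extend_scalars L. \<forall>v\<in>L. bform Q x (embed v) \<in> \<int>}"

definition trivial_on_discriminant ::
    "int^'n^'n \<Rightarrow> (int^'n) set \<Rightarrow> (int^'n \<Rightarrow> int^'n) \<Rightarrow> bool" where
  "trivial_on_discriminant Q L g \<longleftrightarrow>
     (\<forall>x\<in>dual_lattice Q L. linear_ext L g x - x \<in> embed ` L)"

definition fixed_sublattice :: "(int^'n \<Rightarrow> int^'n) set \<Rightarrow> (int^'n) set" where
  "fixed_sublattice G = {v. \<forall>g\<in>G. g v = v}"

subsection \<open>Projective spaces and period domains\<close>

definition quotient_topology :: "'a topology \<Rightarrow> ('a \<Rightarrow> 'b) \<Rightarrow> 'b topology" where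
  "quotient_topology X q = topology (\<lambda>U. U \<subseteq> q ` topspace X \<and> openin X {x \<in> topspace X. q x \<in> U})"

abbreviation line :: "complex^'n \<Rightarrow> (complex^'n) set" where
  "line x \<equiv> vec.span {x}"

definition projective_space :: "(complex^'n) set \<Rightarrow> (complex^'n) set topology" where
  "projective_space V = quotient_topology (top_of_set (V - {0})) line"

text \<open>
  Both components of the period domain. The number \<open>(x, \<xi>)\<close>, with \<open>\<xi>\<close> the conjugate of \<open>x\<close>, is real.
\<close>

definition full_period_domain :: "int^'n^'n \<Rightarrow> (int^'n) set \<Rightarrow> (complex^'n) set topology" where
  "full_period_domain Q L = subtopology (projective_space (extend_scalars L))
     {line x | x. x \<in> extend_scalars L \<and> bform Q x x = 0 \<and> Re (bform Q x (\<chi> i. cnj (x $ i))) < 0}"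

definition is_period_domain ::
    "int^'n^'n \<Rightarrow> (int^'n) set \<Rightarrow> (complex^'n) set set \<Rightarrow> bool" where
  "is_period_domain Q L D \<longleftrightarrow> D \<in> connected_components_of (full_period_domain Q L)"

definition period_domain_topology ::
    "int^'n^'n \<Rightarrow> (int^'n) set \<Rightarrow> (complex^'n) set set \<Rightarrow> (complex^'n) set topology" where
  "period_domain_topology Q L D = subtopology (full_period_domain Q L) D"

definition line_action ::
    "(int^'n) set \<Rightarrow> (int^'n \<Rightarrow> int^'n) \<Rightarrow> (complex^'n) set \<Rightarrow> (complex^'n) set" where
  "line_action L g l = linear_ext L g ` l"

subsection \<open>The groups acting on the period domains\<close>

definition Gamma_hat ::
    "int^'n^'n \<Rightarrow> (complex^'n) set set \<Rightarrow> (int^'n \<Rightarrow> int^'n) monoid" where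
  "Gamma_hat Q D = (BijGroup UNIV)\<lparr>carrier := {g \<in> isometries Q UNIV.
     trivial_on_discriminant Q UNIV g \<and> line_action UNIV g ` D = D}\<rparr>"

definition Gamma_fixed ::
    "int^'n^'n \<Rightarrow> (complex^'n) set set \<Rightarrow> (int^'n \<Rightarrow> int^'n) set \<Rightarrow> (int^'n \<Rightarrow> int^'n) monoid" where
  "Gamma_fixed Q D G = (BijGroup (fixed_sublattice G))\<lparr>carrier :=
     (\<lambda>g. restrict g (fixed_sublattice G)) ` normalizer (Gamma_hat Q D) G\<rparr>"

definition quotient_curve ::
    "int^'n^'n \<Rightarrow> (int^'n) set \<Rightarrow> (int^'n \<Rightarrow> int^'n) monoid \<Rightarrow> (complex^'n) set set
      \<Rightarrow> (complex^'n) set set topology" where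
  "quotient_curve Q L \<Gamma> D =
     quotient_topology (period_domain_topology Q L D) (orbit \<Gamma> (line_action L))"

subsection \<open>\<open>PSL\<^sub>2\<close>\<close>

definition SL2 :: "('a::comm_ring_1^2^2) monoid" where
  "SL2 = \<lparr>carrier = {A. det A = 1}, mult = (**), one = mat 1\<rparr>"

definition SL2_center :: "('a::comm_ring_1^2^2) set" where
  "SL2_center = {A \<in> carrier SL2. \<exists>c. A = mat c}"

definition PSL2 :: "('a::comm_ring_1^2^2) set monoid" where
  "PSL2 = SL2 Mod SL2_center"

definition PSL2_class :: "'a::comm_ring_1^2^2 \<Rightarrow> ('a^2^2) set" where
  "PSL2_class A = SL2_center #>\<^bsub>SL2\<^esub> A"

definition PSL2_Z :: "(real^2^2) set set" where
  "PSL2_Z = {PSL2_class (\<chi> i j. real_of_int (A $ i $ j)) | A :: int^2^2. det A = 1}"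

subsection \<open>Isogeny of arithmetic quotients of the upper half plane\<close>

definition upper_half_plane :: "complex set" where
  "upper_half_plane = {z. Im z > 0}"

definition moebius :: "real^2^2 \<Rightarrow> complex \<Rightarrow> complex" where
  "moebius A z = (of_real (A $ 1 $ 1) * z + of_real (A $ 1 $ 2)) /
                 (of_real (A $ 2 $ 1) * z + of_real (A $ 2 $ 2))"

text \<open>
  Isomorphisms of the upper half plane with a one-dimensional period domain. A map to projective
  space is holomorphic if it lifts locally to a holomorphic map into the vector space without \<open>0\<close>;
  the inverse of a holomorphic homeomorphism between Riemann surfaces is automatically holomorphic.
\<close>

definition half_plane_iso ::
    "int^'n^'n \<Rightarrow> (int^'n) set \<Rightarrow> (complex^'n) set set \<Rightarrow> (complex \<Rightarrow> (complex^'n) set) \<Rightarrow> bool" where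
  "half_plane_iso Q L D \<psi> \<longleftrightarrow>
     homeomorphic_map (top_of_set upper_half_plane) (period_domain_topology Q L D) \<psi> \<and>
     (\<forall>z\<in>upper_half_plane. \<exists>U f. open U \<and> z \<in> U \<and> U \<subseteq> upper_half_plane \<and>
        (\<forall>i. (\<lambda>w. f w $ i) holomorphic_on U) \<and> (\<forall>w\<in>U. f w \<noteq> 0 \<and> \<psi> w = line (f w)))"

text \<open>
  The image in \<open>PSL(2,\<real>)\<close> of a group acting holomorphically on \<open>D\<close>. It is well defined because
  \<open>PSL(2,\<real>)\<close> is the holomorphic automorphism group of the upper half plane.
\<close>

definition PSL2_image ::
    "(int^'n) set \<Rightarrow> (int^'n \<Rightarrow> int^'n) monoid \<Rightarrow> (complex \<Rightarrow> (complex^'n) set) \<Rightarrow> (real^2^2) set set" where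
  "PSL2_image L \<Gamma> \<psi> = {PSL2_class A | A. det A = 1 \<and>
     (\<exists>\<gamma>\<in>carrier \<Gamma>. \<forall>z\<in>upper_half_plane. \<psi> (moebius A z) = line_action L \<gamma> (\<psi> z))}"

definition commensurable :: "('a, 'b) monoid_scheme \<Rightarrow> 'a set \<Rightarrow> 'a set \<Rightarrow> bool" where
  "commensurable G H K \<longleftrightarrow>
     finite (rcosets\<^bsub>G\<lparr>carrier := H\<rparr>\<^esub> (H \<inter> K)) \<and> finite (rcosets\<^bsub>G\<lparr>carrier := K\<rparr>\<^esub> (H \<inter> K))"

definition isogenous :: "(real^2^2) set set \<Rightarrow> (real^2^2) set set \<Rightarrow> bool" where
  "isogenous H K \<longleftrightarrow>
     (\<exists>c\<in>carrier PSL2. commensurable PSL2 (c <#\<^bsub>PSL2\<^esub> H #>\<^bsub>PSL2\<^esub> (inv\<^bsub>PSL2\<^esub> c)) K)"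

end

theory Submission
  imports Defs
begin

no_notation fps_nth (infixl "$" 75)

text \<open>
  The rational quadratic form of \<open>T1\<close> is anisotropic at 7. For a point \<open>x\<close> of the period domain let the
  majorant at \<open>x\<close> be the positive definite form obtained by changing the sign on the negative plane of
  \<open>x\<close>. It has the same determinant, and by anisotropy it is at least 1 on nonzero lattice
  vectors; hence there is a basis of \<open>T1\<close> of bounded majorant at \<open>x\<close>, with only finitely
  many Gram matrices. Two points with reduced bases of the same Gram matrix and the same residues modulo
  588 (the determinant) are related by an isometry that extends by the identity on the
  orthogonal complement of \<open>T1\<close>. The points for which a given basis is reduced form a compact set, so finitely
  many of these sets cover the quotient.

  The same finiteness shows that an isometry with points of arbitrarily small displacement has a fixed
  point. A group commensurable with \<open>PSL2_Z\<close> contains a parabolic element, whose displacement tends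
  to 0 by the Schwarz lemma although it has no fixed point.
\<close>

text \<open>\<open>Gamma_fixed\<close> is given only as the image of a normalizer, and two one-sided
  facts about it carry the proof. For compactness it has to be large: since 588 times the identity
  is the adjugate of the Gram matrix times that matrix, an isometry of T1 congruent to 1 modulo 588
  has the form \<open>mat 1 + A ** T1_gram\<close> with \<open>A\<close> integral. Its extension
  adds to each vector a combination of the basis with coefficients \<open>A\<close> times the
  pairings of the vector with the basis. This is integral, trivial on the discriminant group, and
  commutes with \<open>G\<close>. For the failure of isogeny the group has to be discrete, which
  enters as integrality of its matrices.

  An obstacle throughout is that the quadric has two negative components and an isometry may
  exchange them. The real number \<open>orient\<close> turns this into a sign: it is never 0 on
  period vectors and is positive exactly on pairs in one component.

  The isomorphism with the upper half plane is an arbitrary holomorphic one, so no formula for it is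
  available. Displacements are therefore measured by a ratio of pairings, which depends only on
  lines.\<close>

lemma of_int_int [simp]: "(of_int :: int \<Rightarrow> int) = id"
  by (auto simp: fun_eq_iff)

section \<open>Bilinear forms, extension of scalars and complex conjugation\<close>

lemma bform_add_left: "bform Q (x + y) z = bform Q x z + bform Q y z"
  by (simp add: bform_def algebra_simps sum.distrib)

lemma bform_add_right: "bform Q z (x + y) = bform Q z x + bform Q z y"
  by (simp add: bform_def algebra_simps sum.distrib)

lemma bform_scale_left: "bform Q (c *s x) z = c * bform Q x z"
  by (simp add: bform_def algebra_simps sum_distrib_left)

lemma bform_scale_right: "bform Q z (c *s x) = c * bform Q z x"
  by (simp add: bform_def algebra_simps sum_distrib_left)

lemma bform_zero_left [simp]: "bform Q 0 x = 0"
  by (simp add: bform_def)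

lemma bform_zero_right [simp]: "bform Q x 0 = 0"
  by (simp add: bform_def)

lemma bform_minus_left: "bform Q (- x) z = - bform Q x z"
  by (simp add: bform_def sum_negf)

lemma bform_minus_right: "bform Q z (- x) = - bform Q z x"
  by (simp add: bform_def sum_negf)

lemma bform_diff_left: "bform Q (x - y) z = bform Q x z - bform Q y z"
  using bform_add_left[of Q x "- y" z] by (simp add: bform_minus_left)

lemma bform_diff_right: "bform Q z (x - y) = bform Q z x - bform Q z y"
  using bform_add_right[of Q z x "- y"] by (simp add: bform_minus_right)

lemma bform_sum_left: "bform Q (\<Sum>i\<in>I. f i) z = (\<Sum>i\<in>I. bform Q (f i) z)"
  by (induction I rule: infinite_finite_induct) (auto simp: bform_add_left)

lemma bform_sum_right: "bform Q z (\<Sum>i\<in>I. f i) = (\<Sum>i\<in>I. bform Q z (f i))"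
  by (induction I rule: infinite_finite_induct) (auto simp: bform_add_right)

lemmas bform_linear = bform_add_left bform_add_right bform_scale_left bform_scale_right
  bform_diff_left bform_diff_right bform_minus_left bform_minus_right

lemma bform_commute:
  assumes "transpose Q = Q"
  shows "bform Q x y = bform Q y x"
proof -
  have *: "Q $ i $ j = Q $ j $ i" for i j
    by (metis assms transpose_def vec_lambda_beta)
  show ?thesis
    unfolding bform_def
    by (subst sum.swap, intro sum.cong refl) (use * in \<open>metis mult.assoc mult.commute\<close>)
qed

lemma bform_embed: "bform Q (embed x) (embed y) = of_int (bform Q x y)"
  by (simp add: bform_def embed_def)

lemma embed_add: "embed (x + y) = embed x + embed y"
  by (simp add: embed_def vec_eq_iff)

lemma embed_diff: "embed (x - y) = embed x - embed y"
  by (simp add: embed_def vec_eq_iff)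

lemma embed_scale: "embed (c *s x) = of_int c *s embed x"
  by (simp add: embed_def vec_eq_iff)

lemma embed_zero [simp]: "embed 0 = 0"
  by (simp add: embed_def vec_eq_iff)

lemma embed_sum: "embed (\<Sum>i\<in>I. f i) = (\<Sum>i\<in>I. embed (f i))"
  by (induction I rule: infinite_finite_induct) (auto simp: embed_add)

lemma embed_int [simp]: "(embed x :: int^'n) = x"
  by (simp add: embed_def)

lemma embed_nth [simp]: "embed x $ i = of_int (x $ i)"
  by (simp add: embed_def)

definition vcnj :: "complex^'n \<Rightarrow> complex^'n" where
  "vcnj x = (\<chi> i. cnj (x $ i))"

lemma vcnj_nth [simp]: "vcnj x $ i = cnj (x $ i)"
  by (simp add: vcnj_def)

lemma vcnj_vcnj [simp]: "vcnj (vcnj x) = x"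
  by (simp add: vec_eq_iff)

lemma vcnj_add: "vcnj (x + y) = vcnj x + vcnj y"
  by (simp add: vec_eq_iff)

lemma vcnj_scale: "vcnj (c *s x) = cnj c *s vcnj x"
  by (simp add: vec_eq_iff)

lemma vcnj_zero [simp]: "vcnj 0 = 0"
  by (simp add: vec_eq_iff)

lemma vcnj_embed [simp]: "vcnj (embed v) = embed v"
  by (simp add: vec_eq_iff)

lemma vcnj_sum: "vcnj (\<Sum>i\<in>I. f i) = (\<Sum>i\<in>I. vcnj (f i))"
  by (induction I rule: infinite_finite_induct) (auto simp: vcnj_add)

lemma bform_vcnj: "bform Q (vcnj x) (vcnj y) = cnj (bform Q x y)"
  by (simp add: bform_def)

lemma bform_vcnj_left: "bform Q (vcnj x) y = cnj (bform Q x (vcnj y))"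
  by (metis bform_vcnj vcnj_vcnj)

definition of_real_vec :: "real^'n \<Rightarrow> complex^'n" where
  "of_real_vec x = (\<chi> i. of_real (x $ i))"

lemma of_real_vec_nth [simp]: "of_real_vec x $ i = of_real (x $ i)"
  by (simp add: of_real_vec_def)

lemma bform_of_real_vec: "bform Q (of_real_vec x) (of_real_vec y) = of_real (bform Q x y)"
  by (simp add: bform_def)

definition Re_vec :: "complex^'n \<Rightarrow> real^'n" where "Re_vec x = (\<chi> i. Re (x $ i))"
definition Im_vec :: "complex^'n \<Rightarrow> real^'n" where "Im_vec x = (\<chi> i. Im (x $ i))"

lemma Re_Im_vec: "x = of_real_vec (Re_vec x) + \<i> *s of_real_vec (Im_vec x)"
  by (simp add: vec_eq_iff Re_vec_def Im_vec_def complex_eq)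

lemma vcnj_Re_Im_vec: "vcnj x = of_real_vec (Re_vec x) - \<i> *s of_real_vec (Im_vec x)"
  by (simp add: vec_eq_iff Re_vec_def Im_vec_def complex_eq_iff)

lemma bform_Re_Im:
  "bform Q x y = Complex (bform Q (Re_vec x) (Re_vec y) - bform Q (Im_vec x) (Im_vec y))
                         (bform Q (Re_vec x) (Im_vec y) + bform Q (Im_vec x) (Re_vec y))"
  by (subst (1) Re_Im_vec[of x], subst (1) Re_Im_vec[of y])
     (simp add: bform_linear bform_of_real_vec complex_eq_iff)

lemma bform_Re_Im_vcnj:
  "bform Q x (vcnj y) = Complex (bform Q (Re_vec x) (Re_vec y) + bform Q (Im_vec x) (Im_vec y))
                         (bform Q (Im_vec x) (Re_vec y) - bform Q (Re_vec x) (Im_vec y))"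
  by (subst (1) Re_Im_vec[of x], subst (1) vcnj_Re_Im_vec[of y])
     (simp add: bform_linear bform_of_real_vec complex_eq_iff)

section \<open>The signature of the primitive lattice\<close>

lemma bform_direct_sum:
  "bform (A \<oplus>\<^sub>L B) x y =
     bform A (\<chi> i. x $ Inl i) (\<chi> i. y $ Inl i) + bform B (\<chi> i. x $ Inr i) (\<chi> i. y $ Inr i)"
  by (simp add: bform_def direct_sum_gram_def UNIV_Plus_UNIV[symmetric] sum.Plus
      del: UNIV_Plus_UNIV)

lemma sum_8: "sum f (UNIV :: 8 set) = f 1 + f 2 + f 3 + f 4 + f 5 + f 6 + f 7 + f 8"
proof -
  have "card {1, 2, 3, 4, 5, 6, 7, 8 :: 8} = 8"
    by simp
  then have *: "(UNIV :: 8 set) = {1, 2, 3, 4, 5, 6, 7, 8}"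
    by (intro card_subset_eq[symmetric]) auto
  show ?thesis
    unfolding * by (simp add: add.assoc)
qed

lemma E8_gram_nth:
  "E8_gram $ i $ j = (if i = j then 2 else if (i, j) \<in> {(1,2), (2,1), (2,3), (3,2), (3,4), (4,3),
     (4,5), (5,4), (5,6), (6,5), (6,7), (7,6), (5,8), (8,5)} then -1 else 0)"
  unfolding E8_gram_def by (simp add: doubleton_eq_iff)

text \<open>Squares are completed along the Dynkin diagram, from the ends of the three arms towards
  node 5. What remains at node 5 is \<open>2 - 4/5 - 2/3 - 1/2 = 1/30\<close>, so the form is
  positive definite.\<close>

lemma bform_E8:
  fixes x :: "real^8"
  shows "bform E8_gram x x =
    2 * (x$1 - x$2/2)\<^sup>2 + 3/2 * (x$2 - 2/3 * x$3)\<^sup>2 + 4/3 * (x$3 - 3/4 * x$4)\<^sup>2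
    + 5/4 * (x$4 - 4/5 * x$5)\<^sup>2 + 2 * (x$7 - x$6/2)\<^sup>2 + 3/2 * (x$6 - 2/3 * x$5)\<^sup>2
    + 2 * (x$8 - x$5/2)\<^sup>2 + 1/30 * (x$5)\<^sup>2"
  unfolding bform_def sum_8 E8_gram_nth by (simp add: power2_eq_square field_simps)

lemma bform_2: "bform Q (x::'a::comm_ring_1^2) y = of_int (Q$1$1) * x$1 * y$1 + of_int (Q$1$2) * x$1 * y$2
  + of_int (Q$2$1) * x$2 * y$1 + of_int (Q$2$2) * x$2 * y$2"
  by (simp add: bform_def sum_2)

lemma bform_A2_nonneg: "0 \<le> bform A2_gram (x::real^2) x"
proof -
  have "bform A2_gram x x = (x$1)\<^sup>2 + (x$2)\<^sup>2 + (x$1 - x$2)\<^sup>2"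
    by (simp add: bform_2 A2_gram_def vector_2 power2_eq_square algebra_simps)
  then show ?thesis by simp
qed

lemma bform_hyperbolic: "bform hyperbolic_gram x x = 2 * x$1 * x$2"
  by (simp add: bform_2 hyperbolic_gram_def vector_2)

text \<open>The kernel of these two functionals avoids the negative directions of the two hyperbolic planes.\<close>

definition neg1 :: "real^prim_index \<Rightarrow> real" where
  "neg1 v = v $ Inr (Inr (Inl 1)) - v $ Inr (Inr (Inl 2))"
definition neg2 :: "real^prim_index \<Rightarrow> real" where
  "neg2 v = v $ Inr (Inr (Inr (Inl 1))) - v $ Inr (Inr (Inr (Inl 2)))"

lemma prim_gram_nonneg:
  assumes "neg1 v = 0" "neg2 v = 0"
  shows "0 \<le> bform prim_gram v v"
  using assms unfolding prim_gram_def bform_direct_sum bform_hyperbolic bform_E8 neg1_def neg2_def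
  by (auto intro!: add_nonneg_nonneg bform_A2_nonneg)

text \<open>The cross product of the two rows is a solution. If it vanishes, the rows are
  proportional and a solution is read off from the first two columns.\<close>

lemma two_equations:
  fixes p q :: "real \<times> real \<times> real"
  obtains s t r where "(s, t, r) \<noteq> (0, 0, 0::real)"
    "s * fst p + t * fst (snd p) + r * snd (snd p) = 0" "s * fst q + t * fst (snd q) + r * snd (snd q) = 0"
proof -
  obtain a b c d e f where [simp]: "p = (a, b, c)" "q = (d, e, f)" by (metis surj_pair)
  show ?thesis
  proof (cases "(b*f - c*e, c*d - a*f, a*e - b*d) = (0,0,0)")
    case False
    then show ?thesis
      using that[of "b*f - c*e" "c*d - a*f" "a*e - b*d"] by (auto simp: algebra_simps)
  next
    case True
    then have z: "b*f = c*e" "c*d = a*f" "a*e = b*d" by auto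
    show ?thesis
    proof (cases "a = 0 \<and> d = 0")
      case True
      then show ?thesis using that[of 1 0 0] by simp
    next
      case F: False
      show ?thesis
      proof (cases "a = 0")
        case True
        then show ?thesis using z F that[of "-e" d 0] by (auto simp: algebra_simps)
      next
        case False
        then show ?thesis using z that[of "-b" a 0] by (auto simp: algebra_simps)
      qed
    qed
  qed
qed

text \<open>The consequence of signature \<open>(n, 2)\<close> on which the theory of period domains
  rests. Semidefiniteness on the complement of a negative pair is enough, and it can be checked
  without diagonalising the form.\<close>

definition two_negative :: "int^'n^'n \<Rightarrow> bool" where
  "two_negative Q \<longleftrightarrow> (\<forall>a b v :: real^'n. bform Q a a < 0 \<longrightarrow> bform Q b b < 0 \<longrightarrow> bform Q a b = 0 \<longrightarrow>
      bform Q a v = 0 \<longrightarrow> bform Q b v = 0 \<longrightarrow> 0 \<le> bform Q v v)"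

lemma transpose_direct_sum: "transpose A = A \<Longrightarrow> transpose B = B \<Longrightarrow> transpose (A \<oplus>\<^sub>L B) = A \<oplus>\<^sub>L B"
  by (auto simp: transpose_def direct_sum_gram_def vec_eq_iff split: sum.splits)

lemma prim_gram_symmetric: "transpose prim_gram = prim_gram"
proof -
  have "transpose E8_gram = E8_gram"
    by (simp add: transpose_def E8_gram_def vec_eq_iff insert_commute eq_commute)
  moreover have "transpose hyperbolic_gram = hyperbolic_gram" "transpose A2_gram = A2_gram"
    by (auto simp: transpose_def hyperbolic_gram_def A2_gram_def vec_eq_iff forall_2 vector_2)
  ultimately show ?thesis
    unfolding prim_gram_def by (intro transpose_direct_sum)
qed

lemma two_negative_prim_gram: "two_negative prim_gram"
  unfolding two_negative_def
proof (intro allI impI, rule ccontr)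
  fix a b v :: "real^prim_index"
  assume *: "bform prim_gram a a < 0" "bform prim_gram b b < 0" "bform prim_gram a b = 0"
      "bform prim_gram a v = 0" "bform prim_gram b v = 0" "\<not> 0 \<le> bform prim_gram v v"
  have sym: "bform prim_gram x y = bform prim_gram y x" for x y :: "real^prim_index"
    by (rule bform_commute[OF prim_gram_symmetric])
  obtain s t r where str: "(s, t, r) \<noteq> (0, 0, 0::real)"
    "s * neg1 a + t * neg1 b + r * neg1 v = 0" "s * neg2 a + t * neg2 b + r * neg2 v = 0"
    using two_equations[of "(neg1 a, neg1 b, neg1 v)" "(neg2 a, neg2 b, neg2 v)"] by auto
  \<comment> \<open>Three mutually orthogonal negative vectors span a space on which the two
    functionals have a common nonzero zero; the form is negative there, against
    \<open>prim_gram_nonneg\<close>.\<close>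
  define w where "w = s *s a + t *s b + r *s v"
  have "neg1 w = 0" "neg2 w = 0"
    using str(2,3) by (simp_all add: w_def neg1_def neg2_def algebra_simps)
  then have "0 \<le> bform prim_gram w w"
    by (rule prim_gram_nonneg)
  also have "bform prim_gram w w
      = s\<^sup>2 * bform prim_gram a a + t\<^sup>2 * bform prim_gram b b + r\<^sup>2 * bform prim_gram v v"
    using * sym[of b a] sym[of v a] sym[of v b]
    by (simp add: w_def bform_linear power2_eq_square)
  also have "\<dots> < 0"
  proof -
    have "s\<^sup>2 * bform prim_gram a a \<le> 0" "t\<^sup>2 * bform prim_gram b b \<le> 0" "r\<^sup>2 * bform prim_gram v v \<le> 0"
      using * by (auto intro: mult_nonneg_nonpos)
    moreover have "s\<^sup>2 * bform prim_gram a a < 0 \<or> t\<^sup>2 * bform prim_gram b b < 0 \<or> r\<^sup>2 * bform prim_gram v v < 0"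
      using str(1) * by (auto simp: mult_less_0_iff)
    ultimately show ?thesis by linarith
  qed
  finally show False by simp
qed

section \<open>Quotient topologies, lines and the components of the period domain\<close>

lemma openin_quotient_topology:
  "openin (quotient_topology X q) U \<longleftrightarrow> U \<subseteq> q ` topspace X \<and> openin X {x \<in> topspace X. q x \<in> U}"
proof -
  have "istopology (\<lambda>U. U \<subseteq> q ` topspace X \<and> openin X {x \<in> topspace X. q x \<in> U})"
    unfolding istopology_def
  proof (intro conjI allI impI)
    fix S T
    assume *: "S \<subseteq> q ` topspace X \<and> openin X {x \<in> topspace X. q x \<in> S}"
      "T \<subseteq> q ` topspace X \<and> openin X {x \<in> topspace X. q x \<in> T}"
    then show "S \<inter> T \<subseteq> q ` topspace X" by auto
    have "{x \<in> topspace X. q x \<in> S \<inter> T} = {x \<in> topspace X. q x \<in> S} \<inter> {x \<in> topspace X. q x \<in> T}"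
      by auto
    with * show "openin X {x \<in> topspace X. q x \<in> S \<inter> T}" by auto
  next
    fix K
    assume *: "\<forall>U\<in>K. U \<subseteq> q ` topspace X \<and> openin X {x \<in> topspace X. q x \<in> U}"
    then show "\<Union> K \<subseteq> q ` topspace X" by auto
    have "{x \<in> topspace X. q x \<in> \<Union> K} = (\<Union>U\<in>K. {x \<in> topspace X. q x \<in> U})"
      by auto
    with * show "openin X {x \<in> topspace X. q x \<in> \<Union> K}" by auto
  qed
  then show ?thesis
    by (simp add: quotient_topology_def)
qed

lemma topspace_quotient_topology [simp]: "topspace (quotient_topology X q) = q ` topspace X"
proof (rule antisym)
  show "topspace (quotient_topology X q) \<subseteq> q ` topspace X"
    using openin_quotient_topology[of X q "topspace (quotient_topology X q)"] by auto
  have "{x \<in> topspace X. q x \<in> q ` topspace X} = topspace X" by auto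
  then have "openin (quotient_topology X q) (q ` topspace X)"
    by (simp add: openin_quotient_topology)
  then show "q ` topspace X \<subseteq> topspace (quotient_topology X q)"
    by (rule openin_subset)
qed

lemma continuous_map_quotient_topology: "continuous_map X (quotient_topology X q) q"
  by (auto simp: continuous_map_def openin_quotient_topology)

lemma continuous_on_bform:
  assumes "continuous_on S f" "continuous_on S g"
  shows "continuous_on S (\<lambda>x. bform Q (f x) (g x) :: 'b::{comm_ring_1, real_normed_algebra_1})"
  unfolding bform_def using assms by (intro continuous_intros)

lemma continuous_on_vcnj:
  assumes "continuous_on S f"
  shows "continuous_on S (\<lambda>x. vcnj (f x))"
  unfolding vcnj_def using assms by (intro continuous_intros)

lemma continuous_on_scale:
  fixes g :: "'a::topological_space \<Rightarrow> 'b::real_normed_algebra_1^'n"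
  assumes "continuous_on S f" "continuous_on S g"
  shows "continuous_on S (\<lambda>x. f x *s g x)"
  unfolding vector_scalar_mult_def using assms by (intro continuous_intros)

lemma line_eq: "line x = range (\<lambda>c. c *s x)"
  by (rule vec.span_singleton)

lemma line_scale:
  assumes "c \<noteq> 0"
  shows "line (c *s x) = line x"
proof -
  have "range (\<lambda>d. d * c) = UNIV"
    using assms by (intro surjI[of _ "\<lambda>d. d / c"]) simp
  moreover have "line (c *s x) = (\<lambda>d. d *s x) ` range (\<lambda>d. d * c)"
    by (simp add: line_eq image_image)
  ultimately show ?thesis
    by (simp add: line_eq)
qed

lemma line_eq_lineE:
  assumes "line x = line y" "x \<noteq> 0"
  obtains c where "c \<noteq> 0" "x = c *s y"
proof -
  have "x \<in> line y" using assms(1) vec.span_base[of x "{x}"] by simp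
  then obtain c where "x = c *s y" by (auto simp: line_eq)
  with assms(2) show ?thesis using that by (cases "c = 0") auto
qed

lemma subspace_extend_scalars: "vec.subspace (extend_scalars L)"
  by (simp add: extend_scalars_def)

lemma vcnj_extend_scalars: "x \<in> extend_scalars L \<Longrightarrow> vcnj x \<in> extend_scalars L"
  unfolding extend_scalars_def
proof (induction rule: vec.span_induct_alt)
  case base
  then show ?case by (simp add: vec.span_zero)
next
  case (step c x y)
  then show ?case
    by (auto simp: vcnj_add vcnj_scale intro!: vec.span_add vec.span_scale intro: vec.span_base)
qed

lemma extend_scalars_UNIV [simp]: "extend_scalars UNIV = UNIV"
proof -
  have "x \<in> extend_scalars UNIV" for x :: "'a::field^'n"
  proof -
    have "(axis i 1 :: 'a^'n) \<in> extend_scalars UNIV" for i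
    proof -
      have "embed (axis i 1) = (axis i 1 :: 'a^'n)"
        by (simp add: vec_eq_iff axis_def)
      then show ?thesis
        unfolding extend_scalars_def using vec.span_base[OF rangeI[of "embed :: _ \<Rightarrow> 'a^'n" "axis i 1"]]
        by simp
    qed
    then have "(\<Sum>i\<in>UNIV. x $ i *s axis i 1) \<in> extend_scalars UNIV"
      by (intro vec.subspace_sum vec.subspace_scale subspace_extend_scalars)
    then show ?thesis
      by (simp add: basis_expansion)
  qed
  then show ?thesis by auto
qed

text \<open>Four times the determinant of the pairings of \<open>Re_vec x\<close>,
  \<open>Im_vec x\<close> with \<open>Re_vec y\<close>, \<open>Im_vec y\<close>. Its sign tells
  whether orthogonal projection between the two negative planes respects their orientations.
  Rescaling either vector multiplies it by a positive number.\<close>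

definition orient :: "int^'n^'n \<Rightarrow> complex^'n \<Rightarrow> complex^'n \<Rightarrow> real" where
  "orient Q x y = (cmod (bform Q x (vcnj y)))\<^sup>2 - (cmod (bform Q x y))\<^sup>2"

definition period_vectors :: "int^'n^'n \<Rightarrow> (complex^'n) set \<Rightarrow> (complex^'n) set" where
  "period_vectors Q W = {x \<in> W. bform Q x x = 0 \<and> Re (bform Q x (vcnj x)) < 0}"

lemma period_vectors_nonzero: "x \<in> period_vectors Q W \<Longrightarrow> x \<noteq> 0"
  by (auto simp: period_vectors_def)

lemma period_vectors_scale:
  assumes "vec.subspace W" "x \<in> period_vectors Q W" "c \<noteq> 0"
  shows "c *s x \<in> period_vectors Q W"
proof -
  have "bform Q (c *s x) (vcnj (c *s x)) = of_real ((cmod c)\<^sup>2) * bform Q x (vcnj x)"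
    unfolding complex_norm_square by (simp add: vcnj_scale bform_linear)
  then show ?thesis
    using assms by (auto simp: period_vectors_def vec.subspace_scale bform_linear mult_less_0_iff)
qed

lemma orient_scale_right: "orient Q x (c *s y) = (cmod c)\<^sup>2 * orient Q x y"
  by (simp add: orient_def bform_linear norm_mult power_mult_distrib algebra_simps vcnj_scale)

lemma orient_vcnj_left: "orient Q (vcnj x) y = - orient Q x y"
  by (simp add: orient_def bform_vcnj) (simp add: bform_vcnj_left)

lemma orient_vcnj_vcnj: "orient Q (vcnj x) (vcnj y) = orient Q x y"
  by (simp add: orient_def bform_vcnj) (simp add: bform_vcnj_left)

lemma continuous_on_orient:
  assumes "continuous_on S f" "continuous_on S g"
  shows "continuous_on S (\<lambda>x. orient Q (f x) (g x))"
  unfolding orient_def using assms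
  by (intro continuous_intros continuous_on_bform continuous_on_vcnj)

lemma lines_eq_image:
  "{line x | x. x \<in> W \<and> bform Q x x = 0 \<and> Re (bform Q x (\<chi> i. cnj (x $ i))) < 0}
    = line ` period_vectors Q W"
  unfolding period_vectors_def vcnj_def by blast

lemma topspace_full_period_domain:
  "topspace (full_period_domain Q L) = line ` period_vectors Q (extend_scalars L)"
proof -
  have "period_vectors Q (extend_scalars L) \<subseteq> extend_scalars L - {0}"
    by (auto simp: period_vectors_def)
  then have "line ` period_vectors Q (extend_scalars L) \<subseteq> line ` (extend_scalars L - {0})"
    by (rule image_mono)
  then show ?thesis
    unfolding full_period_domain_def projective_space_def lines_eq_image
    by (simp add: Int_absorb1)
qed

lemma continuous_map_line:
  "continuous_map (top_of_set (period_vectors Q (extend_scalars L))) (full_period_domain Q L) line"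
  unfolding full_period_domain_def
proof (rule continuous_map_into_subtopology)
  have "period_vectors Q (extend_scalars L) \<subseteq> extend_scalars L - {0}"
    by (auto simp: period_vectors_def)
  then show "continuous_map (top_of_set (period_vectors Q (extend_scalars L)))
     (projective_space (extend_scalars L)) line"
    using continuous_map_from_subtopology[OF continuous_map_quotient_topology
        [of "top_of_set (extend_scalars L - {0})" line], of "period_vectors Q (extend_scalars L)"]
    unfolding projective_space_def by (simp add: subtopology_subtopology Int_absorb1)
next
  show "line \<in> topspace (top_of_set (period_vectors Q (extend_scalars L))) \<rightarrow>
    {line x |x. x \<in> extend_scalars L \<and> bform Q x x = 0 \<and> Re (bform Q x (\<chi> i. cnj (x $ i))) < 0}"
    unfolding lines_eq_image by (intro funcsetI imageI) simp
qed

locale period_space =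
  fixes Q :: "int^'n^'n"
  assumes symmetric: "transpose Q = Q"
begin

lemma bform_sym: "bform Q x y = bform Q y x"
  by (rule bform_commute[OF symmetric])

lemma hermitian_real: "bform Q x (vcnj x) = of_real (Re (bform Q x (vcnj x)))"
proof -
  have "cnj (bform Q x (vcnj x)) = bform Q x (vcnj x)"
    by (metis bform_sym bform_vcnj_left)
  then show ?thesis by (metis Reals_cnj_iff of_real_Re)
qed

lemma orient_commute: "orient Q x y = orient Q y x"
proof -
  have "bform Q x (vcnj y) = cnj (bform Q y (vcnj x))"
    by (metis bform_sym bform_vcnj_left)
  then show ?thesis by (simp add: orient_def bform_sym[of x y])
qed

lemma orient_self: "x \<in> period_vectors Q W \<Longrightarrow> 0 < orient Q x x"
  by (auto simp: orient_def period_vectors_def)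

text \<open>The vectors \<open>x\<close> and \<open>vcnj x\<close> are isotropic with pairing
  \<open>- c\<close>, so they span a nondegenerate plane; \<open>w\<close> is the part of
  \<open>y\<close> orthogonal to it. The two norm formulas reduce comparisons of two period vectors
  to the coefficients and to \<open>w\<close>.\<close>

lemma decomposition:
  fixes x y :: "complex^'n"
  assumes x: "x \<in> period_vectors Q W"
  defines "c \<equiv> - Re (bform Q x (vcnj x))"
  defines "\<alpha> \<equiv> - bform Q y (vcnj x) / of_real c" and "\<beta> \<equiv> - bform Q y x / of_real c"
  defines "w \<equiv> y - \<alpha> *s x - \<beta> *s vcnj x"
  shows "bform Q w x = 0" "bform Q w (vcnj x) = 0"
    "bform Q y y = bform Q w w - 2 * \<alpha> * \<beta> * of_real c"
    "Re (bform Q y (vcnj y)) = Re (bform Q w (vcnj w)) - ((cmod \<alpha>)\<^sup>2 + (cmod \<beta>)\<^sup>2) * c"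
proof -
  have c: "c > 0" using x by (simp add: period_vectors_def c_def)
  have xx: "bform Q x x = 0" "bform Q (vcnj x) (vcnj x) = 0"
    using x by (auto simp: period_vectors_def bform_vcnj)
  have xb: "bform Q x (vcnj x) = - of_real c" "bform Q (vcnj x) x = - of_real c"
    using hermitian_real[of x] by (auto simp: c_def bform_sym[of "vcnj x"])
  show w1: "bform Q w x = 0" and w2: "bform Q w (vcnj x) = 0"
    using c by (simp_all add: w_def bform_linear xx xb \<alpha>_def \<beta>_def)
  have w3: "bform Q x w = 0" "bform Q (vcnj x) w = 0"
    using w1 w2 by (simp_all add: bform_sym)
  have w4: "bform Q (vcnj w) x = 0" "bform Q x (vcnj w) = 0" "bform Q (vcnj x) (vcnj w) = 0"
    using w1 w2 by (simp_all add: bform_sym[of x] bform_vcnj bform_vcnj_left bform_sym[of x w])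
  have y: "y = \<alpha> *s x + \<beta> *s vcnj x + w"
    by (simp add: w_def)
  show "bform Q y y = bform Q w w - 2 * \<alpha> * \<beta> * of_real c"
    unfolding y by (simp add: bform_linear xx xb w1 w2 w3 algebra_simps)
  have vy: "vcnj y = cnj \<alpha> *s vcnj x + cnj \<beta> *s x + vcnj w"
    by (simp add: y vcnj_add vcnj_scale)
  have "bform Q y (vcnj y) = bform Q w (vcnj w) - (\<alpha> * cnj \<alpha> + \<beta> * cnj \<beta>) * of_real c"
    unfolding vy by (subst y) (simp add: bform_linear xx xb w1 w2 w3 w4 algebra_simps)
  then show "Re (bform Q y (vcnj y)) = Re (bform Q w (vcnj w)) - ((cmod \<alpha>)\<^sup>2 + (cmod \<beta>)\<^sup>2) * c"
    by (simp add: complex_norm_square[symmetric] del: of_real_power of_real_add) 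
qed

text \<open>
  Multiplying \<open>w\<close> by a phase makes \<open>(w, w)\<close> nonpositive, and then the real part of \<open>w\<close> has square
  \<open>((w, vcnj w) - \<bar>(w, w)\<bar>) / 2\<close>.
\<close>

lemma norm_le_hermitian:
  fixes w :: "complex^'n"
  assumes "two_negative Q" and x: "x \<in> period_vectors Q W"
    and w: "bform Q w x = 0" "bform Q w (vcnj x) = 0"
  shows "cmod (bform Q w w) \<le> Re (bform Q w (vcnj w))"
proof -
  define z where "z = bform Q w w"
  obtain \<zeta> where \<zeta>: "cmod \<zeta> = 1" "\<zeta>\<^sup>2 * z = - of_real (cmod z)"
  proof (cases "z = 0")
    case True
    then show ?thesis using that[of 1] by simp
  next
    case False
    define u where "u = - cnj z / of_real (cmod z)"
    have "cmod u = 1" using False by (simp add: u_def norm_divide)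
    moreover have "u * z = - of_real (cmod z)"
      using False by (simp add: u_def mult.commute[of "cnj z"] complex_norm_square[symmetric] power2_eq_square)
    ultimately show ?thesis
      using that[of "csqrt u"] by (simp add: norm_csqrt)
  qed
  define v where "v = \<zeta> *s w"
  have v: "bform Q v x = 0" "bform Q v (vcnj x) = 0"
    using w by (simp_all add: v_def bform_linear)
  have vv: "bform Q v v = - of_real (cmod z)"
    using \<zeta>(2) by (simp add: v_def bform_linear z_def power2_eq_square mult.assoc)
  have "bform Q v (vcnj v) = (\<zeta> * cnj \<zeta>) * bform Q w (vcnj w)"
    by (simp add: v_def bform_linear vcnj_scale)
  then have vvc: "bform Q v (vcnj v) = bform Q w (vcnj w)"
    using \<zeta>(1) by (simp add: complex_norm_square[symmetric])
  define a b u where "a = Re_vec x" and "b = Im_vec x" and "u = Re_vec v"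
  have "bform Q a u = 0" "bform Q b u = 0"
    using v unfolding bform_Re_Im[of Q v x] bform_Re_Im_vcnj[of Q v x] a_def b_def u_def
    by (auto simp: complex_eq_iff bform_sym)
  moreover have "bform Q x x = 0" "Re (bform Q x (vcnj x)) < 0"
    using x by (auto simp: period_vectors_def)
  then have "bform Q a b = 0" "bform Q a a < 0" "bform Q b b < 0"
    unfolding bform_Re_Im[of Q x x] bform_Re_Im_vcnj[of Q x x] a_def b_def
    by (auto simp: complex_eq_iff bform_sym[of "Im_vec x" "Re_vec x"])
  ultimately have "0 \<le> bform Q u u"
    using assms(1) unfolding two_negative_def by blast
  also have "2 * bform Q u u = Re (bform Q v (vcnj v)) + Re (bform Q v v)"
    unfolding bform_Re_Im[of Q v v] bform_Re_Im_vcnj[of Q v v] u_def by simp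
  finally show ?thesis
    by (simp add: vv vvc z_def)
qed

text \<open>Vanishing means that both coefficients in the decomposition of \<open>y\<close> have the
  same modulus m. Then \<open>(w, w)\<close> has modulus \<open>2 m^2 c\<close>, while
  \<open>(w, vcnj w)\<close> is smaller than \<open>2 m^2 c\<close>, against
  \<open>norm_le_hermitian\<close>.\<close>

lemma orient_nonzero:
  assumes "two_negative Q" and x: "x \<in> period_vectors Q W" and y: "y \<in> period_vectors Q W'"
  shows "orient Q x y \<noteq> 0"
proof
  assume 0: "orient Q x y = 0"
  define c where "c = - Re (bform Q x (vcnj x))"
  define \<alpha> where "\<alpha> = - bform Q y (vcnj x) / of_real c"
  define \<beta> where "\<beta> = - bform Q y x / of_real c"
  define w where "w = y - \<alpha> *s x - \<beta> *s vcnj x"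
  note d = decomposition[OF x, of y, folded c_def, folded \<alpha>_def \<beta>_def, folded w_def]
  have c: "c > 0" using x by (simp add: period_vectors_def c_def)
  have "cmod \<alpha> = cmod \<beta>"
    using 0 unfolding orient_commute[of x] by (simp add: \<alpha>_def \<beta>_def orient_def norm_divide)
  moreover have "cmod (bform Q w w) = 2 * cmod \<alpha> * cmod \<beta> * c"
    using c d(3) y by (simp add: period_vectors_def norm_mult)
  moreover have "Re (bform Q w (vcnj w)) < ((cmod \<alpha>)\<^sup>2 + (cmod \<beta>)\<^sup>2) * c"
    using d(4) y by (simp add: period_vectors_def)
  moreover have "cmod (bform Q w w) \<le> Re (bform Q w (vcnj w))"
    by (rule norm_le_hermitian[OF assms(1) x d(1,2)])
  ultimately show False
    by (simp add: power2_eq_square)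
qed

text \<open>
  After scaling, \<open>y = x + \<beta> vcnj x + w\<close> with \<open>\<bar>\<beta>\<bar> < 1\<close> and \<open>w\<close> orthogonal to \<open>x\<close> and \<open>vcnj x\<close>. The path
  \<open>x + t\<^sup>2 \<beta> vcnj x + t w\<close> stays on the quadric, and in the negative part because
  \<open>(1 - t\<^sup>2) (1 - \<bar>\<beta>\<bar>\<^sup>2 t\<^sup>2) \<ge> 0\<close>.
\<close>

lemma path_in_period_vectors:
  assumes W: "vec.subspace W" "\<And>z. z \<in> W \<Longrightarrow> vcnj z \<in> W"
    and x: "x \<in> period_vectors Q W" and y: "y \<in> period_vectors Q W" and pos: "0 < orient Q x y"
  obtains S where "connected S" "S \<subseteq> period_vectors Q W" "x \<in> S" "line y \<in> line ` S"
proof -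
  define c where "c = - Re (bform Q x (vcnj x))"
  define \<alpha> where "\<alpha> = - bform Q y (vcnj x) / of_real c"
  have c: "c > 0" using x by (simp add: period_vectors_def c_def)
  have "bform Q y (vcnj x) \<noteq> 0"
  proof
    assume "bform Q y (vcnj x) = 0"
    then show False
      using pos by (simp add: orient_commute[of x y]) (simp add: orient_def)
  qed
  then have \<alpha>0: "\<alpha> \<noteq> 0" using c by (simp add: \<alpha>_def)
  define y1 where "y1 = (1 / \<alpha>) *s y"
  have y1: "y1 \<in> period_vectors Q W"
    unfolding y1_def using \<alpha>0 by (intro period_vectors_scale W y) auto
  have line: "line y1 = line y" unfolding y1_def using \<alpha>0 by (intro line_scale) auto
  define \<beta> where "\<beta> = - bform Q y1 x / of_real c"
  have 1: "- bform Q y1 (vcnj x) / of_real c = 1"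
    using \<alpha>0 c by (simp add: y1_def bform_linear \<alpha>_def)
  define w where "w = y1 - x - \<beta> *s vcnj x"
  note d = decomposition[OF x, of y1, folded c_def, unfolded 1, folded \<beta>_def, simplified, folded w_def]
  have "0 < orient Q x y1" using pos \<alpha>0 by (simp add: y1_def orient_scale_right)
  then have "(cmod (bform Q y1 x))\<^sup>2 < (cmod (bform Q y1 (vcnj x)))\<^sup>2"
    unfolding orient_commute[of x] by (simp add: orient_def)
  moreover have "bform Q y1 (vcnj x) = - of_real c" using 1 c by (simp add: field_simps) (metis minus_minus)
  ultimately have "cmod (bform Q y1 x) < c"
    using c by (simp add: power2_less_imp_less)
  then have \<beta>1: "cmod \<beta> < 1" using c by (simp add: \<beta>_def norm_divide)
  define b where "b = (cmod \<beta>)\<^sup>2"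
  have b: "0 \<le> b" "b < 1" using \<beta>1 by (simp_all add: b_def abs_square_less_1)
  have ww: "bform Q w w = 2 * \<beta> * of_real c"
    using d(3) y1 by (simp add: period_vectors_def)
  have hw: "Re (bform Q w (vcnj w)) < (1 + b) * c"
    using d(4) y1 by (simp add: period_vectors_def b_def)
  define \<gamma> where "\<gamma> = (\<lambda>t::real. x + (of_real (t\<^sup>2) * \<beta>) *s vcnj x + of_real t *s w)"
  have "\<gamma> t \<in> period_vectors Q W" if t: "0 \<le> t" "t \<le> 1" for t
  proof -
    have wW: "w \<in> W" unfolding w_def
      using x y1 W by (auto simp: period_vectors_def intro!: vec.subspace_diff vec.subspace_scale)
    then have "\<gamma> t \<in> W" unfolding \<gamma>_def
      using x W by (auto simp: period_vectors_def intro!: vec.subspace_add vec.subspace_scale)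
    have cx: "bform Q x (vcnj x) = - of_real c" using hermitian_real[of x] by (simp add: c_def)
    have e1: "- bform Q (\<gamma> t) (vcnj x) / of_real c = 1"
      using c x d(2) by (simp add: \<gamma>_def bform_linear cx period_vectors_def bform_vcnj)
    have e2: "- bform Q (\<gamma> t) x / of_real c = of_real (t\<^sup>2) * \<beta>"
      using c x d(1) by (simp add: \<gamma>_def bform_linear cx period_vectors_def bform_sym[of "vcnj x" x])
    have e3: "\<gamma> t - 1 *s x - (of_real (t\<^sup>2) * \<beta>) *s vcnj x = of_real t *s w"
      by (simp add: \<gamma>_def)
    note e = decomposition[OF x, of "\<gamma> t", folded c_def, unfolded e1 e2 e3]
    have "bform Q (\<gamma> t) (\<gamma> t) = 0"
      using e(3) by (simp add: bform_linear ww power2_eq_square)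
    moreover have "Re (bform Q (\<gamma> t) (vcnj (\<gamma> t))) < 0"
    proof -
      define h where "h = Re (bform Q w (vcnj w))"
      have "Re (bform Q (\<gamma> t) (vcnj (\<gamma> t))) = t\<^sup>2 * h - (1 + (t\<^sup>2)\<^sup>2 * b) * c"
        using e(4) by (simp add: bform_linear vcnj_scale b_def norm_mult power_mult_distrib
            power2_eq_square h_def norm_power)
      also have "\<dots> < 0"
      proof (cases "t = 0")
        case True
        then show ?thesis using c by simp
      next
        case False
        define s where "s = t\<^sup>2"
        have s: "0 < s" "s \<le> 1" using False t by (auto simp: s_def power_le_one)
        have "0 \<le> (1 - s) * (1 - b * s)"
          using s b by (intro mult_nonneg_nonneg) (auto simp: mult_le_one)
        then have *: "s * (1 + b) \<le> 1 + s\<^sup>2 * b"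
          by (simp add: algebra_simps power2_eq_square)
        have "s * h < s * ((1 + b) * c)"
          using s hw unfolding h_def by (intro mult_strict_left_mono) auto
        also have "\<dots> \<le> (1 + s\<^sup>2 * b) * c"
          using * c by (metis mult.assoc mult_right_mono less_imp_le)
        finally show ?thesis by (simp add: s_def)
      qed
      finally show ?thesis .
    qed
    ultimately show ?thesis using \<open>\<gamma> t \<in> W\<close> by (simp add: period_vectors_def)
  qed
  moreover have "continuous_on {0..1} \<gamma>"
    unfolding \<gamma>_def by (intro continuous_intros continuous_on_scale)
  then have "connected (\<gamma> ` {0..1})"
    by (intro connected_continuous_image) auto
  moreover have "\<gamma> 0 = x" by (simp add: \<gamma>_def)
  then have "x \<in> \<gamma> ` {0..1}" by (metis atLeastAtMost_iff imageI le_numeral_extra(1) order_refl zero_le_one)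
  moreover have "\<gamma> 1 = y1" by (simp add: \<gamma>_def w_def)
  then have "line y \<in> line ` \<gamma> ` {0..1}"
    using line by (metis atLeastAtMost_iff image_eqI order_refl zero_le_one)
  ultimately show ?thesis
    using that[of "\<gamma> ` {0..1}"] by (meson image_subset_iff atLeastAtMost_iff)
qed

text \<open>The sign \<open>s\<close> treats both half spaces at once. Openness passes to lines
  because the sign of \<open>orient\<close> does not change under scaling.\<close>

lemma openin_orient:
  assumes "s = 1 \<or> s = (-1::real)"
  shows "openin (full_period_domain Q L)
     {l. \<exists>y\<in>period_vectors Q (extend_scalars L). l = line y \<and> 0 < s * orient Q x y}"
proof -
  define V where "V = extend_scalars L - {0::complex^'n}"
  define U where "U = {l. \<exists>y\<in>V. l = line y \<and> 0 < s * orient Q x y}"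
  have inv: "0 < s * orient Q x y \<longleftrightarrow> 0 < s * orient Q x y'" if yy: "line y = line y'" "y \<noteq> 0" for y y'
  proof -
    obtain c where "c \<noteq> 0" "y = c *s y'" using line_eq_lineE[OF yy] by blast
    then show ?thesis by (auto simp: orient_scale_right zero_less_mult_iff mult_less_0_iff)
  qed
  have pre: "{y \<in> V. line y \<in> U} = V \<inter> (\<lambda>y. s * orient Q x y) -` {0<..}"
    using inv unfolding U_def V_def by blast
  have "continuous_on V (\<lambda>y. s * orient Q x y)"
    by (intro continuous_intros continuous_on_orient)
  then have "openin (top_of_set V) {y \<in> V. line y \<in> U}"
    unfolding pre by (rule continuous_openin_preimage_gen) simp
  then have "openin (projective_space (extend_scalars L)) U"
    unfolding projective_space_def openin_quotient_topology V_def[symmetric] by (auto simp: U_def)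
  moreover have "{l. \<exists>y\<in>period_vectors Q (extend_scalars L). l = line y \<and> 0 < s * orient Q x y}
    = U \<inter> line ` period_vectors Q (extend_scalars L)" (is "?A = ?B")
  proof
    have "period_vectors Q (extend_scalars L) \<subseteq> V"
      by (auto simp: V_def period_vectors_def)
    then show "?A \<subseteq> ?B" unfolding U_def by blast
    show "?B \<subseteq> ?A"
    proof
      fix l assume "l \<in> ?B"
      then obtain z where z: "l = line z" "line z \<in> U" "z \<in> period_vectors Q (extend_scalars L)"
        by blast
      then have "0 < s * orient Q x z"
        using inv[of z] period_vectors_nonzero[OF z(3)] unfolding U_def by blast
      with z show "l \<in> ?A" by blast
    qed
  qed
  ultimately show ?thesis
    unfolding full_period_domain_def lines_eq_image by (simp add: openin_subtopology) blast
qed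

text \<open>Positive orientation gives a path inside the domain. Conversely, the two open sets given
  by the sign of \<open>orient\<close> cover the domain and are disjoint, so a connected set cannot
  meet both.\<close>

lemma period_domain_orient:
  assumes "two_negative Q" and D: "is_period_domain Q L D"
    and x: "x \<in> period_vectors Q (extend_scalars L)" "line x \<in> D"
    and y: "y \<in> period_vectors Q (extend_scalars L)"
  shows "line y \<in> D \<longleftrightarrow> 0 < orient Q x y"
proof
  assume "0 < orient Q x y"
  then obtain S where S: "connected S" "S \<subseteq> period_vectors Q (extend_scalars L)" "x \<in> S" "line y \<in> line ` S"
    using path_in_period_vectors[OF subspace_extend_scalars vcnj_extend_scalars x(1) y] by metis
  have "connectedin (full_period_domain Q L) (line ` S)"
    by (rule connectedin_continuous_map_image[OF continuous_map_line])
       (use S in \<open>auto simp: connectedin_subtopology\<close>)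
  moreover have "\<not> disjnt D (line ` S)" using x S by (auto simp: disjnt_iff)
  ultimately have "line ` S \<subseteq> D"
    using D connected_components_of_maximal unfolding is_period_domain_def by blast
  with S show "line y \<in> D" by auto
next
  assume yD: "line y \<in> D"
  define A where "A = (\<lambda>s::real. {l. \<exists>y\<in>period_vectors Q (extend_scalars L). l = line y \<and> 0 < s * orient Q x y})"
  have op: "openin (full_period_domain Q L) (A 1)" "openin (full_period_domain Q L) (A (-1))"
    unfolding A_def by (rule openin_orient, simp)+
  have con: "connectedin (full_period_domain Q L) D"
    using D unfolding is_period_domain_def by (rule connectedin_connected_components_of)
  then have "D \<subseteq> line ` period_vectors Q (extend_scalars L)"
    using connectedin_subset_topspace topspace_full_period_domain by blast
  then have sub: "D \<subseteq> A 1 \<union> A (-1)"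
    using orient_nonzero[OF assms(1) x(1)] by (force simp: A_def not_less_iff_gr_or_eq)
  have "A 1 \<inter> A (-1) = {}"
  proof -
    have False if yz: "y \<in> period_vectors Q (extend_scalars L)" "line y = line z" "0 < orient Q x y" "orient Q x z < 0" for y z
    proof -
      obtain c where "c \<noteq> 0" "y = c *s z"
        using line_eq_lineE[OF yz(2) period_vectors_nonzero[OF yz(1)]] .
      then show False using yz by (simp add: orient_scale_right zero_less_mult_iff)
    qed
    then show ?thesis by (auto simp: A_def)
  qed
  moreover have "line x \<in> A 1" using x orient_self by (auto simp: A_def)
  ultimately have "line y \<notin> A (-1)"
    using con op sub x yD unfolding connectedin by blast
  then have "\<not> orient Q x y < 0" using y by (auto simp: A_def)
  then show "0 < orient Q x y"
    using orient_nonzero[OF assms(1) x(1) y] by linarith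
qed

text \<open>Positivity of \<open>orient\<close> is membership in the same component, hence
  transitive; no inequality between the three values is needed.\<close>

lemma orient_trans:
  assumes "two_negative Q" and xyz: "x \<in> period_vectors Q UNIV" "y \<in> period_vectors Q UNIV" "z \<in> period_vectors Q UNIV"
    and pos: "0 < orient Q x y" "0 < orient Q y z"
  shows "0 < orient Q x z"
proof -
  have "line x \<in> topspace (full_period_domain Q UNIV)"
    using xyz by (simp add: topspace_full_period_domain)
  then obtain D where D: "is_period_domain Q UNIV D" "line x \<in> D"
    unfolding is_period_domain_def
    by (metis Union_connected_components_of UnionE)
  note char = period_domain_orient[OF assms(1) D(1), unfolded extend_scalars_UNIV]
  show ?thesis
    using char[of x y] char[of x z] char[of y z] D xyz pos by auto
qed

end

section \<open>Integer matrices acting on vectors and forms\<close>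

abbreviation of_int_mat :: "int^'n^'m \<Rightarrow> 'a::ring_1^'n^'m" where
  "of_int_mat A \<equiv> map_matrix of_int A"

lemma of_int_mat_mult: "of_int_mat (A ** B) = of_int_mat A ** of_int_mat B"
  by (simp add: vec_eq_iff matrix_matrix_mult_def)

lemma of_int_mat_add: "of_int_mat (A + B) = of_int_mat A + of_int_mat B"
  by (simp add: vec_eq_iff)

lemma of_int_mat_one [simp]: "of_int_mat (mat 1) = mat 1"
  by (simp add: vec_eq_iff mat_def)

lemma map_matrix_id [simp]: "map_matrix id A = A"
  by (simp add: vec_eq_iff)

lemma embed_mult: "embed (A *v x) = of_int_mat A *v embed x"
  by (simp add: vec_eq_iff matrix_vector_mult_def)

lemma of_real_vec_mult: "of_real_vec (of_int_mat A *v x) = of_int_mat A *v of_real_vec x"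
  by (simp add: vec_eq_iff matrix_vector_mult_def)

lemma vcnj_mult: "vcnj (of_int_mat A *v x) = of_int_mat A *v vcnj x"
  by (simp add: vec_eq_iff matrix_vector_mult_def)

lemma of_int_mat_scale: "of_int_mat A *v (c *s x) = c *s (of_int_mat A *v (x::'a::comm_ring_1^'n))"
  by (simp add: vec_eq_iff matrix_vector_mult_def sum_distrib_left mult_ac)

lemma matrix_add_rdistrib: "(A + B) ** C = A ** C + B ** (C :: 'a::semiring_1^'n^'m)"
  by (simp add: vec_eq_iff matrix_matrix_mult_def sum.distrib algebra_simps)

lemma matrix_zero_mult [simp]: "0 ** (A :: 'a::semiring_1^'n^'m) = 0" "(A :: 'a::semiring_1^'n^'m) ** 0 = 0"
  by (simp_all add: vec_eq_iff matrix_matrix_mult_def)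

lemma transpose_add: "transpose (A + B) = transpose A + transpose B"
  by (simp add: vec_eq_iff transpose_def)

lemma mat_mult_nth: "(mat k ** A) $ i $ j = k * (A :: 'a::semiring_1^'n^'m) $ i $ j"
  by (simp add: matrix_matrix_mult_def mat_def if_distrib[of "\<lambda>c. c * _"] cong: if_cong)

lemma mult_mat_nth: "((A :: 'a::semiring_1^'n^'m) ** mat k) $ i $ j = A $ i $ j * k"
  by (simp add: matrix_matrix_mult_def mat_def if_distrib[of "\<lambda>c. _ * c"] cong: if_cong)

lemma mat_mult_commute: "mat k ** A = (A :: 'a::comm_semiring_1^'n^'m) ** mat k"
  by (simp add: vec_eq_iff mat_mult_nth mult_mat_nth mult.commute)

lemma bform_alt: "bform Q x y = (\<Sum>i\<in>UNIV. x $ i * (of_int_mat Q *v y) $ i)"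
  by (simp add: bform_def matrix_vector_mult_def sum_distrib_left mult_ac)

lemma bform_transpose: "bform (transpose Q) x y = bform Q y x"
  unfolding bform_def transpose_def by (subst sum.swap) (simp add: mult_ac)

lemma bform_mult_right: "bform Q x (of_int_mat B *v y) = bform (Q ** B) x y"
  by (simp add: bform_alt matrix_vector_mul_assoc of_int_mat_mult)

lemma bform_mult_left: "bform Q (of_int_mat A *v x) y = bform (transpose A ** Q) x y"
proof -
  have "bform Q (of_int_mat A *v x) y = bform (transpose Q) y (of_int_mat A *v x)"
    by (simp add: bform_transpose)
  also have "\<dots> = bform (transpose (transpose Q ** A)) x y"
    by (simp add: bform_mult_right bform_transpose)
  finally show ?thesis
    by (simp add: matrix_transpose_mul)
qed

lemma bform_add_form: "bform (A + B) x y = bform A x y + bform B x y"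
  by (simp add: bform_def algebra_simps sum.distrib)

lemma bform_zero_form [simp]: "bform 0 x y = 0"
  by (simp add: bform_def)

lemma sum_mult_eq_bform: "(\<Sum>i\<in>UNIV. (of_int_mat A *v x) $ i * y $ i) = bform A y x"
  by (simp add: bform_alt mult.commute)

lemma bform_isometry:
  "transpose H ** Q ** H = Q \<Longrightarrow> bform Q (of_int_mat H *v x) (of_int_mat H *v y) = bform Q x y"
  by (simp add: bform_mult_left bform_mult_right matrix_mul_assoc)

lemma bform_axis: "bform Q (axis i 1) (axis j 1) = of_int (Q $ i $ j)"
  by (simp add: bform_def axis_def if_distrib[of "\<lambda>c. _ * c"] cong: if_cong)

lemma bform_eqI:
  assumes "\<And>x y :: int^'n. bform A x y = bform B x y"
  shows "A = B"
  using assms[of "axis _ 1" "axis _ 1"] by (simp add: bform_axis vec_eq_iff)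

lemma orient_isometry:
  "transpose H ** Q ** H = Q \<Longrightarrow> orient Q (of_int_mat H *v x) (of_int_mat H *v y) = orient Q x y"
  by (simp add: orient_def vcnj_mult bform_isometry)

lemma period_vectors_isometry:
  "transpose H ** Q ** H = Q \<Longrightarrow> of_int_mat H *v x \<in> period_vectors Q UNIV \<longleftrightarrow> x \<in> period_vectors Q UNIV"
  by (simp add: period_vectors_def vcnj_mult bform_isometry)

section \<open>Sublattices and transvections\<close>

locale sublattice = period_space Q for Q :: "int^'n^'n" +
  fixes b :: "int^'n^'k" and S :: "int^'k^'k"
  assumes gram: "bform Q (b $ i) (b $ j) = S $ i $ j"
begin

definition lin_comb :: "'a::comm_ring_1^'k \<Rightarrow> 'a^'n" where
  "lin_comb c = (\<Sum>i\<in>UNIV. c $ i *s embed (b $ i))"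

text \<open>These coordinates are integral on the whole dual lattice, which is what makes
  transvections trivial on the discriminant group.\<close>

definition pairing :: "'a::comm_ring_1^'n \<Rightarrow> 'a^'k" where
  "pairing x = (\<chi> j. bform Q (embed (b $ j)) x)"

text \<open>
  If \<open>H = 1 + A S\<close> is an isometry of the sublattice, this extends it by the identity on the
  orthogonal complement.
\<close>

definition transvection :: "int^'k^'k \<Rightarrow> 'a::comm_ring_1^'n \<Rightarrow> 'a^'n" where
  "transvection A x = x + lin_comb (of_int_mat A *v pairing x)"

lemma lin_comb_add: "lin_comb (x + y) = lin_comb x + lin_comb y"
  by (simp add: lin_comb_def vec_eq_iff sum.distrib algebra_simps)

lemma lin_comb_scale: "lin_comb (c *s x) = c *s lin_comb x"
  by (simp add: lin_comb_def vec_eq_iff sum_distrib_left mult.assoc)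

lemma lin_comb_embed: "lin_comb (embed c) = embed (lin_comb c)"
  by (simp add: lin_comb_def vec_eq_iff)

lemma vcnj_lin_comb: "vcnj (lin_comb c) = lin_comb (vcnj c)"
  by (simp add: lin_comb_def vcnj_sum vcnj_scale)

lemma pairing_add: "pairing (x + y) = pairing x + pairing y"
  by (simp add: pairing_def vec_eq_iff bform_linear)

lemma pairing_scale: "pairing (c *s x) = c *s pairing x"
  by (simp add: pairing_def vec_eq_iff bform_linear)

lemma pairing_embed: "pairing (embed v) = embed (pairing v)"
  by (simp add: pairing_def vec_eq_iff bform_embed)

lemma bform_lin_comb: "bform Q (lin_comb c) x = (\<Sum>i\<in>UNIV. c $ i * pairing x $ i)"
  by (simp add: lin_comb_def pairing_def bform_sum_left bform_linear)

lemma pairing_lin_comb: "pairing (lin_comb c) = of_int_mat S *v c"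
  by (simp add: pairing_def lin_comb_def vec_eq_iff bform_sum_right bform_linear bform_embed gram
      matrix_vector_mult_def mult.commute)

lemma bform_lin_comb_lin_comb: "bform Q (lin_comb c) (lin_comb d) = bform S c d"
  by (simp add: bform_lin_comb pairing_lin_comb bform_alt[of S])

lemma orient_lin_comb: "orient Q (lin_comb x) (lin_comb y) = orient S x y"
  by (simp add: orient_def vcnj_lin_comb bform_lin_comb_lin_comb)

lemma transvection_linear:
  "transvection A (x + y) = transvection A x + transvection A y"
  "transvection A (c *s x) = c *s transvection A x"
proof -
  show "transvection A (x + y) = transvection A x + transvection A y"
    by (simp add: transvection_def pairing_add lin_comb_add matrix_vector_right_distrib)
  show "transvection A (c *s x) = c *s transvection A x"
    by (simp add: transvection_def pairing_scale lin_comb_scale of_int_mat_scale vector_add_ldistrib)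
qed

lemma transvection_embed: "transvection A (embed v) = embed (transvection A v)"
  by (simp add: transvection_def pairing_embed embed_add embed_mult[symmetric] lin_comb_embed)

lemma transvection_vcnj: "transvection A (vcnj x) = vcnj (transvection A x)"
proof -
  have "pairing (vcnj x) = vcnj (pairing x)"
    by (simp add: pairing_def vec_eq_iff bform_vcnj[of Q "embed v" for v, simplified])
  then show ?thesis
    by (simp add: transvection_def vcnj_add vcnj_lin_comb vcnj_mult)
qed

lemma transvection_lin_comb:
  "transvection A (lin_comb c) = lin_comb (of_int_mat (mat 1 + A ** S) *v c)"
  by (simp add: transvection_def pairing_lin_comb matrix_vector_mul_assoc of_int_mat_mult of_int_mat_add
      lin_comb_add matrix_vector_mult_add_rdistrib)

text \<open>Mirrors \<open>(1 + A S) (1 + B S) = 1 + (A + B + A S B) S\<close> on the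
  sublattice.\<close>

lemma transvection_transvection:
  "transvection A (transvection B x) = transvection (A + B + A ** S ** B) x"
  by (simp add: transvection_def pairing_lin_comb pairing_add matrix_vector_mul_assoc of_int_mat_mult
      of_int_mat_add lin_comb_add matrix_vector_mult_add_rdistrib matrix_vector_right_distrib
      matrix_mul_assoc add_ac)

lemma transvection_zero [simp]: "transvection 0 x = x"
  by (simp add: transvection_def lin_comb_def matrix_vector_mult_def vec_eq_iff)

text \<open>For \<open>H = 1 + A S\<close> the isometry condition reads
  \<open>S (A + transpose A + transpose A S A) S = 0\<close>. The hypothesis is this equation with
  the outer factors removed, and it suffices on the whole ambient lattice.\<close>

lemma transvection_isometry:
  assumes "A + transpose A + transpose A ** S ** A = 0"
  shows "bform Q (transvection A x) (transvection A y) = bform Q x y"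
proof -
  let ?l = "\<lambda>x. lin_comb (of_int_mat A *v pairing x)"
  have "bform Q (?l x) (?l y) = bform (transpose A ** S ** A) (pairing x) (pairing y)"
    by (simp only: bform_lin_comb_lin_comb bform_mult_left bform_mult_right matrix_mul_assoc)
  moreover have "bform Q (?l x) y = bform (transpose A) (pairing x) (pairing y)"
    by (simp only: bform_lin_comb sum_mult_eq_bform bform_transpose)
  moreover have "bform Q x (?l y) = bform A (pairing x) (pairing y)"
    unfolding bform_sym[of x] by (simp only: bform_lin_comb sum_mult_eq_bform)
  ultimately have "bform Q (transvection A x) (transvection A y)
      = bform Q x y + bform (A + transpose A + transpose A ** S ** A) (pairing x) (pairing y)"
    by (simp add: transvection_def bform_add_left bform_add_right bform_add_form)
  then show ?thesis
    by (simp add: assms)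
qed

end

section \<open>Integral isometries of \<open>T1_gram\<close>\<close>

definition adjugate3 :: "'a::comm_ring_1^3^3 \<Rightarrow> 'a^3^3" where
  "adjugate3 A = vector
    [vector [A$2$2 * A$3$3 - A$2$3 * A$3$2, A$1$3 * A$3$2 - A$1$2 * A$3$3, A$1$2 * A$2$3 - A$1$3 * A$2$2],
     vector [A$2$3 * A$3$1 - A$2$1 * A$3$3, A$1$1 * A$3$3 - A$1$3 * A$3$1, A$1$3 * A$2$1 - A$1$1 * A$2$3],
     vector [A$2$1 * A$3$2 - A$2$2 * A$3$1, A$1$2 * A$3$1 - A$1$1 * A$3$2, A$1$1 * A$2$2 - A$1$2 * A$2$1]]"

lemma adjugate3: "adjugate3 A ** A = mat (det A)" "A ** adjugate3 A = mat (det A)"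
  by (simp_all add: adjugate3_def vec_eq_iff forall_3 matrix_matrix_mult_def sum_3 det_3 vector_3 mat_def
      algebra_simps)

text \<open>The hypothesis encodes determinant 1 or -1, and the inverse is the determinant times the
  adjugate.\<close>

lemma unimodular_inverse:
  fixes V :: "int^3^3"
  assumes "det V * det V = 1"
  obtains W where "V ** W = mat 1" "W ** V = mat 1"
proof
  have *: "mat (det V) ** mat (det V) = (mat 1 :: int^3^3)"
    using assms by (simp add: vec_eq_iff mat_mult_nth) (simp add: mat_def)
  show "V ** (mat (det V) ** adjugate3 V) = mat 1"
    by (metis * adjugate3(2) mat_mult_commute matrix_mul_assoc)
  show "(mat (det V) ** adjugate3 V) ** V = mat 1"
    by (metis * adjugate3(1) matrix_mul_assoc)
qed

lemma T1_gram_symmetric: "transpose T1_gram = T1_gram"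
  by (simp add: transpose_def T1_gram_def vec_eq_iff forall_3 vector_3)

lemma det_T1_gram: "det T1_gram = 588"
  by (simp add: det_3 T1_gram_def vector_3)

lemma mat_588_cancel:
  fixes A :: "int^3^3"
  assumes "mat 588 ** A = mat 588 ** B"
  shows "A = B"
  using assms by (simp add: vec_eq_iff mat_mult_nth)

lemma T1_gram_cancel:
  fixes A :: "int^3^3"
  shows "A ** T1_gram = B ** T1_gram \<Longrightarrow> A = B" "T1_gram ** A = T1_gram ** B \<Longrightarrow> A = B"
proof -
  assume "A ** T1_gram = B ** T1_gram"
  then have "A ** (T1_gram ** adjugate3 T1_gram) = B ** (T1_gram ** adjugate3 T1_gram)"
    by (simp add: matrix_mul_assoc)
  then have "mat 588 ** A = mat 588 ** B"
    by (simp add: adjugate3 det_T1_gram mat_mult_commute)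
  then show "A = B" by (rule mat_588_cancel)
next
  assume "T1_gram ** A = T1_gram ** B"
  then have "(adjugate3 T1_gram ** T1_gram) ** A = (adjugate3 T1_gram ** T1_gram) ** B"
    by (simp add: matrix_mul_assoc[symmetric])
  then have "mat 588 ** A = mat 588 ** B"
    by (simp add: adjugate3 det_T1_gram)
  then show "A = B" by (rule mat_588_cancel)
qed

definition T1_isometry :: "int^3^3 \<Rightarrow> bool" where
  "T1_isometry H \<longleftrightarrow> transpose H ** T1_gram ** H = T1_gram"

definition congruence_isometry :: "int^3^3 \<Rightarrow> bool" where
  "congruence_isometry H \<longleftrightarrow> T1_isometry H \<and> (\<exists>E. H = mat 1 + mat 588 ** E)"

text \<open>Since \<open>mat 588\<close> is the adjugate times \<open>T1_gram\<close>, the matrix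
  \<open>E ** adjugate3 T1_gram\<close> serves as \<open>A\<close>. The second identity is the
  isometry equation after cancelling \<open>T1_gram\<close> on both sides.\<close>

lemma congruence_isometry_transvection:
  assumes "congruence_isometry H"
  obtains A where "H = mat 1 + A ** T1_gram" "A + transpose A + transpose A ** T1_gram ** A = 0"
proof -
  obtain E where E: "H = mat 1 + mat 588 ** E" "transpose H ** T1_gram ** H = T1_gram"
    using assms by (auto simp: congruence_isometry_def T1_isometry_def)
  define A where "A = E ** adjugate3 T1_gram"
  have H: "H = mat 1 + A ** T1_gram"
    by (simp add: E(1) A_def matrix_mul_assoc[symmetric] adjugate3 det_T1_gram mat_mult_commute)
  have "transpose H = mat 1 + T1_gram ** transpose A"
    by (simp add: H transpose_add matrix_transpose_mul T1_gram_symmetric)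
  then have "T1_gram ** ((A + transpose A + transpose A ** T1_gram ** A) ** T1_gram) + T1_gram = T1_gram"
    using E(2) unfolding H
    by (simp add: matrix_add_ldistrib matrix_add_rdistrib matrix_mul_assoc add_ac)
  then have "T1_gram ** ((A + transpose A + transpose A ** T1_gram ** A) ** T1_gram) = T1_gram ** (0 ** T1_gram)"
    by simp
  then have "A + transpose A + transpose A ** T1_gram ** A = 0"
    using T1_gram_cancel by blast
  with H show ?thesis by (rule that)
qed

lemma T1_isometry_inverse:
  assumes "T1_isometry H"
  obtains W where "H ** W = mat 1" "W ** H = mat 1" "T1_isometry W"
proof -
  have *: "transpose H ** T1_gram ** H = T1_gram"
    using assms by (simp add: T1_isometry_def)
  then have "det H * det T1_gram * det H = det T1_gram"
    by (metis det_mul det_transpose)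
  then have "det H * det H = 1"
    by (simp add: det_T1_gram)
  then obtain W where W: "H ** W = mat 1" "W ** H = mat 1"
    by (rule unimodular_inverse)
  have "transpose W ** T1_gram ** W = transpose W ** (transpose H ** T1_gram ** H) ** W"
    by (simp add: *)
  also have "\<dots> = transpose (H ** W) ** T1_gram ** (H ** W)"
    by (simp add: matrix_transpose_mul matrix_mul_assoc)
  finally have "T1_isometry W"
    by (simp add: T1_isometry_def W)
  with W show ?thesis using that by blast
qed

lemma T1_isometry_mult:
  assumes "T1_isometry H" "T1_isometry K"
  shows "T1_isometry (H ** K)"
proof -
  have "transpose (H ** K) ** T1_gram ** (H ** K) = transpose K ** (transpose H ** T1_gram ** H) ** K"
    by (simp add: matrix_transpose_mul matrix_mul_assoc)
  then show ?thesis using assms by (simp add: T1_isometry_def)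
qed

lemma congruence_isometry_inverse:
  assumes "congruence_isometry H"
  obtains W where "H ** W = mat 1" "W ** H = mat 1" "congruence_isometry W"
proof -
  obtain E where E: "H = mat 1 + mat 588 ** E" "T1_isometry H"
    using assms by (auto simp: congruence_isometry_def)
  obtain W where W: "H ** W = mat 1" "W ** H = mat 1" "T1_isometry W"
    using T1_isometry_inverse[OF E(2)] .
  have "W ** (mat 588 ** E) = mat 588 ** (W ** E)"
    by (metis mat_mult_commute matrix_mul_assoc)
  then have "W + mat 588 ** (W ** E) = mat 1"
    using W(2) by (simp add: E(1) matrix_add_ldistrib)
  moreover have "mat 588 ** (W ** E) + mat 588 ** (- (W ** E)) = 0"
    by (simp add: vec_eq_iff mat_mult_nth)
  ultimately have "W = mat 1 + mat 588 ** (- (W ** E))"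
    by (simp add: add_eq_0_iff2 diff_eq_eq)
  with W show ?thesis
    using that unfolding congruence_isometry_def by blast
qed

text \<open>Rows of \<open>V\<close> and \<open>V'\<close> are thought of as bases; \<open>H\<close> carries the one to the other.\<close>

lemma isometry_from_gram:
  fixes V V' :: "int^3^3"
  assumes V: "det V * det V = 1" and V': "det V' * det V' = 1"
    and gram: "V ** T1_gram ** transpose V = V' ** T1_gram ** transpose V'"
  obtains H where "T1_isometry H" "V' = V ** transpose H"
    "(\<exists>E. V' = V + mat 588 ** E) \<Longrightarrow> congruence_isometry H"
proof -
  obtain W where W: "V ** W = mat 1" "W ** V = mat 1"
    using unimodular_inverse[OF V] .
  define H where "H = transpose (W ** V')"
  have 1: "V' = V ** transpose H"
    by (simp add: H_def matrix_mul_assoc W)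
  have "transpose H ** T1_gram ** H = W ** (V' ** T1_gram ** transpose V') ** transpose W"
    by (simp add: H_def matrix_transpose_mul matrix_mul_assoc)
  also have "\<dots> = (W ** V) ** T1_gram ** transpose (W ** V)"
    by (simp add: gram[symmetric] matrix_transpose_mul matrix_mul_assoc)
  finally have 2: "T1_isometry H"
    by (simp add: T1_isometry_def W)
  have "congruence_isometry H" if "\<exists>E. V' = V + mat 588 ** E"
  proof -
    from that obtain E where E: "V' = V + mat 588 ** E" ..
    have "H = mat 1 + mat 588 ** transpose (W ** E)"
      by (simp add: H_def E matrix_add_ldistrib W mat_mult_commute matrix_mul_assoc[symmetric]
          transpose_add matrix_transpose_mul)
    with 2 show ?thesis unfolding congruence_isometry_def by blast
  qed
  with 1 2 show ?thesis using that by blast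
qed

interpretation T1: period_space T1_gram
  by unfold_locales (rule T1_gram_symmetric)

lemma T1_gram_nth [simp]:
  "T1_gram $ 1 $ 1 = - 2" "T1_gram $ 1 $ 2 = 1" "T1_gram $ 1 $ 3 = 0"
  "T1_gram $ 2 $ 1 = 1" "T1_gram $ 2 $ 2 = 10" "T1_gram $ 2 $ 3 = 0"
  "T1_gram $ 3 $ 1 = 0" "T1_gram $ 3 $ 2 = 0" "T1_gram $ 3 $ 3 = - 28"
  by (simp_all add: T1_gram_def vector_3)

abbreviation form :: "'a::comm_ring_1^3 \<Rightarrow> 'a^3 \<Rightarrow> 'a" where
  "form \<equiv> bform T1_gram"

abbreviation orient3 :: "complex^3 \<Rightarrow> complex^3 \<Rightarrow> real" where
  "orient3 \<equiv> orient T1_gram"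

lemma bform_T1:
  "form x y = - 2 * x$1 * y$1 + x$1 * y$2 + x$2 * y$1 + 10 * x$2 * y$2 - 28 * x$3 * y$3"
  by (simp add: bform_def sum_3)

lemma det_gram_T1:
  fixes X Y :: "'a::comm_ring_1^3^3"
  shows "det (\<chi> i j. form (X $ i) (Y $ j)) = 588 * det X * det Y"
proof -
  have "(\<chi> i j. form (X $ i) (Y $ j)) = X ** of_int_mat T1_gram ** transpose Y"
    by (simp add: vec_eq_iff forall_3 bform_T1 matrix_matrix_mult_def sum_3 transpose_def algebra_simps)
  moreover have "det (of_int_mat T1_gram :: 'a^3^3) = 588"
    by (simp add: det_3)
  ultimately show ?thesis
    by (simp add: det_mul mult.commute)
qed

text \<open>The Gram determinant of an orthogonal triple is 588 times a square, so two negative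
  norms force the third to be nonnegative.\<close>

lemma two_negative_T1: "two_negative T1_gram"
  unfolding two_negative_def
proof (intro allI impI)
  fix a b v :: "real^3"
  assume *: "form a a < 0" "form b b < 0" "form a b = 0"
      "form a v = 0" "form b v = 0"
  let ?X = "vector [a, b, v] :: real^3^3"
  have "form a a * form b b * form v v
      = det (\<chi> i j. form (?X $ i) (?X $ j))"
    using * by (simp add: det_3 vector_3 T1.bform_sym[of b a] T1.bform_sym[of v a] T1.bform_sym[of v b])
  also have "\<dots> = 588 * (det ?X)\<^sup>2"
    unfolding det_gram_T1 by (simp add: power2_eq_square)
  finally have "0 \<le> form a a * form b b * form v v"
    by simp
  moreover have "0 < form a a * form b b"
    using * by (simp add: mult_neg_neg)
  ultimately show "0 \<le> form v v"
    by (simp add: zero_le_mult_iff)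
qed

text \<open>-2 is not a square modulo 7; the residues are checked one by one.\<close>

lemma square_plus_double_mod_7:
  fixes b c :: int
  assumes "7 dvd b\<^sup>2 + 2 * c\<^sup>2"
  shows "7 dvd b \<and> 7 dvd c"
proof -
  have "((b mod 7)\<^sup>2 + 2 * (c mod 7)\<^sup>2) mod 7 = (b\<^sup>2 + 2 * c\<^sup>2) mod 7"
    by (rule mod_add_cong[OF power_mod mod_mult_cong[OF refl power_mod]])
  then have 1: "((b mod 7)\<^sup>2 + 2 * (c mod 7)\<^sup>2) mod 7 = 0"
    using assms by (metis dvd_imp_mod_0)
  have "\<forall>x\<in>{0, 1, 2, 3, 4, 5, 6}. \<forall>y\<in>{0, 1, 2, 3, 4, 5, 6}. (x\<^sup>2 + 2 * y\<^sup>2) mod 7 = (0::int) \<longrightarrow> x = 0 \<and> y = 0"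
    by simp
  moreover have "b mod 7 \<in> {0, 1, 2, 3, 4, 5, 6}" "c mod 7 \<in> {0, 1, 2, 3, 4, 5, 6}"
    by auto
  ultimately have "b mod 7 = 0 \<and> c mod 7 = 0" using 1 by (meson bspec)
  then show ?thesis by (metis mod_0_imp_dvd)
qed

text \<open>
  Up to sign, twice the form is \<open>(2 x\<^sub>1 - x\<^sub>2)\<^sup>2 - 21 x\<^sub>2\<^sup>2 + 56 x\<^sub>3\<^sup>2\<close>, which is anisotropic over the
  7-adic numbers because 3 is not a square modulo 7.
\<close>

lemma T1_anisotropic_descent:
  fixes a b c :: int
  assumes "a\<^sup>2 - a * b - 5 * b\<^sup>2 + 14 * c\<^sup>2 = 0"
  shows "a = 0 \<and> b = 0 \<and> c = 0"
  using assms
proof (induction "nat (\<bar>a\<bar> + \<bar>b\<bar> + \<bar>c\<bar>)" arbitrary: a b c rule: less_induct)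
  case less
  \<comment> \<open>Modulo 7 the form is the square of \<open>a + 3 * b\<close>. Substituting
    \<open>a = 7 * k - 3 * b\<close> and dividing by 7 leaves
    \<open>b\<^sup>2 + 2 * c\<^sup>2\<close> modulo 7, so all three coordinates are divisible by 7
    and infinite descent applies.\<close>
  have "(a + 3 * b)\<^sup>2 = 7 * (a * b + 2 * b\<^sup>2 - 2 * c\<^sup>2)"
    using less.prems by (simp add: power2_eq_square algebra_simps)
  then have "7 dvd (a + 3 * b)\<^sup>2"
    by (rule dvdI)
  then have "7 dvd a + 3 * b"
    using prime_dvd_power[of "7::int"] by simp
  then obtain k where k: "a = 7 * k - 3 * b"
    by (metis add_diff_cancel_right' dvd_def)
  have "b\<^sup>2 + 2 * c\<^sup>2 = 7 * (k * b - k\<^sup>2)"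
    using less.prems by (simp add: k power2_eq_square algebra_simps)
  then have "7 dvd b\<^sup>2 + 2 * c\<^sup>2"
    by (rule dvdI)
  then have bc: "7 dvd b" "7 dvd c"
    by (rule square_plus_double_mod_7[THEN conjunct1], rule square_plus_double_mod_7[THEN conjunct2])
  then obtain b' c' where *: "b = 7 * b'" "c = 7 * c'"
    by (meson dvdE)
  define a' where "a' = k - 3 * b'"
  have a: "a = 7 * a'"
    by (simp add: a'_def k *)
  have eq: "a'\<^sup>2 - a' * b' - 5 * b'\<^sup>2 + 14 * c'\<^sup>2 = 0"
    using less.prems by (simp add: a * power2_eq_square)
  show ?case
  proof (cases "a = 0 \<and> b = 0 \<and> c = 0")
    case False
    then have "nat (\<bar>a'\<bar> + \<bar>b'\<bar> + \<bar>c'\<bar>) < nat (\<bar>a\<bar> + \<bar>b\<bar> + \<bar>c\<bar>)"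
      using a * by auto
    from less.hyps[OF this eq] show ?thesis
      by (simp add: a *)
  qed
qed

lemma T1_anisotropic:
  assumes "form x x = (0::int)"
  shows "x = 0"
proof -
  have "(x$1)\<^sup>2 - x$1 * x$2 - 5 * (x$2)\<^sup>2 + 14 * (x$3)\<^sup>2 = 0"
    using assms by (simp add: bform_T1 power2_eq_square)
  from T1_anisotropic_descent[OF this] show ?thesis
    by (simp add: vec_eq_iff forall_3)
qed

section \<open>Majorants\<close>

definition neg_norm :: "int^'n^'n \<Rightarrow> complex^'n \<Rightarrow> real" where
  "neg_norm Q x = - Re (bform Q x (vcnj x))"

text \<open>The component of a real \<open>v\<close> in the negative plane of \<open>x\<close> has
  square \<open>- 2 * (cmod (v, x))\<^sup>2 / neg_norm Q x\<close>; reversing its sign adds twice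
  its absolute value, whence the factor 4. The polarised version is needed for Gram determinants and
  basis changes.\<close>

definition majorant_form :: "int^'n^'n \<Rightarrow> complex^'n \<Rightarrow> real^'n \<Rightarrow> real^'n \<Rightarrow> real" where
  "majorant_form Q x v w = bform Q v w
     + 4 * Re (bform Q (of_real_vec v) x * cnj (bform Q (of_real_vec w) x)) / neg_norm Q x"

abbreviation majorant :: "int^'n^'n \<Rightarrow> complex^'n \<Rightarrow> real^'n \<Rightarrow> real" where
  "majorant Q x v \<equiv> majorant_form Q x v v"

abbreviation neg_norm3 :: "complex^3 \<Rightarrow> real" where
  "neg_norm3 \<equiv> neg_norm T1_gram"

abbreviation majorant3 :: "complex^3 \<Rightarrow> real^3 \<Rightarrow> real" where
  "majorant3 x v \<equiv> majorant T1_gram x v"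

lemma majorant_eq:
  "majorant Q x v = bform Q v v + 4 * (cmod (bform Q (of_real_vec v) x))\<^sup>2 / neg_norm Q x"
  by (simp add: majorant_form_def complex_mult_cnj cmod_power2)

lemma of_real_vec_linear:
  "of_real_vec (x + y) = of_real_vec x + of_real_vec y"
  "of_real_vec (x - y) = of_real_vec x - of_real_vec y"
  "of_real_vec (c *s x) = of_real c *s of_real_vec x"
  by (simp_all add: vec_eq_iff)

lemma of_real_vec_embed [simp]: "of_real_vec (embed v) = embed v"
  by (simp add: vec_eq_iff)

lemma vcnj_of_real_vec [simp]: "vcnj (of_real_vec v) = of_real_vec v"
  by (simp add: vec_eq_iff)

lemma majorant_form_linear:
  "majorant_form Q x (u + v) w = majorant_form Q x u w + majorant_form Q x v w"
  "majorant_form Q x w (u + v) = majorant_form Q x w u + majorant_form Q x w v"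
  "majorant_form Q x (c *s v) w = c * majorant_form Q x v w"
  "majorant_form Q x w (c *s v) = c * majorant_form Q x w v"
  "majorant_form Q x (u - v) w = majorant_form Q x u w - majorant_form Q x v w"
  "majorant_form Q x w (u - v) = majorant_form Q x w u - majorant_form Q x w v"
  by (simp_all add: majorant_form_def of_real_vec_linear bform_linear algebra_simps add_divide_distrib
      diff_divide_distrib)

lemma neg_norm_scale: "neg_norm Q (c *s x) = (cmod c)\<^sup>2 * neg_norm Q x"
proof -
  have "bform Q (c *s x) (vcnj (c *s x)) = of_real ((cmod c)\<^sup>2) * bform Q x (vcnj x)"
    unfolding complex_norm_square by (simp add: vcnj_scale bform_linear)
  then show ?thesis by (simp add: neg_norm_def)
qed

lemma neg_norm_pos: "x \<in> period_vectors Q W \<Longrightarrow> 0 < neg_norm Q x"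
  by (simp add: period_vectors_def neg_norm_def)

lemma majorant_scale: "c \<noteq> 0 \<Longrightarrow> majorant Q (c *s x) v = majorant Q x v"
  by (simp add: majorant_eq neg_norm_scale bform_linear norm_mult power_mult_distrib)

lemma majorant_isometry:
  "transpose H ** Q ** H = Q \<Longrightarrow> majorant Q (of_int_mat H *v x) (of_int_mat H *v v) = majorant Q x v"
  by (simp add: majorant_eq neg_norm_def vcnj_mult bform_isometry of_real_vec_mult)

context period_space
begin

lemma majorant_form_sym: "majorant_form Q x v w = majorant_form Q x w v"
  by (simp add: majorant_form_def bform_sym[of v w] algebra_simps)

text \<open>The form is the difference, and the majorant the sum, of the same two nonnegative
  contributions: from the complement of the negative plane and from the plane itself.\<close>

lemma abs_le_majorant:
  assumes "two_negative Q" and x: "x \<in> period_vectors Q W"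
  shows "\<bar>bform Q v v\<bar> \<le> majorant Q x v"
proof -
  define c where "c = - Re (bform Q x (vcnj x))"
  define \<alpha> where "\<alpha> = - bform Q (of_real_vec v) (vcnj x) / of_real c"
  define \<beta> where "\<beta> = - bform Q (of_real_vec v) x / of_real c"
  define w where "w = of_real_vec v - \<alpha> *s x - \<beta> *s vcnj x"
  note d = decomposition[OF x, of "of_real_vec v", folded c_def, folded \<alpha>_def \<beta>_def, folded w_def]
  have c: "c > 0" using x by (simp add: period_vectors_def c_def)
  have "0 \<le> Re (bform Q w (vcnj w))"
    using norm_le_hermitian[OF assms(1) x d(1,2)] norm_ge_zero order_trans by blast
  also have "\<dots> = bform Q v v + ((cmod \<alpha>)\<^sup>2 + (cmod \<beta>)\<^sup>2) * c"
    using d(4) by (simp add: bform_of_real_vec)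
  also have "cmod \<alpha> = cmod \<beta>"
  proof -
    have "bform Q (of_real_vec v) (vcnj x) = cnj (bform Q (of_real_vec v) x)"
      using bform_vcnj[of Q "of_real_vec v" x] by simp
    then show ?thesis by (simp add: \<alpha>_def \<beta>_def norm_divide)
  qed
  also have "(cmod \<beta>)\<^sup>2 = (cmod (bform Q (of_real_vec v) x))\<^sup>2 / c\<^sup>2"
    by (simp add: \<beta>_def norm_divide power_divide)
  finally have "0 \<le> bform Q v v + 2 * (cmod (bform Q (of_real_vec v) x))\<^sup>2 / c"
    using c by (simp add: power2_eq_square field_simps)
  moreover have "0 \<le> 4 * (cmod (bform Q (of_real_vec v) x))\<^sup>2 / c"
    using c by simp
  ultimately show ?thesis
    unfolding majorant_eq neg_norm_def c_def[symmetric] by (simp add: abs_le_iff)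
qed

text \<open>Polarisation writes \<open>4 * bform Q v w\<close> as a difference of two values of the
  form; each is bounded by the majorant, which obeys the parallelogram law.\<close>

lemma abs_bform_le_majorant:
  assumes "two_negative Q" and x: "x \<in> period_vectors Q W"
  shows "\<bar>bform Q v w\<bar> \<le> (majorant Q x v + majorant Q x w) / 2"
proof -
  have "\<bar>4 * bform Q v w\<bar> = \<bar>bform Q (v + w) (v + w) - bform Q (v - w) (v - w)\<bar>"
    by (simp add: bform_linear bform_sym[of w v])
  also have "\<dots> \<le> majorant Q x (v + w) + majorant Q x (v - w)"
    using abs_le_majorant[OF assms, of "v + w"] abs_le_majorant[OF assms, of "v - w"] by linarith
  also have "\<dots> = 2 * majorant Q x v + 2 * majorant Q x w"
    by (simp add: majorant_form_linear)
  finally show ?thesis by (simp add: field_simps)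
qed

end

text \<open>By anisotropy the form takes a nonzero integer value at \<open>v\<close>. This uniform
  lower bound is where anisotropy enters and what keeps reduced bases bounded.\<close>

lemma majorant_T1_ge_1:
  assumes x: "x \<in> period_vectors T1_gram W" and v: "v \<noteq> 0"
  shows "1 \<le> majorant3 x (embed v)"
proof -
  have "form v v \<noteq> 0"
    using T1_anisotropic v by blast
  then have "1 \<le> \<bar>form (embed v) (embed v :: real^3)\<bar>"
    unfolding bform_embed by linarith
  also have "\<dots> \<le> majorant3 x (embed v)"
    by (rule T1.abs_le_majorant[OF two_negative_T1 x])
  finally show ?thesis .
qed

text \<open>Expansion of a determinant under a rank two update: the linear coefficient is the
  adjugate form of \<open>T1_gram\<close> at \<open>p\<close> and \<open>r\<close>, the quadratic
  one is the form itself at the cross product \<open>w\<close> of \<open>p\<close> and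
  \<open>r\<close>.\<close>

lemma det_rank_two_update:
  fixes p r :: "real^3"
  defines "w \<equiv> vector [p$2 * r$3 - p$3 * r$2, p$3 * r$1 - p$1 * r$3, p$1 * r$2 - p$2 * r$1] :: real^3"
  shows "det (\<chi> i j. of_int (T1_gram $ i $ j) + s * (p $ i * p $ j + r $ i * r $ j))
    = 588 + s * (- 280 * (p$1*p$1 + r$1*r$1) + 56 * (p$1*p$2 + r$1*r$2) + 56 * (p$2*p$2 + r$2*r$2)
        - 21 * (p$3*p$3 + r$3*r$3)) + s\<^sup>2 * form w w"
  unfolding w_def bform_T1 det_3 vec_lambda_beta T1_gram_nth vector_3 by simp algebra

text \<open>With \<open>x = a + \<i> b\<close>, the majorant is the form plus the rank two term coming from \<open>a\<close> and \<open>b\<close>,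
  and it has the same determinant because it only changes the sign on the plane of \<open>a\<close> and \<open>b\<close>.\<close>

lemma det_majorant_aux:
  fixes a b :: "real^3"
  defines "M \<equiv> \<lambda>s v w. form v w
     + s * (form v a * form w a + form v b * form w b)"
  shows "det (\<chi> i j. M s (axis i 1) (axis j 1))
    = 588 * (1 + s * (form a a + form b b)
       + s\<^sup>2 * (form a a * form b b - (form a b)\<^sup>2))"
proof -
  define p r :: "real^3" where "p = (\<chi> i. form (axis i 1) a)" and "r = (\<chi> i. form (axis i 1) b)"
  have p: "p$1 = - 2 * a$1 + a$2" "p$2 = a$1 + 10 * a$2" "p$3 = - 28 * a$3"
    and r: "r$1 = - 2 * b$1 + b$2" "r$2 = b$1 + 10 * b$2" "r$3 = - 28 * b$3"
    by (simp_all add: p_def r_def bform_T1 axis_def)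
  have 1: "(\<chi> i j. M s (axis i 1) (axis j 1))
      = (\<chi> i j. of_int (T1_gram $ i $ j) + s * (p $ i * p $ j + r $ i * r $ j))"
    by (simp add: M_def p_def r_def bform_axis)
  \<comment> \<open>As \<open>p\<close> and \<open>r\<close> are \<open>T1_gram\<close> applied to
    \<open>a\<close> and \<open>b\<close>, the adjugate cancels one factor \<open>T1_gram\<close>
    and leaves the determinant 588.\<close>
  have 2: "- 280 * (p$1*p$1 + r$1*r$1) + 56 * (p$1*p$2 + r$1*r$2) + 56 * (p$2*p$2 + r$2*r$2)
        - 21 * (p$3*p$3 + r$3*r$3) = 588 * (form a a + form b b)"
    unfolding p r bform_T1 by algebra
  define w :: "real^3" where "w = vector [p$2 * r$3 - p$3 * r$2, p$3 * r$1 - p$1 * r$3, p$1 * r$2 - p$2 * r$1]"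
  have 3: "form w w = 588 * (form a a * form b b - (form a b)\<^sup>2)"
    unfolding bform_T1 w_def vector_3 p r by algebra
  show ?thesis
    unfolding 1 det_rank_two_update 2 w_def[symmetric] 3 by (simp add: algebra_simps)
qed

lemma majorant_form_Re_Im:
  "majorant_form Q x v w = bform Q v w + 4 / neg_norm Q x *
     (bform Q v (Re_vec x) * bform Q w (Re_vec x) + bform Q v (Im_vec x) * bform Q w (Im_vec x))"
proof -
  have "bform Q (of_real_vec v) x = Complex (bform Q v (Re_vec x)) (bform Q v (Im_vec x))" for v
    by (subst (1) Re_Im_vec[of x]) (simp add: bform_linear bform_of_real_vec complex_eq_iff)
  then show ?thesis
    by (simp add: majorant_form_def field_simps)
qed

lemma det_majorant:
  assumes x: "x \<in> period_vectors T1_gram W"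
  shows "det (\<chi> i j. majorant_form T1_gram x (V $ i) (V $ j)) = 588 * (det V)\<^sup>2"
proof -
  define R :: "real^3^3" where "R = (\<chi> i j. majorant_form T1_gram x (axis i 1) (axis j 1))"
  define c where "c = neg_norm3 x"
  have c: "c > 0" using neg_norm_pos[OF x] by (simp add: c_def)
  have "form x x = 0" "Re (form x (vcnj x)) = - c"
    using x by (auto simp: period_vectors_def neg_norm_def c_def)
  then have ab: "form (Re_vec x) (Im_vec x) = 0" "form (Re_vec x) (Re_vec x) = - c / 2"
      "form (Im_vec x) (Im_vec x) = - c / 2"
    unfolding bform_Re_Im[of _ x x] bform_Re_Im_vcnj[of _ x x]
    by (auto simp: complex_eq_iff T1.bform_sym[of "Im_vec x" "Re_vec x"])
  \<comment> \<open>With \<open>s = 4 / c\<close> and both norms equal to \<open>- c / 2\<close>,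
    the bracket is \<open>1 - 4 + 4 = 1\<close>.\<close>
  have "det R = 588"
    unfolding R_def majorant_form_Re_Im det_majorant_aux c_def[symmetric] ab
    using c by (simp add: power2_eq_square)
  moreover have "(\<chi> i j. majorant_form T1_gram x (V $ i) (V $ j)) = V ** R ** transpose V"
  proof -
    have "v = v$1 *s axis 1 1 + v$2 *s axis 2 1 + v$3 *s axis 3 1" for v :: "real^3"
      by (simp add: vec_eq_iff forall_3 axis_def)
    then have "majorant_form T1_gram x v w
        = majorant_form T1_gram x (v$1 *s axis 1 1 + v$2 *s axis 2 1 + v$3 *s axis 3 1)
            (w$1 *s axis 1 1 + w$2 *s axis 2 1 + w$3 *s axis 3 1)" for v w
      by metis
    moreover have "majorant_form T1_gram x (v$1 *s axis 1 1 + v$2 *s axis 2 1 + v$3 *s axis 3 1)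
            (w$1 *s axis 1 1 + w$2 *s axis 2 1 + w$3 *s axis 3 1) = (\<Sum>k\<in>UNIV. (\<Sum>l\<in>UNIV. v $ l * R $ l $ k) * w $ k)" for v w
      by (simp only: majorant_form_linear R_def sum_3 vec_lambda_beta) (simp add: algebra_simps)
    ultimately have "majorant_form T1_gram x v w = (\<Sum>k\<in>UNIV. (\<Sum>l\<in>UNIV. v $ l * R $ l $ k) * w $ k)" for v w
      by (rule trans)
    then show ?thesis
      by (simp add: vec_eq_iff matrix_matrix_mult_def transpose_def)
  qed
  ultimately show ?thesis
    by (simp add: det_mul power2_eq_square)
qed

section \<open>Reduction theory\<close>

lemma exists_int_near: "\<exists>k::int. (of_int k + t)\<^sup>2 \<le> (1/4 :: real)"
proof
  have "\<bar>of_int (round (- t)) - (- t)\<bar> \<le> 1/2"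
    by (rule of_int_round_abs_le)
  then have "\<bar>of_int (round (- t)) + t\<bar>\<^sup>2 \<le> (1/2)\<^sup>2"
    by (intro power_mono) auto
  then show "(of_int (round (- t)) + t)\<^sup>2 \<le> (1/4 :: real)"
    by (simp add: power2_eq_square)
qed

text \<open>Completing squares gives diagonal entries \<open>a\<close>, \<open>B2\<close>,
  \<open>B3\<close> with product 588. Near-minimality of the basis gives
  \<open>B2 \<ge> 5/8 b\<close> and \<open>B3 \<ge> 3/8 c\<close>, so
  \<open>588 \<ge> 15/64 c\<close>, that is c at most 2508.8; 2600 is a rounding. The slack 1/8 is
  absorbed because all diagonal entries are at least 1.\<close>

lemma reduced_bound:
  fixes a b c d e f :: real
  assumes "1 \<le> a" "a \<le> b" "b \<le> c" and det: "a*b*c + 2*d*e*f - a*f\<^sup>2 - b*e\<^sup>2 - c*d\<^sup>2 = 588"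
    and 2: "\<And>k::int. 0 \<le> (of_int k)\<^sup>2 * a + 2 * of_int k * d + 1/8"
    and 3: "\<And>k l::int. 0 \<le> (of_int k)\<^sup>2 * a + (of_int l)\<^sup>2 * b + 2 * of_int k * e + 2 * of_int l * f
        + 2 * of_int k * of_int l * d + 1/8"
  shows "c \<le> 2600"
proof -
  define \<mu> \<nu> where "\<mu> = d / a" and "\<nu> = e / a"
  have d: "d = a * \<mu>" and e: "e = a * \<nu>"
    using assms(1) by (simp_all add: \<mu>_def \<nu>_def)
  define B2 where "B2 = b - a * \<mu>\<^sup>2"
  have b: "b = B2 + a * \<mu>\<^sup>2" by (simp add: B2_def)
  \<comment> \<open>The second basis vector plus \<open>k\<close> times the first is the test
    vector: \<open>k\<close> rounds the negative of the projection coefficient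
    \<open>\<mu>\<close>.\<close>
  obtain k :: int where k: "(of_int k + \<mu>)\<^sup>2 \<le> 1/4"
    using exists_int_near by blast
  have "(of_int k)\<^sup>2 * a + 2 * of_int k * d = a * (of_int k + \<mu>)\<^sup>2 - a * \<mu>\<^sup>2"
    unfolding d by algebra
  moreover have "a * (of_int k + \<mu>)\<^sup>2 \<le> a * (1/4)"
    using k assms(1) by (intro mult_left_mono) auto
  ultimately have "a * \<mu>\<^sup>2 \<le> a / 4 + 1/8"
    using 2[of k] by simp
  moreover have "0 \<le> a * \<mu>\<^sup>2"
    using assms(1) by simp
  ultimately have B2: "5/8 * b \<le> B2" "B2 \<le> b"
    using assms(1-3) unfolding B2_def by linarith+
  then have B2_pos: "B2 > 0" using assms(1-3) by linarith
  define g where "g = (f - a * \<mu> * \<nu>) / B2"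
  have f: "f = B2 * g + a * \<mu> * \<nu>" using B2_pos by (simp add: g_def)
  define B3 where "B3 = c - a * \<nu>\<^sup>2 - B2 * g\<^sup>2"
  have c: "c = B3 + a * \<nu>\<^sup>2 + B2 * g\<^sup>2" by (simp add: B3_def)
  \<comment> \<open>For the third vector the coefficient \<open>l\<close> of the second is rounded
    before that of the first, whose target depends on \<open>l\<close>.\<close>
  obtain l :: int where l: "(of_int l + g)\<^sup>2 \<le> 1/4"
    using exists_int_near by blast
  obtain m :: int where m: "(of_int m + (\<nu> + of_int l * \<mu>))\<^sup>2 \<le> 1/4"
    using exists_int_near by blast
  have "(of_int m)\<^sup>2 * a + (of_int l)\<^sup>2 * b + 2 * of_int m * e + 2 * of_int l * f + 2 * of_int m * of_int l * d
    = a * (of_int m + (\<nu> + of_int l * \<mu>))\<^sup>2 + B2 * (of_int l + g)\<^sup>2 - (c - B3)"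
    unfolding b c d e f by algebra
  moreover have "a * (of_int m + (\<nu> + of_int l * \<mu>))\<^sup>2 \<le> a * (1/4)" "B2 * (of_int l + g)\<^sup>2 \<le> B2 * (1/4)"
    using l m assms(1) B2_pos by (auto intro!: mult_left_mono)
  ultimately have "c - B3 \<le> a / 4 + B2 / 4 + 1/8"
    using 3[of m l] by simp
  then have B3: "3/8 * c \<le> B3"
    using B2 assms(1-3) by linarith
  have "a*b*c + 2*d*e*f - a*f\<^sup>2 - b*e\<^sup>2 - c*d\<^sup>2 = a * B2 * B3"
    unfolding b c d e f by algebra
  then have "a * B2 * B3 = 588"
    using det by simp
  moreover have "5/8 * (3/8 * c) \<le> (a * B2) * B3"
  proof (intro mult_mono)
    have "5/8 * 1 \<le> B2" using B2 assms(1,2) by linarith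
    then have "1 * (5/8) \<le> a * B2" using assms(1) by (intro mult_mono) auto
    then show "5/8 \<le> a * B2" by simp
  qed (use B3 assms(1-3) B2_pos in auto)
  ultimately show ?thesis by simp
qed

text \<open>A near-minimal basis comes in no particular order; the hypotheses are symmetric, so each
  of the six orders is an instance of the ordered case.\<close>

lemma reduced_bound_unordered:
  fixes a b c d e f :: real
  assumes "1 \<le> a" "1 \<le> b" "1 \<le> c" and det: "a*b*c + 2*d*e*f - a*f\<^sup>2 - b*e\<^sup>2 - c*d\<^sup>2 = 588"
    and 1: "\<And>k l::int. 0 \<le> (of_int k)\<^sup>2 * b + (of_int l)\<^sup>2 * c + 2 * of_int k * d + 2 * of_int l * e
        + 2 * of_int k * of_int l * f + 1/8"
    and 2: "\<And>k l::int. 0 \<le> (of_int k)\<^sup>2 * a + (of_int l)\<^sup>2 * c + 2 * of_int k * d + 2 * of_int l * f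
        + 2 * of_int k * of_int l * e + 1/8"
    and 3: "\<And>k l::int. 0 \<le> (of_int k)\<^sup>2 * a + (of_int l)\<^sup>2 * b + 2 * of_int k * e + 2 * of_int l * f
        + 2 * of_int k * of_int l * d + 1/8"
  shows "a \<le> 2600 \<and> b \<le> 2600 \<and> c \<le> 2600"
proof -
  have det': "a*c*b + 2*e*d*f - a*f\<^sup>2 - c*d\<^sup>2 - b*e\<^sup>2 = 588" "b*a*c + 2*d*f*e - b*e\<^sup>2 - a*f\<^sup>2 - c*d\<^sup>2 = 588"
    "b*c*a + 2*f*d*e - b*e\<^sup>2 - c*d\<^sup>2 - a*f\<^sup>2 = 588" "c*a*b + 2*e*f*d - c*d\<^sup>2 - a*f\<^sup>2 - b*e\<^sup>2 = 588"
    "c*b*a + 2*f*e*d - c*d\<^sup>2 - b*e\<^sup>2 - a*f\<^sup>2 = 588"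
    using det by (simp_all add: algebra_simps)
  have swap: "0 \<le> (of_int k)\<^sup>2 * c + (of_int l)\<^sup>2 * b + 2 * of_int k * e + 2 * of_int l * d
        + 2 * of_int k * of_int l * f + 1/8"
    "0 \<le> (of_int k)\<^sup>2 * c + (of_int l)\<^sup>2 * a + 2 * of_int k * f + 2 * of_int l * d
        + 2 * of_int k * of_int l * e + 1/8"
    "0 \<le> (of_int k)\<^sup>2 * b + (of_int l)\<^sup>2 * a + 2 * of_int k * f + 2 * of_int l * e
        + 2 * of_int k * of_int l * d + 1/8" for k l :: int
    using 1[of l k] 2[of l k] 3[of l k] by (simp_all add: algebra_simps)
  have single: "0 \<le> (of_int k)\<^sup>2 * b + 2 * of_int k * d + 1/8" "0 \<le> (of_int k)\<^sup>2 * a + 2 * of_int k * d + 1/8"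
    "0 \<le> (of_int k)\<^sup>2 * a + 2 * of_int k * e + 1/8" "0 \<le> (of_int k)\<^sup>2 * b + 2 * of_int k * f + 1/8"
    "0 \<le> (of_int k)\<^sup>2 * c + 2 * of_int k * e + 1/8" "0 \<le> (of_int k)\<^sup>2 * c + 2 * of_int k * f + 1/8" for k :: int
    using 1[of k 0] 2[of k 0] 3[of k 0] 3[of 0 k] 1[of 0 k] 2[of 0 k] by simp_all
  consider "a \<le> b" "b \<le> c" | "a \<le> c" "c \<le> b" | "b \<le> a" "a \<le> c" | "b \<le> c" "c \<le> a" | "c \<le> a" "a \<le> b" | "c \<le> b" "b \<le> a"
    by linarith
  then show ?thesis
  proof cases
    assume o: "a \<le> b" "b \<le> c"
    show ?thesis using o reduced_bound[OF assms(1) o det single(2) 3] by simp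
  next
    assume o: "a \<le> c" "c \<le> b"
    show ?thesis using o reduced_bound[OF assms(1) o det'(1) single(3) 2] by simp
  next
    assume o: "b \<le> a" "a \<le> c"
    show ?thesis using o reduced_bound[OF assms(2) o det'(2) single(1) swap(3)] by simp
  next
    assume o: "b \<le> c" "c \<le> a"
    show ?thesis using o reduced_bound[OF assms(2) o det'(3) single(4) 1] by simp
  next
    assume o: "c \<le> a" "a \<le> b"
    show ?thesis using o reduced_bound[OF assms(3) o det'(4) single(5) swap(2)] by simp
  next
    assume o: "c \<le> b" "b \<le> a"
    show ?thesis using o reduced_bound[OF assms(3) o det'(5) single(6) swap(1)] by simp
  qed
qed

text \<open>The basis minimises the sum of the three majorants over all unimodular bases up to 1/8,
  which avoids showing that the infimum is attained. Adding multiples of two rows to the third can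
  then lower the sum by at most 1/8, which is what \<open>reduced_bound_unordered\<close> asks
  for.\<close>

lemma exists_reduced_basis:
  assumes x: "x \<in> period_vectors T1_gram W"
  obtains V :: "int^3^3" where "det V * det V = 1" "\<And>i. majorant3 x (embed (V $ i)) \<le> 2600"
proof -
  define m where "m = (\<lambda>v :: int^3. majorant3 x (embed v))"
  define F where "F = (\<lambda>V :: int^3^3. m (V$1) + m (V$2) + m (V$3))"
  define U where "U = {V :: int^3^3. det V * det V = 1}"
  have m_nonneg: "0 \<le> m v" for v
    using T1.abs_le_majorant[OF two_negative_T1 x, of "embed v"] unfolding m_def by linarith
  have "mat 1 \<in> U"
    by (simp add: U_def)
  have bdd: "bdd_below (F ` U)"
    by (intro bdd_belowI[of _ 0]) (auto simp: F_def intro!: add_nonneg_nonneg m_nonneg)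
  have "\<exists>y\<in>F ` U. y < Inf (F ` U) + 1/8"
    using \<open>mat 1 \<in> U\<close> by (intro cInf_lessD) auto
  then obtain V where V: "V \<in> U" "F V < Inf (F ` U) + 1/8"
    by blast
  have min: "F V \<le> F V' + 1/8" if "V' \<in> U" for V'
    using V(2) cInf_lower[OF imageI[OF that, of F] bdd] by linarith
  define v1 v2 v3 where "v1 = V$1" and "v2 = V$2" and "v3 = V$3"
  have V_eq: "V = vector [v1, v2, v3]"
    by (simp add: vec_eq_iff forall_3 vector_3 v1_def v2_def v3_def)
  have "v1 \<noteq> 0" "v2 \<noteq> 0" "v3 \<noteq> 0"
    using V(1) by (auto simp: U_def V_eq det_3 vector_3)
  then have ge1: "1 \<le> m v1" "1 \<le> m v2" "1 \<le> m v3"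
    unfolding m_def by (simp_all add: majorant_T1_ge_1[OF x])
  let ?M = "\<lambda>v w. majorant_form T1_gram x (embed v) (embed w)"
  have sym: "?M v2 v1 = ?M v1 v2" "?M v3 v1 = ?M v1 v3" "?M v3 v2 = ?M v2 v3"
    by (simp_all add: T1.majorant_form_sym)
  have det1: "det V * det V = 1" using V(1) by (simp add: U_def)
  have row: "m (v1 + k *s v2 + l *s v3) = m v1 + (of_int k)\<^sup>2 * m v2 + (of_int l)\<^sup>2 * m v3
        + 2 * of_int k * ?M v1 v2 + 2 * of_int l * ?M v1 v3 + 2 * of_int k * of_int l * ?M v2 v3"
      "m (v2 + k *s v1 + l *s v3) = m v2 + (of_int k)\<^sup>2 * m v1 + (of_int l)\<^sup>2 * m v3
        + 2 * of_int k * ?M v1 v2 + 2 * of_int l * ?M v2 v3 + 2 * of_int k * of_int l * ?M v1 v3"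
      "m (v3 + k *s v1 + l *s v2) = m v3 + (of_int k)\<^sup>2 * m v1 + (of_int l)\<^sup>2 * m v2
        + 2 * of_int k * ?M v1 v3 + 2 * of_int l * ?M v2 v3 + 2 * of_int k * of_int l * ?M v1 v2" for k l
    unfolding m_def
    by (simp_all add: embed_add embed_scale majorant_form_linear sym power2_eq_square algebra_simps)
  have dets: "det (vector [v1 + k *s v2 + l *s v3, v2, v3] :: int^3^3) = det V"
       "det (vector [v1, v2 + k *s v1 + l *s v3, v3] :: int^3^3) = det V"
       "det (vector [v1, v2, v3 + k *s v1 + l *s v2] :: int^3^3) = det V" for k l
    by (simp_all add: V_eq det_3 vector_3 algebra_simps)
  have "m v1 \<le> 2600 \<and> m v2 \<le> 2600 \<and> m v3 \<le> 2600"
  proof (rule reduced_bound_unordered[OF ge1])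
    let ?V = "of_int_mat V :: real^3^3"
    have rows: "?V $ 1 = embed v1" "?V $ 2 = embed v2" "?V $ 3 = embed v3"
      by (simp_all add: vec_eq_iff v1_def v2_def v3_def)
    have "det ?V = of_int (det V)"
      by (simp add: det_3)
    then have "(det ?V)\<^sup>2 = 1"
      using det1 by (simp add: power2_eq_square flip: of_int_mult)
    then have "det (\<chi> i j. majorant_form T1_gram x (?V $ i) (?V $ j)) = 588"
      by (simp add: det_majorant[OF x])
    then show "m v1 * m v2 * m v3 + 2 * ?M v1 v2 * ?M v1 v3 * ?M v2 v3 - m v1 * (?M v2 v3)\<^sup>2
        - m v2 * (?M v1 v3)\<^sup>2 - m v3 * (?M v1 v2)\<^sup>2 = 588"
      unfolding det_3 vec_lambda_beta rows m_def sym by (simp add: power2_eq_square algebra_simps)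
  next
    fix k l :: int
    have "F V \<le> F (vector [v1 + k *s v2 + l *s v3, v2, v3]) + 1/8"
      using det1 by (intro min) (simp add: U_def dets)
    then show "0 \<le> (of_int k)\<^sup>2 * m v2 + (of_int l)\<^sup>2 * m v3 + 2 * of_int k * ?M v1 v2
        + 2 * of_int l * ?M v1 v3 + 2 * of_int k * of_int l * ?M v2 v3 + 1/8"
      by (simp add: F_def vector_3 row v1_def[symmetric] v2_def[symmetric] v3_def[symmetric])
    have "F V \<le> F (vector [v1, v2 + k *s v1 + l *s v3, v3]) + 1/8"
      using det1 by (intro min) (simp add: U_def dets)
    then show "0 \<le> (of_int k)\<^sup>2 * m v1 + (of_int l)\<^sup>2 * m v3 + 2 * of_int k * ?M v1 v2
        + 2 * of_int l * ?M v2 v3 + 2 * of_int k * of_int l * ?M v1 v3 + 1/8"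
      by (simp add: F_def vector_3 row v1_def[symmetric] v2_def[symmetric] v3_def[symmetric])
    have "F V \<le> F (vector [v1, v2, v3 + k *s v1 + l *s v2]) + 1/8"
      using det1 by (intro min) (simp add: U_def dets)
    then show "0 \<le> (of_int k)\<^sup>2 * m v1 + (of_int l)\<^sup>2 * m v2 + 2 * of_int k * ?M v1 v3
        + 2 * of_int l * ?M v2 v3 + 2 * of_int k * of_int l * ?M v1 v2 + 1/8"
      by (simp add: F_def vector_3 row v1_def[symmetric] v2_def[symmetric] v3_def[symmetric])
  qed
  then have "m (V $ i) \<le> 2600" for i
    using exhaust_3[of i] by (auto simp: v1_def v2_def v3_def)
  with det1 show ?thesis
    using that unfolding m_def by blast
qed

section \<open>Linear extensions and the group \<open>Gamma_hat\<close>\<close>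

text \<open>Exhibiting one linear map with the right values on \<open>L\<close> supplies the
  existence that \<open>SOME\<close> requires, and linear maps that agree on \<open>L\<close> agree
  on its span.\<close>

lemma linear_ext_eq:
  fixes f :: "'a::field_char_0^'n \<Rightarrow> 'a^'n"
  assumes "\<And>x y. f (x + y) = f x + f y" "\<And>c x. f (c *s x) = c *s f x"
    and f: "\<And>v. v \<in> L \<Longrightarrow> f (embed v) = embed (g v)" and x: "x \<in> extend_scalars L"
  shows "linear_ext L g x = f x"
proof -
  have vs: "vector_space ((*s) :: 'a \<Rightarrow> 'a^'n \<Rightarrow> 'a^'n)"
    by (rule vec.vector_space_axioms)
  have "Vector_Spaces.linear (*s) (*s) f"
    unfolding Vector_Spaces.linear_iff using vs assms by auto
  with f have "Vector_Spaces.linear (*s) (*s) (linear_ext L g :: 'a^'n \<Rightarrow> _) \<and>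
      (\<forall>v\<in>L. linear_ext L g (embed v :: 'a^'n) = embed (g v))"
    unfolding linear_ext_def
    by (intro someI[of "\<lambda>f. Vector_Spaces.linear (*s) (*s) f \<and> (\<forall>v\<in>L. f (embed v) = embed (g v))" f]) auto
  then have l: "linear_ext L g (x + y) = linear_ext L g x + linear_ext L g y"
      "linear_ext L g (c *s x) = c *s linear_ext L g x"
      "v \<in> L \<Longrightarrow> linear_ext L g (embed v :: 'a^'n) = embed (g v)" for x y :: "'a^'n" and c v
    unfolding Vector_Spaces.linear_iff by blast+
  have z: "linear_ext L g (0 :: 'a^'n) = 0" "f 0 = 0"
    using l(1)[of 0 0] assms(1)[of 0 0] by simp_all
  show ?thesis
    using x unfolding extend_scalars_def
  proof (induction rule: vec.span_induct_alt)
    case base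
    then show ?case by (simp add: z)
  next
    case (step c x y)
    then show ?case using l assms by auto
  qed
qed

lemma additive_scale_int:
  fixes g :: "int^'n \<Rightarrow> int^'m"
  assumes add: "\<And>x y. g (x + y) = g x + g y"
  shows "g (c *s x) = c *s g x"
proof -
  have zero: "g 0 = 0" using add[of 0 0] by simp
  have "g (- x) + g x = 0" for x
    by (metis add zero add.left_inverse)
  then have neg: "g (- x) = - g x" for x
    by (simp add: eq_neg_iff_add_eq_0)
  show ?thesis
  proof (induction c rule: int_induct[where k = 0])
    case base
    then show ?case by (simp add: zero)
  next
    case (step1 i)
    have "(i + 1) *s x = i *s x + x" "(i + 1) *s g x = i *s g x + g x"
      by (simp_all add: vec_eq_iff algebra_simps)
    with step1 show ?case by (simp add: add)
  next
    case (step2 i)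
    have "(i - 1) *s x = i *s x + (- x)" "(i - 1) *s g x = i *s g x + (- g x)"
      by (simp_all add: vec_eq_iff algebra_simps)
    with step2 show ?case by (simp only: add neg)
  qed
qed

lemma additive_sum:
  fixes g :: "int^'n \<Rightarrow> int^'m"
  assumes add: "\<And>x y. g (x + y) = g x + g y"
  shows "g (\<Sum>i\<in>I. f i) = (\<Sum>i\<in>I. g (f i))"
proof -
  have "g 0 = 0" using add[of 0 0] by simp
  then show ?thesis
    by (induction I rule: infinite_finite_induct) (auto simp: add)
qed

lemma linear_ext_UNIV:
  fixes g :: "int^'n \<Rightarrow> int^'n"
  assumes add: "\<And>x y. g (x + y) = g x + g y"
  shows "linear_ext UNIV g x = (\<Sum>i\<in>UNIV. x $ i *s embed (g (axis i 1)))"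
proof (rule linear_ext_eq)
  show "(\<Sum>i\<in>UNIV. embed v $ i *s embed (g (axis i 1))) = embed (g v)" for v
  proof -
    have "g v = g (\<Sum>i\<in>UNIV. v $ i *s axis i 1)"
      by (simp add: basis_expansion)
    also have "\<dots> = (\<Sum>i\<in>UNIV. v $ i *s g (axis i 1))"
      by (simp add: additive_sum[OF add] additive_scale_int[OF add])
    finally show ?thesis
      by (simp add: embed_sum embed_scale)
  qed
qed (simp_all add: vec_eq_iff sum.distrib sum_distrib_left algebra_simps)

lemma linear_ext_UNIV_linear:
  assumes add: "\<And>x y. g (x + y) = g x + g y"
  shows "linear_ext UNIV g (x + y) = linear_ext UNIV g x + linear_ext UNIV g y"
    "linear_ext UNIV g (c *s x) = c *s linear_ext UNIV g x"
    "linear_ext UNIV g (embed v) = embed (g v)"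
proof -
  show "linear_ext UNIV g (x + y) = linear_ext UNIV g x + linear_ext UNIV g y"
    "linear_ext UNIV g (c *s x) = c *s linear_ext UNIV g x"
    unfolding linear_ext_UNIV[OF add] by (simp_all add: vec_eq_iff sum.distrib sum_distrib_left algebra_simps)
  have "g v = g (\<Sum>i\<in>UNIV. v $ i *s axis i 1)"
    by (simp add: basis_expansion)
  also have "\<dots> = (\<Sum>i\<in>UNIV. v $ i *s g (axis i 1))"
    by (simp add: additive_sum[OF add] additive_scale_int[OF add])
  finally show "linear_ext UNIV g (embed v) = embed (g v)"
    unfolding linear_ext_UNIV[OF add] by (simp add: embed_sum embed_scale)
qed

lemma linear_ext_compose:
  assumes g: "\<And>x y. g (x + y) = g x + g y" and h: "\<And>x y. h (x + y) = h x + h y"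
  shows "linear_ext UNIV (\<lambda>x. g (h x)) x = linear_ext UNIV g (linear_ext UNIV h x)"
  by (rule linear_ext_eq) (simp_all add: linear_ext_UNIV_linear[OF g] linear_ext_UNIV_linear[OF h])

lemma linear_ext_id: "linear_ext UNIV (\<lambda>x. x) x = x"
  by (rule linear_ext_eq) auto

lemma line_image:
  assumes "\<And>c x. f (c *s x) = c *s f x"
  shows "f ` line x = line (f x)"
  unfolding line_eq image_image assms ..

lemma isometries_UNIV:
  "g \<in> isometries Q UNIV \<longleftrightarrow> bij g \<and> (\<forall>x y. g (x + y) = g x + g y) \<and> (\<forall>x y. bform Q (g x) (g y) = bform Q x y)"
  by (simp add: isometries_def Bij_def)

lemma isometries_compose:
  "g \<in> isometries Q UNIV \<Longrightarrow> h \<in> isometries Q UNIV \<Longrightarrow> (\<lambda>x. g (h x)) \<in> isometries Q UNIV"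
  unfolding isometries_UNIV using bij_comp[of h g] by (simp add: comp_def)

lemma isometries_inv:
  assumes "g \<in> isometries Q UNIV"
  shows "inv_into UNIV g \<in> isometries Q UNIV"
proof -
  have g: "bij g" "\<And>x y. g (x + y) = g x + g y" "\<And>x y. bform Q (g x) (g y) = bform Q x y"
    using assms by (auto simp: isometries_UNIV)
  have gi: "g (inv_into UNIV g x) = x" for x using g(1) by (simp add: bij_is_surj surj_f_inv_f)
  have "inv_into UNIV g (x + y) = inv_into UNIV g x + inv_into UNIV g y" for x y
    by (metis g(1,2) gi bij_is_inj inv_f_f)
  moreover have "bform Q (inv_into UNIV g x) (inv_into UNIV g y) = bform Q x y" for x y
    by (metis g(3) gi)
  ultimately show ?thesis
    using g(1) by (simp add: isometries_UNIV bij_imp_bij_inv)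
qed

lemma trivial_on_discriminant_compose:
  assumes g: "g \<in> isometries Q UNIV" "trivial_on_discriminant Q UNIV g"
    and h: "h \<in> isometries Q UNIV" "trivial_on_discriminant Q UNIV h"
  shows "trivial_on_discriminant Q UNIV (\<lambda>x. g (h x))"
  unfolding trivial_on_discriminant_def
proof
  fix x :: "rat^'a" assume x: "x \<in> dual_lattice Q UNIV"
  have ga: "\<And>x y. g (x + y) = g x + g y" and ha: "\<And>x y. h (x + y) = h x + h y"
    using g h by (auto simp: isometries_UNIV)
  obtain v where v: "linear_ext UNIV h x - x = embed v"
    using h(2) x unfolding trivial_on_discriminant_def by blast
  obtain w where w: "linear_ext UNIV g x - x = embed w"
    using g(2) x unfolding trivial_on_discriminant_def by blast
  have "linear_ext UNIV g (linear_ext UNIV h x) = linear_ext UNIV g (x + embed v)"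
    using v by (simp add: algebra_simps)
  also have "\<dots> = x + embed w + embed (g v)"
    using w by (simp add: linear_ext_UNIV_linear[OF ga] algebra_simps)
  finally have "linear_ext UNIV (\<lambda>x. g (h x)) x - x = embed (w + g v)"
    by (simp add: linear_ext_compose[OF ga ha] embed_add)
  then show "linear_ext UNIV (\<lambda>x. g (h x)) x - x \<in> range embed"
    by auto
qed

lemma trivial_on_discriminant_inv:
  assumes g: "g \<in> isometries Q UNIV" "trivial_on_discriminant Q UNIV g"
  shows "trivial_on_discriminant Q UNIV (inv_into UNIV g)"
  unfolding trivial_on_discriminant_def
proof
  fix x :: "rat^'a" assume x: "x \<in> dual_lattice Q UNIV"
  have i: "inv_into UNIV g \<in> isometries Q UNIV" using g(1) by (rule isometries_inv)
  have ga: "\<And>x y. g (x + y) = g x + g y" and ia: "\<And>x y. inv_into UNIV g (x + y) = inv_into UNIV g x + inv_into UNIV g y"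
    using g i by (auto simp: isometries_UNIV)
  have "bij g" using g by (simp add: isometries_UNIV)
  then have "(\<lambda>x. inv_into UNIV g (g x)) = (\<lambda>x. x)" by (simp add: bij_is_inj)
  then have inv1: "linear_ext UNIV (inv_into UNIV g) (linear_ext UNIV g x) = x"
    using linear_ext_compose[of "inv_into UNIV g" g x] ga ia by (simp add: linear_ext_id)
  obtain w where w: "linear_ext UNIV g x - x = embed w"
    using g(2) x unfolding trivial_on_discriminant_def by blast
  then have "linear_ext UNIV g x = x + embed w" by (simp add: algebra_simps)
  then have "x = linear_ext UNIV (inv_into UNIV g) x + embed (inv_into UNIV g w)"
    using inv1 by (simp add: linear_ext_UNIV_linear[OF ia])
  then have "linear_ext UNIV (inv_into UNIV g) x - x = embed (0 - inv_into UNIV g w)"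
    unfolding embed_diff by (simp add: algebra_simps)
  then show "linear_ext UNIV (inv_into UNIV g) x - x \<in> range embed"
    by (metis rangeI)
qed

lemma line_action_compose:
  assumes "g \<in> isometries Q UNIV" "h \<in> isometries Q UNIV"
  shows "line_action UNIV (\<lambda>x. g (h x)) l = line_action UNIV g (line_action UNIV h l)"
  using assms by (simp add: line_action_def linear_ext_compose image_image isometries_UNIV)

lemma line_action_id: "line_action UNIV (\<lambda>x. x) l = l"
  by (simp add: line_action_def linear_ext_id)

lemma mult_BijGroup_UNIV: "bij g \<Longrightarrow> bij h \<Longrightarrow> g \<otimes>\<^bsub>BijGroup UNIV\<^esub> h = (\<lambda>x. g (h x))"
  by (simp add: BijGroup_def Bij_def compose_def restrict_def)

lemma Gamma_hat_iff:
  "g \<in> carrier (Gamma_hat Q D) \<longleftrightarrow> g \<in> isometries Q UNIV \<and> trivial_on_discriminant Q UNIV g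
     \<and> line_action UNIV g ` D = D"
  by (simp add: Gamma_hat_def)

lemma mult_Gamma_hat:
  "g \<in> carrier (Gamma_hat Q D) \<Longrightarrow> h \<in> carrier (Gamma_hat Q D) \<Longrightarrow> g \<otimes>\<^bsub>Gamma_hat Q D\<^esub> h = (\<lambda>x. g (h x))"
  using mult_BijGroup_UNIV[of g h] by (simp add: Gamma_hat_def isometries_UNIV)

lemma group_Gamma_hat: "group (Gamma_hat Q D)"
proof -
  have "subgroup (carrier (Gamma_hat Q D)) (BijGroup UNIV)"
  proof (rule group.subgroupI[OF group_BijGroup])
    show "carrier (Gamma_hat Q D) \<subseteq> carrier (BijGroup UNIV)"
      by (auto simp: Gamma_hat_iff isometries_def BijGroup_def)
    have "(\<lambda>x. x) \<in> isometries Q UNIV"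
      by (simp add: isometries_UNIV bij_id[unfolded id_def])
    moreover have "trivial_on_discriminant Q UNIV (\<lambda>x. x)"
      unfolding trivial_on_discriminant_def by (auto simp: linear_ext_id intro: range_eqI[of _ _ 0])
    ultimately have "(\<lambda>x. x) \<in> carrier (Gamma_hat Q D)"
      by (simp add: Gamma_hat_iff line_action_id)
    then show "carrier (Gamma_hat Q D) \<noteq> {}" by blast
  next
    fix g assume "g \<in> carrier (Gamma_hat Q D)"
    then have g: "g \<in> isometries Q UNIV" "trivial_on_discriminant Q UNIV g" "line_action UNIV g ` D = D"
      by (auto simp: Gamma_hat_iff)
    have "bij g" using g by (simp add: isometries_UNIV)
    then have *: "(\<lambda>x. inv_into UNIV g (g x)) = (\<lambda>x. x)" by (simp add: bij_is_inj)
    have "line_action UNIV (inv_into UNIV g) ` line_action UNIV g ` D = D"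
      using line_action_compose[OF isometries_inv[OF g(1)] g(1)]
      by (simp add: image_image * line_action_id flip: line_action_compose[OF isometries_inv[OF g(1)] g(1)])
    then have "inv_into UNIV g \<in> carrier (Gamma_hat Q D)"
      using g by (simp add: Gamma_hat_iff isometries_inv trivial_on_discriminant_inv)
    moreover have "g \<in> Bij UNIV" using \<open>bij g\<close> by (simp add: Bij_def)
    then have "inv\<^bsub>BijGroup UNIV\<^esub> g = inv_into UNIV g"
      by (simp add: inv_BijGroup restrict_def)
    ultimately show "inv\<^bsub>BijGroup UNIV\<^esub> g \<in> carrier (Gamma_hat Q D)" by simp
  next
    fix g h assume *: "g \<in> carrier (Gamma_hat Q D)" "h \<in> carrier (Gamma_hat Q D)"
    then have i: "g \<in> isometries Q UNIV" "h \<in> isometries Q UNIV"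
      by (auto simp: Gamma_hat_iff)
    have "line_action UNIV g ` line_action UNIV h ` D = D"
      using * by (simp add: Gamma_hat_iff)
    then have "(\<lambda>x. g (h x)) \<in> carrier (Gamma_hat Q D)"
      using * by (simp add: Gamma_hat_iff isometries_compose trivial_on_discriminant_compose
          line_action_compose[OF i] image_image)
    then show "g \<otimes>\<^bsub>BijGroup UNIV\<^esub> h \<in> carrier (Gamma_hat Q D)"
      using i by (simp add: mult_BijGroup_UNIV isometries_UNIV)
  qed
  from group.subgroup_imp_group[OF group_BijGroup this] show ?thesis
    by (simp add: Gamma_hat_def)
qed

lemma normalizer_iff:
  assumes "G \<subseteq> carrier \<Gamma>"
  shows "n \<in> normalizer \<Gamma> G \<longleftrightarrow> n \<in> carrier \<Gamma> \<and> n <#\<^bsub>\<Gamma>\<^esub> G #>\<^bsub>\<Gamma>\<^esub> inv\<^bsub>\<Gamma>\<^esub> n = G"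
  using assms by (simp add: normalizer_def stabilizer_def)

lemma (in group) centralizer_subset_normalizer:
  assumes "H \<subseteq> carrier G" "n \<in> carrier G" "\<And>g. g \<in> H \<Longrightarrow> n \<otimes> g = g \<otimes> n"
  shows "n \<in> normalizer G H"
proof -
  have "n \<otimes> g \<otimes> inv n = g" if "g \<in> H" for g
    using assms that by (metis inv_solve_right' m_closed subsetD)
  then have "n <# H #> inv n = H"
    unfolding l_coset_def r_coset_def by force
  then show ?thesis
    using assms by (simp add: normalizer_iff)
qed

lemma (in group) normalizer_commute:
  assumes "H \<subseteq> carrier G" "n \<in> normalizer G H" "g \<in> H"
  obtains g' where "g' \<in> H" "g \<otimes> n = n \<otimes> g'"
proof -
  have n: "n \<in> carrier G" "n <# H #> inv n = H"
    using assms by (simp_all add: normalizer_iff)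
  then have "g \<in> n <# H #> inv n" using assms by simp
  then obtain g' where g': "g' \<in> H" "g = n \<otimes> g' \<otimes> inv n"
    unfolding l_coset_def r_coset_def by blast
  then have "g \<otimes> n = n \<otimes> g'"
    using n assms by (simp add: m_assoc subsetD)
  with g' show ?thesis using that by blast
qed

section \<open>The action on the invariant sublattice\<close>

text \<open>An isometry keeps or exchanges components as a whole, so one point decides. Points of
  the other component are reached through conjugation, with which \<open>f\<close> commutes.\<close>

lemma (in period_space) orient_pos_everywhere:
  assumes neg: "two_negative Q"
    and f: "\<And>x y. orient Q (f x) (f y) = orient Q x y" "\<And>x. f (vcnj x) = vcnj (f x)"
      "\<And>x. x \<in> period_vectors Q UNIV \<Longrightarrow> f x \<in> period_vectors Q UNIV"
    and x: "x \<in> period_vectors Q UNIV" "0 < orient Q x (f x)" and y: "y \<in> period_vectors Q UNIV"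
  shows "0 < orient Q y (f y)"
proof -
  have *: "0 < orient Q y (f y)" if z: "z \<in> period_vectors Q UNIV" "0 < orient Q z (f z)" "0 < orient Q z y" for z
  proof -
    have "0 < orient Q y z" using z by (simp add: orient_commute)
    then have "0 < orient Q y (f z)"
      by (rule orient_trans[OF neg y z(1) f(3)[OF z(1)] _ z(2)])
    moreover have "0 < orient Q (f z) (f y)" using z f by simp
    ultimately show ?thesis
      by (rule orient_trans[OF neg y f(3)[OF z(1)] f(3)[OF y]])
  qed
  have "orient Q x y \<noteq> 0" by (rule orient_nonzero[OF neg x(1) y])
  then have "0 < orient Q x y \<or> 0 < - orient Q x y" by linarith
  then consider "0 < orient Q x y" | "0 < orient Q (vcnj x) y"
    unfolding orient_vcnj_left by blast
  then show ?thesis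
  proof cases
    case 1
    then show ?thesis using * x by blast
  next
    case 2
    moreover have "vcnj x \<in> period_vectors Q UNIV"
      using x(1) by (simp add: period_vectors_def bform_vcnj bform_sym[of "vcnj x" x])
    moreover have "0 < orient Q (vcnj x) (f (vcnj x))"
      using x(2) by (simp add: f orient_vcnj_vcnj)
    ultimately show ?thesis using * by blast
  qed
qed

locale fixed_lattice = sublattice Q b T1_gram for Q :: "int^'n^'n" and b :: "int^'n^3" +
  fixes D :: "(complex^'n) set set" and G :: "(int^'n \<Rightarrow> int^'n) set"
  assumes neg: "two_negative Q"
    and D: "is_period_domain Q UNIV D"
    and G: "subgroup G (Gamma_hat Q D)"
    and basis: "integral_basis b (fixed_sublattice G)"
begin

abbreviation L :: "(int^'n) set" where
  "L \<equiv> fixed_sublattice G"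

lemma L_eq: "L = range lin_comb"
  using basis by (simp add: integral_basis_def bij_betw_def lin_comb_def)

lemma b_in_L: "b $ i \<in> L"
proof -
  have "b $ i = lin_comb (axis i 1)"
    by (simp add: lin_comb_def axis_def vec_eq_iff if_distrib[of "\<lambda>c. c * _"] cong: if_cong)
  then show ?thesis by (simp add: L_eq)
qed

lemma G_fixes_b: "g \<in> G \<Longrightarrow> g (b $ i) = b $ i"
  using b_in_L[of i] by (simp add: fixed_sublattice_def)

lemma G_subset: "G \<subseteq> carrier (Gamma_hat Q D)"
  using G by (rule subgroup.subset)

lemma extend_scalars_L: "extend_scalars L = range (lin_comb :: 'a::field^3 \<Rightarrow> 'a^'n)"
proof
  show "extend_scalars L \<subseteq> range (lin_comb :: 'a^3 \<Rightarrow> 'a^'n)"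
  proof
    fix x :: "'a^'n" assume "x \<in> extend_scalars L"
    then show "x \<in> range lin_comb"
      unfolding extend_scalars_def
    proof (induction rule: vec.span_induct_alt)
      case base
      have "0 = lin_comb (0 :: 'a^3)" by (simp add: lin_comb_def)
      then show ?case by blast
    next
      case (step c x y)
      then obtain v and d :: "'a^3" where "x = lin_comb (embed v)" "y = lin_comb d"
        by (auto simp: L_eq lin_comb_embed)
      then have "c *s x + y = lin_comb (c *s embed v + d)"
        by (simp add: lin_comb_add lin_comb_scale)
      then show ?case by blast
    qed
  qed
  show "range (lin_comb :: 'a^3 \<Rightarrow> 'a^'n) \<subseteq> extend_scalars L"
  proof safe
    fix c :: "'a^3"
    show "lin_comb c \<in> extend_scalars L"
      unfolding lin_comb_def extend_scalars_def
      by (intro vec.span_sum vec.span_scale vec.span_base imageI b_in_L)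
  qed
qed

text \<open>The inverse Gram matrix applied to the pairings: orthogonal projection to the span of
  the sublattice, read in the basis. Being defined on the whole space, it provides the globally
  linear map that \<open>linear_ext_eq\<close> asks for.\<close>

definition coords :: "'a::field_char_0^'n \<Rightarrow> 'a^3" where
  "coords x = (1 / 588) *s (of_int_mat (adjugate3 T1_gram) *v pairing x)"

lemma coords_lin_comb [simp]: "coords (lin_comb c) = c"
proof -
  have "of_int_mat (mat 588) *v c = 588 *s c"
    by (simp add: vec_eq_iff matrix_vector_mult_def mat_def if_distrib[of "\<lambda>c. c * _"] if_distrib[of of_int] cong: if_cong)
  then show ?thesis
    by (simp add: coords_def pairing_lin_comb matrix_vector_mul_assoc adjugate3 det_T1_gram
        flip: of_int_mat_mult)
qed

lemma coords_linear: "coords (x + y) = coords x + coords y" "coords (c *s x) = c *s coords x"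
  by (simp_all add: coords_def pairing_add pairing_scale matrix_vector_right_distrib of_int_mat_scale
      vec.scale_right_distrib)

lemma lin_comb_inject: "lin_comb x = lin_comb y \<longleftrightarrow> x = (y :: 'a::field_char_0^3)"
  by (metis coords_lin_comb)

lemma period_vectors_L:
  "period_vectors Q (extend_scalars L) = lin_comb ` period_vectors T1_gram UNIV"
  unfolding extend_scalars_L by (auto simp: period_vectors_def bform_lin_comb_lin_comb vcnj_lin_comb)

lemma lin_comb_period_vectors:
  "x \<in> period_vectors T1_gram UNIV \<longleftrightarrow> lin_comb x \<in> period_vectors Q UNIV"
  by (simp add: period_vectors_def bform_lin_comb_lin_comb vcnj_lin_comb)

definition acts :: "(int^'n \<Rightarrow> int^'n) \<Rightarrow> int^3^3 \<Rightarrow> bool" where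
  "acts g M \<longleftrightarrow> (\<forall>c. g (lin_comb c) = lin_comb (M *v c))"

lemma acts_restrict: "acts (restrict g L) M \<longleftrightarrow> acts g M"
  by (simp add: acts_def L_eq)

lemma line_action_lin_comb:
  assumes "acts g M"
  shows "line_action L g (line (lin_comb y)) = line (lin_comb (of_int_mat M *v y))"
proof -
  define f :: "complex^'n \<Rightarrow> complex^'n" where "f x = lin_comb (of_int_mat M *v coords x)" for x
  have f: "f (x + y) = f x + f y" "f (c *s x) = c *s f x" for x y c
    by (simp_all add: f_def coords_linear matrix_vector_right_distrib of_int_mat_scale lin_comb_add
        lin_comb_scale)
  have "f (embed v) = embed (g v)" if vL: "v \<in> L" for v
  proof -
    obtain c where c: "v = lin_comb c" using vL by (auto simp: L_eq)
    have "g v = lin_comb (M *v c)" using assms by (simp add: c acts_def)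
    then show ?thesis
      by (simp add: c f_def embed_mult flip: lin_comb_embed)
  qed
  then have "linear_ext L g x = f x" if "x \<in> extend_scalars L" for x
    by (intro linear_ext_eq f that) auto
  moreover have "line (lin_comb y) \<subseteq> extend_scalars L"
    unfolding line_eq by (auto simp: extend_scalars_L simp flip: lin_comb_scale)
  ultimately have "linear_ext L g ` line (lin_comb y) = f ` line (lin_comb y)"
    by (intro image_cong) auto
  also have "\<dots> = line (f (lin_comb y))"
    by (rule line_image) (rule f)
  finally show ?thesis
    by (simp add: line_action_def f_def)
qed

lemma linear_ext_transvection: "linear_ext UNIV (transvection A) x = transvection A x"
  by (rule linear_ext_eq) (simp_all add: transvection_linear transvection_embed)

lemma transvection_inverse:
  assumes "(mat 1 + A ** T1_gram) ** (mat 1 + B ** T1_gram) = mat 1"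
  shows "transvection A (transvection B x) = x"
proof -
  have "(A + B + A ** T1_gram ** B) ** T1_gram + mat 1 = 0 ** T1_gram + mat 1"
    using assms by (simp add: matrix_add_ldistrib matrix_add_rdistrib matrix_mul_assoc add_ac)
  then have "(A + B + A ** T1_gram ** B) ** T1_gram = 0 ** T1_gram"
    by (rule add_right_imp_eq)
  then have "A + B + A ** T1_gram ** B = 0"
    by (rule T1_gram_cancel)
  then show ?thesis
    by (simp add: transvection_transvection)
qed

text \<open>The component needs checking at a single point, which may be taken in the small period
  domain. The matrix \<open>B\<close> belongs to the inverse isometry and gives surjectivity, both
  on the lattice and on \<open>D\<close>.\<close>

lemma transvection_in_Gamma_hat:
  assumes A: "A + transpose A + transpose A ** T1_gram ** A = 0"
    and B: "B + transpose B + transpose B ** T1_gram ** B = 0"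
    and AB: "(mat 1 + A ** T1_gram) ** (mat 1 + B ** T1_gram) = mat 1"
      "(mat 1 + B ** T1_gram) ** (mat 1 + A ** T1_gram) = mat 1"
    and x: "x \<in> period_vectors T1_gram UNIV" "0 < orient3 x (of_int_mat (mat 1 + A ** T1_gram) *v x)"
  shows "transvection A \<in> carrier (Gamma_hat Q D)"
proof -
  have inv: "transvection A (transvection B y) = y" "transvection B (transvection A y) = y"
    for y :: "'a::comm_ring_1^'n"
    using AB by (simp_all add: transvection_inverse)
  have iso: "bform Q (transvection A x) (transvection A y) = bform Q x y"
    "bform Q (transvection B x) (transvection B y) = bform Q x y" for x y :: "'a::comm_ring_1^'n"
    using A B by (simp_all add: transvection_isometry)
  have ori: "orient Q (transvection A x) (transvection A y) = orient Q x y" for x y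
    by (simp add: orient_def iso flip: transvection_vcnj)
  have per: "transvection A x \<in> period_vectors Q UNIV" "transvection B x \<in> period_vectors Q UNIV"
    if "x \<in> period_vectors Q UNIV" for x
    using that by (simp_all add: period_vectors_def iso flip: transvection_vcnj)
  have "0 < orient Q (lin_comb x) (transvection A (lin_comb x))"
    using x by (simp add: transvection_lin_comb orient_lin_comb)
  then have pos: "0 < orient Q y (transvection A y)" if "y \<in> period_vectors Q UNIV" for y
    using orient_pos_everywhere[of "transvection A" "lin_comb x" y] neg ori per x that
    by (simp add: transvection_vcnj lin_comb_period_vectors)
  have pos': "0 < orient Q y (transvection B y)" if "y \<in> period_vectors Q UNIV" for y
    using pos[OF per(2)[OF that]] by (simp add: inv orient_commute)
  have sub: "D \<subseteq> line ` period_vectors Q UNIV"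
    using D connected_components_of_subset topspace_full_period_domain[of Q UNIV]
    unfolding is_period_domain_def by fastforce
  have la: "line_action UNIV (transvection C) (line y) = line (transvection C y)" for C and y :: "complex^'n"
    unfolding line_action_def linear_ext_transvection by (rule line_image) (rule transvection_linear)
  have step: "line (transvection C y) \<in> D"
    if "y \<in> period_vectors Q UNIV" "line y \<in> D" "transvection C y \<in> period_vectors Q UNIV"
      "0 < orient Q y (transvection C y)" for C y
    using period_domain_orient[OF neg D, of y "transvection C y"] that by simp
  have "line_action UNIV (transvection A) ` D = D"
  proof
    show "line_action UNIV (transvection A) ` D \<subseteq> D"
    proof
      fix l assume "l \<in> line_action UNIV (transvection A) ` D"
      then obtain y where y: "y \<in> period_vectors Q UNIV" "line y \<in> D"
          "l = line_action UNIV (transvection A) (line y)"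
        using sub by blast
      then show "l \<in> D"
        using step[of y A] la pos per by simp
    qed
    show "D \<subseteq> line_action UNIV (transvection A) ` D"
    proof
      fix l assume "l \<in> D"
      then obtain y where y: "y \<in> period_vectors Q UNIV" "line y \<in> D" "l = line y"
        using sub by blast
      then have "line (transvection B y) \<in> D"
        using step[of y B] pos' per by simp
      moreover have "l = line_action UNIV (transvection A) (line (transvection B y))"
        by (simp add: la inv y)
      ultimately show "l \<in> line_action UNIV (transvection A) ` D" by blast
    qed
  qed
  moreover have "bij (transvection A :: int^'n \<Rightarrow> int^'n)"
    by (rule o_bij[of "transvection B"]) (simp_all add: fun_eq_iff inv)
  then have "transvection A \<in> isometries Q UNIV"
    by (simp add: isometries_UNIV transvection_linear iso)
  moreover have "trivial_on_discriminant Q UNIV (transvection A)"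
    unfolding trivial_on_discriminant_def
  proof
    fix x :: "rat^'n" assume x: "x \<in> dual_lattice Q UNIV"
    have "\<forall>j. \<exists>k. pairing x $ j = of_int k"
    proof
      fix j
      have "bform Q x (embed (b $ j)) \<in> \<int>"
        using x by (simp add: dual_lattice_def)
      then show "\<exists>k. pairing x $ j = of_int k"
        by (auto simp: pairing_def bform_sym[of x] elim: Ints_cases)
    qed
    then obtain k where "\<And>j. pairing x $ j = of_int (k j)" by metis
    then have "pairing x = embed (\<chi> j. k j)"
      by (simp add: vec_eq_iff)
    then have "linear_ext UNIV (transvection A) x - x = embed (lin_comb (A *v (\<chi> j. k j)))"
      unfolding linear_ext_transvection
      by (simp add: transvection_def embed_mult flip: lin_comb_embed)
    then show "linear_ext UNIV (transvection A) x - x \<in> range embed" by blast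
  qed
  ultimately show ?thesis by (simp add: Gamma_hat_iff)
qed

text \<open>An element of \<open>G\<close> is an isometry fixing the basis, so it changes neither
  the pairings with the basis nor the vector that the transvection adds.\<close>

lemma transvection_commute:
  assumes "g \<in> G"
  shows "g (transvection A v) = transvection A (g v)"
proof -
  have g: "g (x + y) = g x + g y" "bform Q (g x) (g y) = bform Q x y" for x y
    using assms G_subset by (auto simp: Gamma_hat_iff isometries_UNIV)
  have "g (lin_comb c) = lin_comb c" for c
    using G_fixes_b[OF assms] by (simp add: lin_comb_def additive_sum[OF g(1)] additive_scale_int[OF g(1)])
  moreover have "bform Q (b $ j) (g v) = bform Q (b $ j) v" for j
    using G_fixes_b[OF assms, of j] g(2)[of "b $ j" v] by simp
  then have "pairing (g v) = pairing v"
    by (simp add: pairing_def vec_eq_iff)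
  ultimately show ?thesis by (simp add: transvection_def g)
qed

lemma transvection_in_normalizer:
  assumes "transvection A \<in> carrier (Gamma_hat Q D)"
  shows "transvection A \<in> normalizer (Gamma_hat Q D) G"
proof (rule group.centralizer_subset_normalizer[OF group_Gamma_hat G_subset assms])
  fix g assume "g \<in> G"
  then show "transvection A \<otimes>\<^bsub>Gamma_hat Q D\<^esub> g = g \<otimes>\<^bsub>Gamma_hat Q D\<^esub> transvection A"
    using assms G_subset by (simp add: mult_Gamma_hat subsetD transvection_commute)
qed

text \<open>If \<open>v\<close> is fixed by \<open>G\<close>, then
  \<open>g (n v) = n (g' v) = n v\<close> with \<open>g'\<close> in \<open>G\<close>, so
  \<open>n\<close> maps the invariant sublattice to itself. The columns of \<open>M\<close> are the
  coordinates of the images of the basis.\<close>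

lemma normalizer_acts:
  assumes n: "n \<in> normalizer (Gamma_hat Q D) G"
  obtains M where "acts n M" "T1_isometry M"
proof -
  have nc: "n \<in> carrier (Gamma_hat Q D)"
    using n by (simp add: normalizer_iff[OF G_subset])
  then have ni: "n (x + y) = n x + n y" "bform Q (n x) (n y) = bform Q x y" for x y
    by (auto simp: Gamma_hat_iff isometries_UNIV)
  have "n v \<in> L" if v: "v \<in> L" for v
    unfolding fixed_sublattice_def
  proof (intro CollectI ballI)
    fix g assume g: "g \<in> G"
    obtain g' where g': "g' \<in> G" "g \<otimes>\<^bsub>Gamma_hat Q D\<^esub> n = n \<otimes>\<^bsub>Gamma_hat Q D\<^esub> g'"
      using group.normalizer_commute[OF group_Gamma_hat G_subset n g] .
    then have "g (n v) = n (g' v)"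
      using nc g G_subset by (simp add: mult_Gamma_hat subsetD fun_eq_iff)
    also have "g' v = v" using v g' by (simp add: fixed_sublattice_def)
    finally show "g (n v) = n v" .
  qed
  then have "\<forall>j. \<exists>c. n (b $ j) = lin_comb c"
    using b_in_L L_eq by (metis rangeE)
  then obtain m where m: "\<And>j. n (b $ j) = lin_comb (m j)" by metis
  define M :: "int^3^3" where "M = (\<chi> i j. m j $ i)"
  have "n (lin_comb c) = lin_comb (M *v c)" for c
  proof -
    have "n (lin_comb c) = (\<Sum>j\<in>UNIV. c $ j *s lin_comb (m j))"
      by (simp add: lin_comb_def[of c] additive_sum[OF ni(1)] additive_scale_int[OF ni(1)] m)
    also have "\<dots> = lin_comb (M *v c)"
      unfolding lin_comb_def M_def sum_3 by (simp add: vec_eq_iff matrix_vector_mult_def sum_3 algebra_simps)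
    finally show ?thesis .
  qed
  then have a: "acts n M" by (simp add: acts_def)
  have "transpose M ** T1_gram ** M = T1_gram"
  proof (rule bform_eqI)
    fix x y :: "int^3"
    have "bform (transpose M ** T1_gram ** M) x y = form (M *v x) (M *v y)"
      using bform_mult_left[of T1_gram M x "M *v y"] bform_mult_right[of "transpose M ** T1_gram" x M y] by simp
    also have "\<dots> = bform Q (n (lin_comb x)) (n (lin_comb y))"
      using a by (simp add: acts_def bform_lin_comb_lin_comb)
    also have "\<dots> = form x y"
      by (simp add: ni bform_lin_comb_lin_comb)
    finally show "bform (transpose M ** T1_gram ** M) x y = form x y" .
  qed
  with a show ?thesis using that by (simp add: T1_isometry_def)
qed

text \<open>\<open>Gamma_fixed\<close> written in the basis \<open>b\<close>. What is used later is
  that these are integral isometries, that 1 is among them, and that they are stable under right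
  multiplication by congruence isometries preserving the component.\<close>

definition matrices :: "(int^3^3) set" where
  "matrices = {M. T1_isometry M \<and> (\<exists>n\<in>normalizer (Gamma_hat Q D) G. acts n M)}"

lemma matrices_isometry: "M \<in> matrices \<Longrightarrow> T1_isometry M"
  by (simp add: matrices_def)

lemma carrier_Gamma_fixed: "carrier (Gamma_fixed Q D G) = (\<lambda>g. restrict g L) ` normalizer (Gamma_hat Q D) G"
  by (simp add: Gamma_fixed_def)

lemma Gamma_fixed_matrix:
  assumes "\<gamma> \<in> carrier (Gamma_fixed Q D G)"
  obtains M where "M \<in> matrices" "acts \<gamma> M"
proof -
  obtain n where n: "n \<in> normalizer (Gamma_hat Q D) G" "\<gamma> = restrict n L"
    using assms by (auto simp: carrier_Gamma_fixed)
  obtain M where "acts n M" "T1_isometry M" using normalizer_acts[OF n(1)] .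
  with n show ?thesis using that by (auto simp: matrices_def acts_restrict)
qed

lemma matrix_Gamma_fixed:
  assumes "M \<in> matrices"
  obtains \<gamma> where "\<gamma> \<in> carrier (Gamma_fixed Q D G)" "acts \<gamma> M"
proof -
  obtain n where n: "n \<in> normalizer (Gamma_hat Q D) G" "acts n M"
    using assms by (auto simp: matrices_def)
  then have "restrict n L \<in> carrier (Gamma_fixed Q D G)" "acts (restrict n L) M"
    by (simp_all add: carrier_Gamma_fixed acts_restrict)
  then show ?thesis by (rule that)
qed

lemma orbit_lin_comb:
  "orbit (Gamma_fixed Q D G) (line_action L) (line (lin_comb y))
    = {line (lin_comb (of_int_mat M *v y)) | M. M \<in> matrices}"
proof
  show "orbit (Gamma_fixed Q D G) (line_action L) (line (lin_comb y))
      \<subseteq> {line (lin_comb (of_int_mat M *v y)) | M. M \<in> matrices}"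
    unfolding orbit_def
  proof safe
    fix \<gamma> assume "\<gamma> \<in> carrier (Gamma_fixed Q D G)"
    then obtain M where "M \<in> matrices" "acts \<gamma> M" by (rule Gamma_fixed_matrix)
    then show "\<exists>M. line_action L \<gamma> (line (lin_comb y)) = line (lin_comb (of_int_mat M *v y)) \<and> M \<in> matrices"
      using line_action_lin_comb by blast
  qed
  show "{line (lin_comb (of_int_mat M *v y)) | M. M \<in> matrices}
      \<subseteq> orbit (Gamma_fixed Q D G) (line_action L) (line (lin_comb y))"
  proof safe
    fix M assume "M \<in> matrices"
    then obtain \<gamma> where "\<gamma> \<in> carrier (Gamma_fixed Q D G)" "acts \<gamma> M" by (rule matrix_Gamma_fixed)
    then show "line (lin_comb (of_int_mat M *v y)) \<in> orbit (Gamma_fixed Q D G) (line_action L) (line (lin_comb y))"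
      unfolding orbit_def using line_action_lin_comb[of \<gamma> M y] by blast
  qed
qed

lemma matrices_one: "mat 1 \<in> matrices"
proof -
  have "transvection 0 \<in> carrier (Gamma_hat Q D)"
  proof -
    have "\<one>\<^bsub>Gamma_hat Q D\<^esub> = (transvection 0 :: int^'n \<Rightarrow> int^'n)"
      by (simp add: Gamma_hat_def BijGroup_def fun_eq_iff)
    then show ?thesis
      using group_Gamma_hat[of Q D] by (metis group.is_monoid monoid.one_closed)
  qed
  then have "transvection 0 \<in> normalizer (Gamma_hat Q D) G"
    by (rule transvection_in_normalizer)
  moreover have "acts (transvection 0) (mat 1)"
    by (simp add: acts_def)
  ultimately show ?thesis
    by (auto simp: matrices_def T1_isometry_def)
qed

text \<open>The transvection extending \<open>H\<close> centralizes \<open>G\<close>, so composing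
  it with an element of the normalizer stays in the normalizer.\<close>

lemma matrices_mult_congruence:
  assumes M: "M \<in> matrices" and H: "congruence_isometry H"
    and x: "x \<in> period_vectors T1_gram UNIV" "0 < orient3 x (of_int_mat H *v x)"
  shows "M ** H \<in> matrices"
proof -
  obtain W where W: "H ** W = mat 1" "W ** H = mat 1" "congruence_isometry W"
    using congruence_isometry_inverse[OF H] .
  obtain A where A: "H = mat 1 + A ** T1_gram" "A + transpose A + transpose A ** T1_gram ** A = 0"
    using congruence_isometry_transvection[OF H] .
  obtain B where B: "W = mat 1 + B ** T1_gram" "B + transpose B + transpose B ** T1_gram ** B = 0"
    using congruence_isometry_transvection[OF W(3)] .
  have t: "transvection A \<in> carrier (Gamma_hat Q D)"
    using A B W x by (intro transvection_in_Gamma_hat[of A B]) auto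
  obtain n where n: "n \<in> normalizer (Gamma_hat Q D) G" "acts n M" "T1_isometry M"
    using M by (auto simp: matrices_def)
  then have nc: "n \<in> carrier (Gamma_hat Q D)"
    by (simp add: normalizer_iff[OF G_subset])
  have "subgroup (normalizer (Gamma_hat Q D) G) (Gamma_hat Q D)"
    by (rule group.normalizer_imp_subgroup[OF group_Gamma_hat G_subset])
  then have "n \<otimes>\<^bsub>Gamma_hat Q D\<^esub> transvection A \<in> normalizer (Gamma_hat Q D) G"
    using n transvection_in_normalizer[OF t] by (simp add: subgroup.m_closed)
  moreover have "acts (\<lambda>x. n (transvection A x)) (M ** H)"
    using n(2) by (simp add: acts_def transvection_lin_comb matrix_vector_mul_assoc A(1))
  moreover have "T1_isometry (M ** H)"
    using n(3) H by (simp add: T1_isometry_mult congruence_isometry_def)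
  ultimately show ?thesis
    using nc t by (auto simp: matrices_def mult_Gamma_hat)
qed

end

section \<open>Compactness of the quotient\<close>

abbreviation P3 :: "(complex^3) set" where
  "P3 \<equiv> period_vectors T1_gram UNIV"

lemma congruence_isometry_mult:
  assumes "congruence_isometry H" "congruence_isometry K"
  shows "congruence_isometry (H ** K)"
proof -
  obtain E F where EF: "H = mat 1 + mat 588 ** E" "K = mat 1 + mat 588 ** F"
    using assms by (auto simp: congruence_isometry_def)
  have "H ** K = mat 1 + mat 588 ** (E + F + E ** (mat 588 ** F))"
    by (simp add: EF matrix_add_ldistrib matrix_add_rdistrib matrix_mul_assoc add_ac)
  then show ?thesis
    using assms T1_isometry_mult unfolding congruence_isometry_def by blast
qed

lemma isometry_P3: "T1_isometry H \<Longrightarrow> of_int_mat H *v x \<in> P3 \<longleftrightarrow> x \<in> P3"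
  by (simp add: period_vectors_isometry T1_isometry_def)

lemma isometry_orient_T1:
  "T1_isometry H \<Longrightarrow> orient3 (of_int_mat H *v x) (of_int_mat H *v y) = orient3 x y"
  by (simp add: orient_isometry T1_isometry_def)

lemma gram_nth: "(V ** T1_gram ** transpose V) $ i $ j = form (V $ i) (V $ j)"
proof -
  have "(V ** T1_gram ** transpose V) $ i $ j = (\<Sum>k\<in>UNIV. V $ i $ k * (T1_gram ** transpose V) $ k $ j)"
    by (simp add: matrix_mul_assoc[symmetric]) (simp add: matrix_matrix_mult_def)
  also have "\<dots> = form (V $ i) (V $ j)"
    by (simp add: bform_alt matrix_matrix_mult_def matrix_vector_mult_def transpose_def)
  finally show ?thesis .
qed

lemma row_mult_transpose: "(V ** transpose H) $ i = H *v (V $ i :: 'a::comm_semiring_1^'n)"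
  by (simp add: vec_eq_iff matrix_matrix_mult_def matrix_vector_mult_def transpose_def mult.commute)

definition reduced_for :: "complex^3 \<Rightarrow> int^3^3 \<Rightarrow> bool" where
  "reduced_for x V \<longleftrightarrow> det V * det V = 1 \<and> (\<forall>i. majorant3 x (embed (V $ i)) \<le> 2600)"

lemma reduced_for_isometry:
  assumes "T1_isometry H" "reduced_for x V" "det V' * det V' = 1" "V' = V ** transpose H"
  shows "reduced_for (of_int_mat H *v x) V'"
proof -
  have "majorant3 (of_int_mat H *v x) (embed (V' $ i)) = majorant3 x (embed (V $ i))" for i
    using assms(1) by (simp add: assms(4) row_mult_transpose embed_mult majorant_isometry T1_isometry_def)
  with assms show ?thesis by (simp add: reduced_for_def)
qed

lemma reduced_for_gram_bound:
  assumes "x \<in> P3" "reduced_for x V"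
  shows "\<bar>(V ** T1_gram ** transpose V) $ i $ j\<bar> \<le> 2600"
proof -
  have "\<bar>form (embed (V $ i)) (embed (V $ j)) :: real\<bar> \<le> 2600"
  proof -
    have "majorant3 x (embed (V $ i)) \<le> 2600" "majorant3 x (embed (V $ j)) \<le> 2600"
      using assms(2) by (simp_all add: reduced_for_def)
    then have "(majorant3 x (embed (V $ i)) + majorant3 x (embed (V $ j))) / 2 \<le> 2600"
      by simp
    with T1.abs_bform_le_majorant[OF two_negative_T1 assms(1)] show ?thesis
      by (rule order_trans)
  qed
  then show ?thesis
    unfolding bform_embed gram_nth by linarith
qed

lemma finite_vectors:
  assumes "finite A"
  shows "finite {v :: 'a^'n. \<forall>i. v $ i \<in> A}"
proof (rule finite_surj)
  show "finite (PiE (UNIV :: 'n set) (\<lambda>_. A))"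
    using assms by (intro finite_PiE) auto
  show "{v :: 'a^'n. \<forall>i. v $ i \<in> A} \<subseteq> vec_lambda ` PiE UNIV (\<lambda>_. A)"
  proof
    fix v :: "'a^'n" assume "v \<in> {v. \<forall>i. v $ i \<in> A}"
    then have "vec_nth v \<in> PiE UNIV (\<lambda>_. A)" by auto
    then show "v \<in> vec_lambda ` PiE UNIV (\<lambda>_. A)"
      by (intro image_eqI[of _ _ "vec_nth v"]) auto
  qed
qed

lemma finite_matrices:
  assumes "finite A"
  shows "finite {M :: 'a^'n^'m. \<forall>i j. M $ i $ j \<in> A}"
  using finite_vectors[OF finite_vectors[OF assms, where 'n = 'n], where 'n = 'm] by simp

text \<open>
  Two points with reduced bases of the same Gram matrix and the same residues modulo 588 are related
  by a congruence isometry. There are finitely many possibilities; the sign in the second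
  label makes the isometry preserve the component.
\<close>

theorem finite_reduced_bases:
  assumes x0: "x0 \<in> P3"
  obtains \<V> where "finite \<V>" "\<And>x. x \<in> P3 \<Longrightarrow> 0 < orient3 x0 x \<Longrightarrow>
     \<exists>V\<in>\<V>. \<exists>H. congruence_isometry H \<and> 0 < orient3 x (of_int_mat H *v x) \<and> reduced_for (of_int_mat H *v x) V"
proof -
  define X where "X = {x \<in> P3. 0 < orient3 x0 x}"
  have "\<exists>V. reduced_for x V" if "x \<in> P3" for x
    using exists_reduced_basis[OF that] unfolding reduced_for_def by metis
  then obtain V where V: "\<And>x. x \<in> P3 \<Longrightarrow> reduced_for x (V x)" by metis
  have Vdet: "det (V x) * det (V x) = 1" if "x \<in> X" for x
    using V that by (auto simp: X_def reduced_for_def)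
  define lab where "lab = (\<lambda>x. (V x ** T1_gram ** transpose (V x), \<chi> i j. V x $ i $ j mod 588))"
  have "finite (lab ` X)"
  proof (rule finite_subset)
    show "lab ` X \<subseteq> {M. \<forall>i j. M $ i $ j \<in> {-2600..2600}} \<times> {M. \<forall>i j. M $ i $ j \<in> {0..588}}"
    proof (intro image_subsetI)
      fix x assume "x \<in> X"
      then have "\<bar>(V x ** T1_gram ** transpose (V x)) $ i $ j\<bar> \<le> 2600" for i j
        using V by (intro reduced_for_gram_bound) (auto simp: X_def)
      moreover have "V x $ i $ j mod 588 \<le> 588" for i j
        using pos_mod_bound[of 588 "V x $ i $ j"] by linarith
      ultimately show "lab x \<in> {M. \<forall>i j. M $ i $ j \<in> {-2600..2600}} \<times> {M. \<forall>i j. M $ i $ j \<in> {0..588}}"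
        by (simp add: lab_def abs_le_iff minus_le_iff)
    qed
  qed (intro finite_cartesian_product finite_matrices; simp)
  then obtain C1 where C1: "C1 \<subseteq> X" "finite C1" "lab ` X = lab ` C1"
    using finite_subset_image[of "lab ` X" lab X] by auto
  have "\<exists>\<rho>\<in>C1. lab \<rho> = lab x" if "x \<in> X" for x
    using that C1(3) by (metis imageE imageI)
  then obtain \<rho> where \<rho>: "\<And>x. x \<in> X \<Longrightarrow> \<rho> x \<in> C1" "\<And>x. x \<in> X \<Longrightarrow> lab (\<rho> x) = lab x" by metis
  have "\<exists>H. congruence_isometry H \<and> V (\<rho> x) = V x ** transpose H" if x: "x \<in> X" for x
  proof -
    have \<rho>X: "\<rho> x \<in> X" using \<rho>(1)[OF x] C1 by auto
    have gr: "V x ** T1_gram ** transpose (V x) = V (\<rho> x) ** T1_gram ** transpose (V (\<rho> x))"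
      using \<rho>(2)[OF x] by (simp add: lab_def)
    obtain H where H: "V (\<rho> x) = V x ** transpose H"
      "(\<exists>E. V (\<rho> x) = V x + mat 588 ** E) \<Longrightarrow> congruence_isometry H"
      using isometry_from_gram[OF Vdet[OF x] Vdet[OF \<rho>X] gr] by metis
    have "V (\<rho> x) $ i $ j mod 588 = V x $ i $ j mod 588" for i j
      using \<rho>(2)[OF x] by (simp add: lab_def vec_eq_iff)
    then have "\<exists>e. V (\<rho> x) $ i $ j = V x $ i $ j + 588 * e" for i j
      by (metis mod_eqE mult_minus_right add_uminus_conv_diff diff_add_cancel add.commute)
    then obtain e where "\<And>i j. V (\<rho> x) $ i $ j = V x $ i $ j + 588 * e i j" by metis
    then have "V (\<rho> x) = V x + mat 588 ** (\<chi> i j. e i j)"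
      by (simp add: vec_eq_iff mat_mult_nth)
    with H show ?thesis by blast
  qed
  then obtain h where h: "\<And>x. x \<in> X \<Longrightarrow> congruence_isometry (h x)"
    "\<And>x. x \<in> X \<Longrightarrow> V (\<rho> x) = V x ** transpose (h x)" by metis
  \<comment> \<open>The isometry \<open>h x\<close>, which carries the basis at \<open>x\<close> to
    the basis at \<open>\<rho> x\<close>, may exchange the components; the Boolean records whether
    it does.\<close>
  define lab2 where "lab2 = (\<lambda>x. (\<rho> x, 0 < orient3 x (of_int_mat (h x) *v x)))"
  have "finite (lab2 ` X)"
    by (rule finite_subset[of _ "C1 \<times> UNIV"]) (use C1 \<rho> in \<open>auto simp: lab2_def\<close>)
  then obtain C2 where C2: "C2 \<subseteq> X" "finite C2" "lab2 ` X = lab2 ` C2"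
    using finite_subset_image[of "lab2 ` X" lab2 X] by auto
  have "\<exists>W\<in>V ` C2. \<exists>H. congruence_isometry H \<and> 0 < orient3 x (of_int_mat H *v x)
     \<and> reduced_for (of_int_mat H *v x) W" if x: "x \<in> P3" "0 < orient3 x0 x" for x
  proof -
    have xX: "x \<in> X" using x by (simp add: X_def)
    then obtain r where r: "r \<in> C2" "lab2 r = lab2 x"
      using C2(3) by (metis imageE imageI)
    then have rX: "r \<in> X" using C2 by auto
    then have rP: "r \<in> P3" by (simp add: X_def)
    have tr: "0 < orient3 u w" if "u \<in> P3" "v \<in> P3" "w \<in> P3" "0 < orient3 u v" "0 < orient3 v w" for u v w
      using T1.orient_trans[OF two_negative_T1] that by blast
    have "0 < orient3 x x0" using x by (simp add: T1.orient_commute)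
    then have xr: "0 < orient3 x r"
      using rX by (intro tr[OF x(1) x0 rP]) (auto simp: X_def)
    have iso: "T1_isometry (h x)" "T1_isometry (h r)"
      using h xX rX by (auto simp: congruence_isometry_def)
    obtain W where W: "h r ** W = mat 1" "W ** h r = mat 1" "congruence_isometry W"
      using congruence_isometry_inverse[OF h(1)[OF rX]] .
    \<comment> \<open>Both \<open>h x\<close> and \<open>h r\<close> lead to the same basis, and
      they keep or exchange the components together, so any exchange cancels in
      \<open>H\<close>.\<close>
    define H where "H = W ** h x"
    have H: "congruence_isometry H"
      unfolding H_def by (intro congruence_isometry_mult W h xX)
    then have Hi: "T1_isometry H" by (simp add: congruence_isometry_def)
    have "V r = V x ** transpose H"
    proof -
      have "V x ** transpose (h x) = V r ** transpose (h r)"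
        using h(2)[OF xX] h(2)[OF rX] r(2) by (simp add: lab2_def)
      then have "V x ** transpose H = V r ** transpose (W ** h r)"
        by (simp add: H_def matrix_transpose_mul matrix_mul_assoc)
      then show ?thesis by (simp add: W)
    qed
    then have red: "reduced_for (of_int_mat H *v x) (V r)"
      using reduced_for_isometry[OF Hi V[OF x(1)] Vdet[OF rX]] by blast
    define a c where "a = of_int_mat (h x) *v x" and "c = of_int_mat (h r) *v r"
    have aP: "a \<in> P3" and cP: "c \<in> P3" and HP: "of_int_mat H *v x \<in> P3"
      using iso Hi x rP by (simp_all add: a_def c_def isometry_P3)
    have "0 < orient3 a c"
    proof (cases "0 < orient3 x a")
      case True
      then have "0 < orient3 r c" using r(2) by (simp add: lab2_def a_def c_def)
      then have "0 < orient3 x c" using tr[OF x(1) rP cP xr] by blast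
      then show ?thesis
        using True tr[OF aP x(1) cP] by (simp add: T1.orient_commute)
    next
      \<comment> \<open>Both isometries exchange components, so the comparison is made with
        \<open>vcnj x\<close> and \<open>vcnj r\<close> in place of \<open>x\<close> and
        \<open>r\<close>.\<close>
      case False
      then have "\<not> 0 < orient3 r c" using r(2) by (simp add: lab2_def a_def c_def)
      moreover have "orient3 x a \<noteq> 0" "orient3 r c \<noteq> 0"
        using T1.orient_nonzero[OF two_negative_T1] x(1) rP aP cP by blast+
      ultimately have neg: "0 < orient3 (vcnj x) a" "0 < orient3 (vcnj r) c"
        using False by (auto simp: orient_vcnj_left)
      have vP: "vcnj x \<in> P3" "vcnj r \<in> P3"
        using x(1) rP by (auto simp: period_vectors_def bform_vcnj T1.bform_sym[of "vcnj _"])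
      have "0 < orient3 (vcnj x) c"
        using tr[OF vP cP _ neg(2)] xr by (simp add: orient_vcnj_vcnj)
      then show ?thesis
        using neg(1) tr[OF aP vP(1) cP] by (simp add: T1.orient_commute)
    qed
    moreover have "of_int_mat (h r) *v (of_int_mat H *v x) = a"
      by (simp add: H_def a_def matrix_vector_mul_assoc matrix_mul_assoc W flip: of_int_mat_mult)
    ultimately have "0 < orient3 (of_int_mat H *v x) r"
      using isometry_orient_T1[OF iso(2), of "of_int_mat H *v x" r] by (simp add: c_def)
    then have "0 < orient3 x (of_int_mat H *v x)"
      using tr[OF x(1) rP HP xr] by (simp add: T1.orient_commute)
    with r red H show ?thesis by blast
  qed
  then show ?thesis using that[of "V ` C2"] C2(2) by blast
qed

text \<open>The condition \<open>majorant3 x v \<le> 2600\<close> multiplied by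
  \<open>neg_norm3 x\<close>, with the strict positivity of that number weakened. All conditions are
  then closed, so the set is compact; that no boundary vector was added is shown in
  \<open>reduced_vectors_subset\<close>.\<close>

definition reduced_vectors :: "int^3^3 \<Rightarrow> (complex^3) set" where
  "reduced_vectors V = {x. norm x = 1 \<and> form x x = 0 \<and> 0 \<le> neg_norm3 x \<and>
     (\<forall>i. form (embed (V $ i)) (embed (V $ i)) * neg_norm3 x
        + 4 * (cmod (form (embed (V $ i)) x))\<^sup>2 \<le> 2600 * neg_norm3 x)}"

lemma compact_reduced_vectors: "compact (reduced_vectors V)"
proof -
  have c: "continuous_on UNIV (\<lambda>x. neg_norm3 x)"
    unfolding neg_norm_def by (intro continuous_intros continuous_on_bform continuous_on_vcnj)
  have "closed (reduced_vectors V)"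
    unfolding reduced_vectors_def
    by (intro closed_Collect_conj closed_Collect_all closed_Collect_eq closed_Collect_le
        continuous_intros continuous_on_bform c)
  moreover have "bounded (reduced_vectors V)"
    by (rule boundedI[of _ 1]) (simp add: reduced_vectors_def)
  ultimately show ?thesis by (simp add: compact_eq_bounded_closed)
qed

text \<open>If \<open>neg_norm3 x\<close> were 0, the inequalities would make \<open>x\<close>
  orthogonal to the three rows of \<open>V\<close>. These form a basis, so \<open>x\<close> would be
  0, against \<open>norm x = 1\<close>.\<close>

lemma reduced_vectors_subset:
  assumes "det V * det V = 1"
  shows "reduced_vectors V \<subseteq> P3"
proof
  fix x assume x: "x \<in> reduced_vectors V"
  have "neg_norm3 x \<noteq> 0"
  proof
    assume 0: "neg_norm3 x = 0"
    have "4 * (cmod (form (embed (V $ i)) x))\<^sup>2 \<le> 0" for i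
      using x by (simp add: reduced_vectors_def 0)
    then have z: "form (embed (V $ i)) x = 0" for i
      by simp
    obtain W where W: "V ** W = mat 1" "W ** V = mat 1"
      using unimodular_inverse[OF assms] .
    have "of_int_mat (V ** T1_gram) *v x = 0"
      using z by (simp add: vec_eq_iff bform_alt of_int_mat_mult flip: matrix_vector_mul_assoc)
         (simp add: matrix_vector_mult_def)
    then have "of_int_mat (adjugate3 T1_gram ** W ** (V ** T1_gram)) *v x = 0"
      by (simp add: of_int_mat_mult flip: matrix_vector_mul_assoc)
    also have "adjugate3 T1_gram ** W ** (V ** T1_gram) = adjugate3 T1_gram ** (W ** V) ** T1_gram"
      by (simp add: matrix_mul_assoc)
    also have "\<dots> = mat 588"
      by (simp add: W adjugate3 det_T1_gram)
    finally have "x = 0"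
      by (simp add: vec_eq_iff matrix_vector_mult_def mat_def if_distrib[of "\<lambda>c. c * _"] if_distrib[of of_int] cong: if_cong)
    then show False using x by (simp add: reduced_vectors_def)
  qed
  then show "x \<in> P3"
    using x by (simp add: reduced_vectors_def period_vectors_def neg_norm_def)
qed

lemma reduced_vectors_normalize:
  assumes x: "x \<in> P3" and V: "reduced_for x V"
  defines "y \<equiv> complex_of_real (inverse (norm x)) *s x"
  shows "y \<in> reduced_vectors V"
proof -
  have "norm x \<noteq> 0" using period_vectors_nonzero[OF x] by simp
  have y: "y \<in> P3"
    unfolding y_def using x \<open>norm x \<noteq> 0\<close> by (intro period_vectors_scale) (auto simp: vec.subspace_UNIV)
  then have c: "0 < neg_norm3 y" by (rule neg_norm_pos)
  have "y = inverse (norm x) *\<^sub>R x"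
    unfolding y_def vec_eq_iff by (simp add: scaleR_conv_of_real[where 'a = complex])
  then have "norm y = 1" using \<open>norm x \<noteq> 0\<close> by simp
  moreover have "form (embed (V $ i)) (embed (V $ i)) * neg_norm3 y
        + 4 * (cmod (form (embed (V $ i)) y))\<^sup>2 \<le> 2600 * neg_norm3 y" for i
  proof -
    have "majorant3 y (embed (V $ i)) \<le> 2600"
      unfolding y_def using V \<open>norm x \<noteq> 0\<close> by (subst majorant_scale) (auto simp: reduced_for_def)
    then have "majorant3 y (embed (V $ i)) * neg_norm3 y \<le> 2600 * neg_norm3 y"
      using c by (intro mult_right_mono) auto
    then show ?thesis
      unfolding majorant_eq using c by (simp add: distrib_right)
  qed
  ultimately show ?thesis
    using y c by (simp add: reduced_vectors_def period_vectors_def)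
qed

context fixed_lattice
begin

lemma period_domain_L:
  assumes D1: "is_period_domain Q L D1"
  obtains x0 where "x0 \<in> P3" "\<And>y. y \<in> P3 \<Longrightarrow> line (lin_comb y) \<in> D1 \<longleftrightarrow> 0 < orient3 x0 y"
    "D1 = {line (lin_comb y) | y. y \<in> P3 \<and> 0 < orient3 x0 y}"
proof -
  have sub: "D1 \<subseteq> line ` period_vectors Q (extend_scalars L)"
    using D1 connected_components_of_subset topspace_full_period_domain[of Q L]
    unfolding is_period_domain_def by fastforce
  moreover have "D1 \<noteq> {}"
    using D1 nonempty_connected_components_of unfolding is_period_domain_def by blast
  ultimately obtain x0 where x0: "x0 \<in> P3" "line (lin_comb x0) \<in> D1"
    unfolding period_vectors_L by blast
  have char: "line (lin_comb y) \<in> D1 \<longleftrightarrow> 0 < orient3 x0 y" if "y \<in> P3" for y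
    using period_domain_orient[OF neg D1, of "lin_comb x0" "lin_comb y"] x0 that
    by (simp add: period_vectors_L orient_lin_comb)
  have "D1 = {line (lin_comb y) | y. y \<in> P3 \<and> 0 < orient3 x0 y}"
    using sub char unfolding period_vectors_L by blast
  with x0 char show ?thesis using that by blast
qed

lemma continuous_on_lin_comb: "continuous_on S (lin_comb :: complex^3 \<Rightarrow> complex^'n)"
  unfolding lin_comb_def by (intro continuous_intros continuous_on_scale)

lemma continuous_map_line_lin_comb:
  "continuous_map (top_of_set P3) (full_period_domain Q L) (\<lambda>y. line (lin_comb y))"
proof -
  have "continuous_map (top_of_set P3) (top_of_set (period_vectors Q (extend_scalars L))) lin_comb"
    by (simp add: continuous_on_lin_comb period_vectors_L)
  from continuous_map_compose[OF this continuous_map_line] show ?thesis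
    by (simp add: comp_def)
qed

text \<open>Right multiplication by \<open>H\<close> and by its inverse preserves
  \<open>matrices\<close>, so the same matrices sweep out both orbits.\<close>

lemma orbit_congruence:
  assumes x: "x \<in> P3" and H: "congruence_isometry H" "0 < orient3 x (of_int_mat H *v x)"
  shows "orbit (Gamma_fixed Q D G) (line_action L) (line (lin_comb (of_int_mat H *v x)))
       = orbit (Gamma_fixed Q D G) (line_action L) (line (lin_comb x))"
proof -
  obtain W where W: "H ** W = mat 1" "W ** H = mat 1" "congruence_isometry W"
    using congruence_isometry_inverse[OF H(1)] .
  have Wx: "of_int_mat W *v (of_int_mat H *v x) = x"
    by (simp add: matrix_vector_mul_assoc W flip: of_int_mat_mult)
  have HP: "of_int_mat H *v x \<in> P3"
    using x H by (simp add: isometry_P3 congruence_isometry_def)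
  have "M ** H \<in> matrices" "M ** W \<in> matrices" if "M \<in> matrices" for M
    using matrices_mult_congruence[OF that H(1) x H(2)]
      matrices_mult_congruence[OF that W(3) HP] H(2) by (simp_all add: Wx T1.orient_commute)
  moreover have "of_int_mat M *v (of_int_mat H *v x) = of_int_mat (M ** H) *v x"
    "of_int_mat M *v x = of_int_mat (M ** W) *v (of_int_mat H *v x)" for M
    by (simp_all add: matrix_vector_mul_assoc of_int_mat_mult)
       (simp add: matrix_mul_assoc[symmetric] W flip: of_int_mat_mult)
  ultimately show ?thesis
    unfolding orbit_lin_comb by (smt (verit) Collect_cong)
qed

theorem compact_quotient_curve:
  assumes D1: "is_period_domain Q L D1"
  shows "compact_space (quotient_curve Q L (Gamma_fixed Q D G) D1)"
proof -
  let ?orb = "orbit (Gamma_fixed Q D G) (line_action L)"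
  let ?\<phi> = "\<lambda>y. line (lin_comb y)"
  obtain x0 where x0: "x0 \<in> P3" "\<And>y. y \<in> P3 \<Longrightarrow> ?\<phi> y \<in> D1 \<longleftrightarrow> 0 < orient3 x0 y"
      "D1 = {?\<phi> y | y. y \<in> P3 \<and> 0 < orient3 x0 y}"
    using period_domain_L[OF D1] by blast
  obtain \<V> where \<V>: "finite \<V>" "\<And>x. x \<in> P3 \<Longrightarrow> 0 < orient3 x0 x \<Longrightarrow>
     \<exists>V\<in>\<V>. \<exists>H. congruence_isometry H \<and> 0 < orient3 x (of_int_mat H *v x) \<and> reduced_for (of_int_mat H *v x) V"
    using finite_reduced_bases[OF x0(1)] by metis
  define K where "K = (\<Union>V\<in>{V\<in>\<V>. det V * det V = 1}. reduced_vectors V)"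
  have K: "compact K" "K \<subseteq> P3"
    unfolding K_def using \<V>(1) compact_reduced_vectors reduced_vectors_subset by (auto intro!: compact_UN)
  have "compactin (full_period_domain Q L) (?\<phi> ` K)"
    by (rule image_compactin[OF _ continuous_map_line_lin_comb]) (use K in \<open>simp add: compactin_subtopology\<close>)
  \<comment> \<open>\<open>K\<close> may contain vectors over both components. A connected component
    is closed, so cutting the image down to \<open>D1\<close> keeps it compact.\<close>
  moreover have "closedin (full_period_domain Q L) D1"
    using D1 unfolding is_period_domain_def by (rule closedin_connected_components_of)
  ultimately have "compactin (full_period_domain Q L) (D1 \<inter> ?\<phi> ` K)"
    by (intro closed_Int_compactin)
  then have "compactin (period_domain_topology Q L D1) (D1 \<inter> ?\<phi> ` K)"
    by (simp add: period_domain_topology_def compactin_subtopology)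
  then have "compactin (quotient_curve Q L (Gamma_fixed Q D G) D1) (?orb ` (D1 \<inter> ?\<phi> ` K))"
    unfolding quotient_curve_def by (rule image_compactin[OF _ continuous_map_quotient_topology])
  moreover have "?orb ` (D1 \<inter> ?\<phi> ` K) = topspace (quotient_curve Q L (Gamma_fixed Q D G) D1)"
  proof -
    have "D1 \<subseteq> topspace (full_period_domain Q L)"
      using D1 unfolding is_period_domain_def by (rule connected_components_of_subset)
    then have top: "topspace (quotient_curve Q L (Gamma_fixed Q D G) D1) = ?orb ` D1"
      by (simp add: quotient_curve_def period_domain_topology_def Int_absorb1)
    have "?orb l \<in> ?orb ` (D1 \<inter> ?\<phi> ` K)" if l: "l \<in> D1" for l
    proof -
      obtain x where x: "l = ?\<phi> x" "x \<in> P3" "0 < orient3 x0 x"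
        using l x0(3) by blast
      obtain V H where VH: "V \<in> \<V>" "congruence_isometry H" "0 < orient3 x (of_int_mat H *v x)"
          "reduced_for (of_int_mat H *v x) V"
        using \<V>(2)[OF x(2,3)] by blast
      define y where "y = of_int_mat H *v x"
      have y: "y \<in> P3" using x VH by (simp add: y_def isometry_P3 congruence_isometry_def)
      define z where "z = complex_of_real (inverse (norm y)) *s y"
      have "0 < orient3 x0 y"
        using T1.orient_trans[OF two_negative_T1 x0(1) x(2) y x(3)] VH(3) by (simp add: y_def)
      then have "?\<phi> y \<in> D1" using x0(2)[OF y] by simp
      moreover have "?\<phi> z = ?\<phi> y"
        unfolding z_def lin_comb_scale using period_vectors_nonzero[OF y] by (intro line_scale) simp
      moreover have "z \<in> K"
      proof -
        have red: "reduced_for y V" using VH(4) by (simp only: y_def)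
        have "z \<in> reduced_vectors V"
          unfolding z_def by (rule reduced_vectors_normalize[OF y red])
        moreover have "det V * det V = 1" using red by (simp only: reduced_for_def)
        ultimately show ?thesis unfolding K_def using VH(1) by blast
      qed
      ultimately have "?\<phi> y \<in> D1 \<inter> ?\<phi> ` K"
        by (intro IntI image_eqI[of _ _ z]) simp_all
      moreover have "?orb (?\<phi> y) = ?orb l"
        unfolding x(1) y_def by (rule orbit_congruence[OF x(2) VH(2,3)])
      ultimately show ?thesis
        by (intro image_eqI[of _ _ "?\<phi> y"]) simp_all
    qed
    then show ?thesis unfolding top by blast
  qed
  ultimately show ?thesis by (simp add: compact_space_def)
qed

end

section \<open>Isometries with small displacement\<close>

lemma T1_products:
  assumes y: "y \<in> P3"
  shows "form y y = 0" "form (vcnj y) (vcnj y) = 0"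
    "form y (vcnj y) = - of_real (neg_norm3 y)"
    "form (vcnj y) y = - of_real (neg_norm3 y)"
  using y T1.hermitian_real[of y]
  by (auto simp: period_vectors_def neg_norm_def bform_vcnj T1.bform_sym[of "vcnj y" y])

text \<open>Both sides of the identity are Gram determinants of \<open>y, vcnj y, x\<close>, once paired with
  themselves and once with \<open>y, vcnj y, vcnj x\<close>.\<close>

lemma neg_norm_mult:
  assumes x: "x \<in> P3" and y: "y \<in> P3"
  shows "neg_norm3 x * neg_norm3 y
    = (cmod (form x (vcnj y)) - cmod (form x y))\<^sup>2"
proof -
  define c c' where "c = neg_norm3 y" and "c' = neg_norm3 x"
  define p r where "p = form x y" and "r = form x (vcnj y)"
  have c: "c > 0" using neg_norm_pos[OF y] by (simp add: c_def)
  define X X' :: "complex^3^3" where "X = vector [y, vcnj y, x]" and "X' = vector [y, vcnj y, vcnj x]"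
  note prods = T1_products[OF y, folded c_def] T1_products[OF x, folded c'_def]
  have sym: "form y x = p" "form (vcnj y) x = r" "form y (vcnj x) = cnj r"
      "form (vcnj y) (vcnj x) = cnj p"
    by (simp_all add: p_def r_def T1.bform_sym[of y x] T1.bform_sym[of "vcnj y" x] bform_vcnj
        T1.bform_sym[of y "vcnj x"] bform_vcnj_left[of _ x])
  have rows: "X $ 1 = y" "X $ 2 = vcnj y" "X $ 3 = x" "X' $ 1 = y" "X' $ 2 = vcnj y" "X' $ 3 = vcnj x"
    by (simp_all add: X_def X'_def vector_3)
  have "det (\<chi> i j. form (X $ i) (X $ j)) = - 2 * of_real c * p * r"
    unfolding det_3 vec_lambda_beta rows sym prods p_def[symmetric] r_def[symmetric] by simp
  then have 1: "588 * det X * det X = - 2 * of_real c * p * r"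
    by (simp add: det_gram_T1)
  have "det (\<chi> i j. form (X $ i) (X' $ j)) = of_real c * (of_real (c * c') - (p * cnj p) - (r * cnj r))"
    unfolding det_3 vec_lambda_beta rows sym prods p_def[symmetric] r_def[symmetric] by (simp add: algebra_simps)
  then have 2: "588 * det X * det X' = of_real c * (of_real (c * c') - (p * cnj p) - (r * cnj r))"
    by (simp add: det_gram_T1)
  \<comment> \<open>Conjugating the rows of \<open>X\<close> gives those of \<open>X'\<close> with
    the first two exchanged.\<close>
  have "det X' = - cnj (det X)"
    unfolding det_3 rows by (simp add: algebra_simps)
  then have "588 * (cmod (det X))\<^sup>2 = c * ((cmod p)\<^sup>2 + (cmod r)\<^sup>2 - c * c')"
  proof -
    have "complex_of_real (588 * (cmod (det X))\<^sup>2) = - (588 * det X * (- cnj (det X)))"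
      by (simp only: of_real_mult complex_norm_square) simp
    also have "\<dots> = - (588 * det X * det X')"
      by (simp only: \<open>det X' = - cnj (det X)\<close>)
    also have "\<dots> = of_real c * ((p * cnj p) + (r * cnj r) - of_real (c * c'))"
      unfolding 2 by (simp add: algebra_simps)
    also have "\<dots> = complex_of_real (c * ((cmod p)\<^sup>2 + (cmod r)\<^sup>2 - c * c'))"
      by (simp only: of_real_mult of_real_add of_real_diff complex_norm_square)
    finally show ?thesis by (simp only: of_real_eq_iff)
  qed
  moreover have "588 * (cmod (det X))\<^sup>2 = 2 * c * cmod p * cmod r"
  proof -
    have "588 * (cmod (det X))\<^sup>2 = cmod (588 * det X * det X)"
      by (simp add: norm_mult power2_eq_square)
    also have "\<dots> = 2 * c * cmod p * cmod r"
      unfolding 1 using c by (simp add: norm_mult)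
    finally show ?thesis .
  qed
  moreover have "2 * c * cmod p * cmod r = c * (2 * cmod p * cmod r)"
    by simp
  ultimately have "c * ((cmod p)\<^sup>2 + (cmod r)\<^sup>2 - c * c') = c * (2 * cmod p * cmod r)"
    by (simp only:)
  then have "(cmod p)\<^sup>2 + (cmod r)\<^sup>2 - c * c' = 2 * cmod p * cmod r"
    using c by simp
  then show ?thesis
    unfolding c_def[symmetric] c'_def[symmetric] p_def[symmetric] r_def[symmetric]
    by (simp add: power2_eq_square algebra_simps)
qed

lemma cramer_3:
  fixes u v w z :: "complex^3"
  shows "det (vector [u, v, w] :: complex^3^3) *s z = det (vector [z, v, w] :: complex^3^3) *s u
    + det (vector [u, z, w] :: complex^3^3) *s v + det (vector [u, v, z] :: complex^3^3) *s w"
  by (simp add: vec_eq_iff forall_3 det_3 vector_3 algebra_simps)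

text \<open>Subtracting from \<open>x\<close> its component along \<open>y\<close> leaves an
  isotropic \<open>w\<close> orthogonal to \<open>y\<close> and \<open>vcnj y\<close>. The
  complement of that plane is an anisotropic line, so \<open>w\<close> vanishes; the argument runs
  through determinants and Cramer's rule. This turns vanishing displacement into a fixed
  point.\<close>

lemma orthogonal_imp_parallel:
  assumes x: "x \<in> P3" and y: "y \<in> P3" and orth: "form x y = 0"
  obtains \<alpha> where "\<alpha> \<noteq> 0" "x = \<alpha> *s y"
proof -
  define c where "c = neg_norm3 y"
  have c: "c > 0" using neg_norm_pos[OF y] by (simp add: c_def)
  note prods = T1_products[OF y, folded c_def]
  define \<alpha> where "\<alpha> = - form x (vcnj y) / of_real c"
  define w where "w = x - \<alpha> *s y"
  have w: "form w y = 0" "form w (vcnj y) = 0"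
    using c by (simp_all add: w_def bform_linear orth prods \<alpha>_def)
  have ww: "form w w = 0"
  proof -
    have "form w w = form x x"
      by (simp add: w_def bform_linear orth prods T1.bform_sym[of y x])
    then show ?thesis using x by (simp add: period_vectors_def)
  qed
  have w': "form y w = 0" "form (vcnj y) w = 0"
    using w by (simp_all add: T1.bform_sym)
  define dt where "dt = (\<lambda>u v w. det (vector [u, v, w] :: complex^3^3))"
  have gram: "588 * dt u v z * dt u v z = det (\<chi> i j. form ((vector [u, v, z] :: complex^3^3) $ i) ((vector [u, v, z] :: complex^3^3) $ j))" for u v z
    by (simp only: det_gram_T1 dt_def)
  have "588 * dt y (vcnj y) w * dt y (vcnj y) w = 0"
    unfolding gram det_3 vec_lambda_beta vector_3 w w' prods ww by simp
  then have dw: "dt y (vcnj y) w = 0" by simp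
  have cr: "0 = dt z (vcnj y) w *s y + dt y z w *s vcnj y + dt y (vcnj y) z *s w" for z
    using cramer_3[of y "vcnj y" w z] dw by (simp add: dt_def)
  have "dt z (vcnj y) w = 0" for z
  proof -
    have "0 = form (dt z (vcnj y) w *s y + dt y z w *s vcnj y + dt y (vcnj y) z *s w) (vcnj y)"
      using cr[of z] by (metis bform_zero_left)
    then show ?thesis using c by (simp add: bform_linear prods w)
  qed
  moreover have "dt y z w = 0" for z
  proof -
    have "0 = form (dt z (vcnj y) w *s y + dt y z w *s vcnj y + dt y (vcnj y) z *s w) y"
      using cr[of z] by (metis bform_zero_left)
    then show ?thesis using c by (simp add: bform_linear prods w)
  qed
  ultimately have 0: "dt y (vcnj y) z *s w = 0" for z
    using cr[of z] by simp
  \<comment> \<open>The second basis vector has positive norm 10, so it does not lie in the negative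
    plane and the Gram determinant of \<open>y\<close>, \<open>vcnj y\<close>, \<open>e\<close> is
    nonzero.\<close>
  define e :: "complex^3" where "e = axis 2 1"
  have "588 * dt y (vcnj y) e * dt y (vcnj y) e = - of_real (2 * c * (cmod (form y e))\<^sup>2 + 10 * c\<^sup>2)"
  proof -
    have e: "form e e = 10" "form (vcnj y) e = cnj (form y e)"
      "form e y = form y e" "form e (vcnj y) = cnj (form y e)"
    proof -
      have "vcnj e = e" by (simp add: e_def vec_eq_iff axis_def)
      then show *: "form (vcnj y) e = cnj (form y e)"
        by (metis bform_vcnj)
      show "form e e = 10" by (simp add: e_def bform_axis)
      show "form e y = form y e" by (rule T1.bform_sym)
      show "form e (vcnj y) = cnj (form y e)" using * by (simp add: T1.bform_sym)
    qed
    show ?thesis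
      unfolding gram det_3 vec_lambda_beta vector_3 prods e of_real_minus of_real_add of_real_mult complex_norm_square
      by (simp add: power2_eq_square algebra_simps)
  qed
  moreover have "2 * c * (cmod (form y e))\<^sup>2 + 10 * c\<^sup>2 > 0"
    using c by (intro add_nonneg_pos) auto
  ultimately have "dt y (vcnj y) e \<noteq> 0"
    by (metis mult_zero_right neg_equal_0_iff_equal of_real_eq_0_iff order_less_irrefl)
  with 0[of e] have "w = 0" by simp
  then have "x = \<alpha> *s y" by (simp add: w_def)
  moreover have "\<alpha> \<noteq> 0"
    using calculation period_vectors_nonzero[OF x] by auto
  ultimately show ?thesis using that by blast
qed

text \<open>The real and imaginary part of \<open>x\<close> have bounded majorant at the nearby point \<open>y\<close>.\<close>

lemma majorant_comparison:
  assumes x: "x \<in> P3" and y: "y \<in> P3" and eq: "neg_norm3 x = neg_norm3 y"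
    and close: "cmod (form x y) \<le> 1/2 * cmod (form x (vcnj y))"
    and v: "majorant3 y v \<le> 2600"
  shows "majorant3 x v \<le> 2600 + 8 * 1305\<^sup>2"
proof -
  define c where "c = neg_norm3 y"
  have c: "c > 0" using neg_norm_pos[OF y] by (simp add: c_def)
  define p r where "p = cmod (form x y)" and "r = cmod (form x (vcnj y))"
  have pr: "0 \<le> p" "p \<le> r / 2" using close by (simp_all add: p_def r_def)
  \<comment> \<open>With equal negative norms \<open>neg_norm_mult\<close> gives
    \<open>r - p = c\<close>; together with \<open>p \<le> r / 2\<close> this yields
    \<open>p \<le> c\<close> and \<open>r \<le> 2 * c\<close>, hence the bound \<open>9 * c\<close>
    for the two majorants.\<close>
  have "c\<^sup>2 = (r - p)\<^sup>2"
    using neg_norm_mult[OF x y] eq by (simp add: c_def p_def r_def power2_eq_square)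
  moreover have "0 \<le> r - p" using pr by linarith
  ultimately have "c = r - p" using c by (metis power2_eq_imp_eq less_imp_le)
  then have rp: "r \<le> 2 * c" "p \<le> c" using pr by linarith+
  let ?a = "Re_vec x" and ?b = "Im_vec x"
  have xexp: "x = of_real_vec ?a + \<i> *s of_real_vec ?b" "vcnj x = of_real_vec ?a - \<i> *s of_real_vec ?b"
    by (rule Re_Im_vec, rule vcnj_Re_Im_vec)
  define A B where "A = form (of_real_vec ?a) y" and "B = form (of_real_vec ?b) y"
  have "form x y = A + \<i> * B"
    by (subst xexp(1)) (simp add: bform_linear A_def B_def)
  moreover have "form (vcnj x) y = A - \<i> * B"
    by (subst xexp(2)) (simp add: bform_linear A_def B_def)
  moreover have "cmod (form (vcnj x) y) = r"
    by (simp add: r_def bform_vcnj_left)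
  ultimately have "p\<^sup>2 + r\<^sup>2 = (cmod (A + \<i> * B))\<^sup>2 + (cmod (A - \<i> * B))\<^sup>2"
    by (simp add: p_def)
  also have "\<dots> = 2 * ((cmod A)\<^sup>2 + (cmod B)\<^sup>2)"
    unfolding cmod_power2 by (simp add: power2_eq_square algebra_simps)
  finally have AB: "(cmod A)\<^sup>2 + (cmod B)\<^sup>2 = (p\<^sup>2 + r\<^sup>2) / 2" by simp
  have "form ?a ?a + form ?b ?b = - c"
    using bform_Re_Im_vcnj[of T1_gram x x] eq by (simp add: neg_norm_def c_def)
  then have "majorant3 y ?a + majorant3 y ?b = - c + 4 * ((cmod A)\<^sup>2 + (cmod B)\<^sup>2) / c"
    by (simp add: majorant_eq A_def B_def c_def add_divide_distrib distrib_left)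
  also have "\<dots> = - c + 2 * (p\<^sup>2 + r\<^sup>2) / c" using c by (simp add: AB field_simps)
  also have "\<dots> \<le> - c + 2 * (c\<^sup>2 + (2 * c)\<^sup>2) / c"
    using rp pr c by (intro add_left_mono divide_right_mono mult_left_mono add_mono power_mono) auto
  also have "\<dots> = 9 * c" using c by (simp add: power2_eq_square)
  finally have ab: "majorant3 y ?a + majorant3 y ?b \<le> 9 * c" .
  have nonneg: "0 \<le> majorant3 y u" for u
    using T1.abs_le_majorant[OF two_negative_T1 y, of u] by linarith
  have key: "(form v u)\<^sup>2 \<le> c * 1305\<^sup>2" if u: "majorant3 y u \<le> 9 * c" for u
  proof -
    \<comment> \<open>Scaling by \<open>sqrt c\<close> makes the majorant of \<open>u'\<close> at
      most 9, so the pairing is at most \<open>(2600 + 9) / 2\<close>, rounded up to 1305.\<close>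
    define s where "s = sqrt c"
    have s: "s > 0" "s * s = c" using c by (simp_all add: s_def)
    define u' where "u' = (1 / s) *s u"
    have "majorant3 y u' = majorant3 y u / c"
      using s by (simp add: u'_def majorant_form_linear flip: s(2))
    also have "\<dots> \<le> 9" using u c by (simp add: divide_le_eq)
    finally have "(majorant3 y v + majorant3 y u') / 2 \<le> 1305"
      using v by simp
    with T1.abs_bform_le_majorant[OF two_negative_T1 y] have "\<bar>form v u'\<bar> \<le> 1305"
      by (rule order_trans)
    then have "(form v u')\<^sup>2 \<le> 1305\<^sup>2"
      using power_mono[of "\<bar>form v u'\<bar>" 1305 2] by simp
    moreover have "form v u = s * form v u'"
      using s by (simp add: u'_def bform_linear)
    then have "(form v u)\<^sup>2 = c * (form v u')\<^sup>2"
      using s by (simp add: power_mult_distrib power2_eq_square)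
    ultimately show ?thesis using c by simp
  qed
  have "(cmod (form (of_real_vec v) x))\<^sup>2 = (form v ?a)\<^sup>2 + (form v ?b)\<^sup>2"
    by (subst xexp(1)) (simp add: bform_linear bform_of_real_vec cmod_power2)
  also have "\<dots> \<le> 2 * c * 1305\<^sup>2"
    using key[of ?a] key[of ?b] ab nonneg[of ?a] nonneg[of ?b] by linarith
  finally have "4 * (cmod (form (of_real_vec v) x))\<^sup>2 / c \<le> 8 * 1305\<^sup>2"
    using c by (simp add: divide_le_eq)
  moreover have "form v v \<le> 2600"
    using T1.abs_le_majorant[OF two_negative_T1 y, of v] v by linarith
  ultimately show ?thesis
    unfolding majorant_eq using eq by (simp add: c_def)
qed

text \<open>The ratio of the moduli of \<open>(M x, x)\<close> and \<open>(M x, vcnj x)\<close> is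
  the square of the pseudo-hyperbolic distance from the point of \<open>x\<close> to its image.
  While it is small, the pairings of a reduced basis with its image under \<open>M\<close> are
  bounded integers, so finitely many labels occur. Points with one label are moved into one compact
  set by isometries commuting with \<open>M\<close>; there the infimum 0 of the displacement is
  attained.\<close>

lemma small_displacement_fixed_point:
  fixes x :: "nat \<Rightarrow> complex^3" and \<rho> :: "nat \<Rightarrow> real"
  assumes M: "T1_isometry M" and x: "\<And>j. x j \<in> P3" and \<rho>: "\<rho> \<longlonglongrightarrow> 0"
    and small: "\<And>j. cmod (form (of_int_mat M *v x j) (x j))
        \<le> \<rho> j * cmod (form (of_int_mat M *v x j) (vcnj (x j)))"
  obtains z \<alpha> where "z \<in> P3" "\<alpha> \<noteq> 0" "of_int_mat M *v z = \<alpha> *s z"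
proof -
  have "\<exists>V. reduced_for (x j) V" for j
    using exists_reduced_basis[OF x[of j]] unfolding reduced_for_def by metis
  then obtain V where V: "\<And>j. reduced_for (x j) (V j)" by metis
  have Vdet: "det (V j) * det (V j) = 1" for j using V by (simp add: reduced_for_def)
  obtain J where J: "\<And>j. j \<ge> J \<Longrightarrow> \<rho> j < 1/2"
    using order_tendstoD(2)[OF \<rho>, of "1/2"] by (auto simp: eventually_sequentially)
  define N :: int where "N = 2600 + 8 * 1305\<^sup>2"
  \<comment> \<open>The first entry makes two bases isometric; the second adds that the isometry
    between them commutes with \<open>M\<close>.\<close>
  define lab where "lab = (\<lambda>j. (V j ** T1_gram ** transpose (V j), V j ** T1_gram ** M ** transpose (V j)))"
  have "finite (lab ` {J..})"
  proof (rule finite_subset)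
    show "lab ` {J..} \<subseteq> {A. \<forall>i k. A $ i $ k \<in> {-2600..2600}} \<times> {A. \<forall>i k. A $ i $ k \<in> {-N..N}}"
    proof (intro image_subsetI)
      fix j assume "j \<in> {J..}"
      then have rj: "\<rho> j \<le> 1/2" using J[of j] by simp
      have "\<bar>(V j ** T1_gram ** transpose (V j)) $ i $ k\<bar> \<le> 2600" for i k
        by (rule reduced_for_gram_bound[OF x V])
      moreover have "\<bar>(V j ** T1_gram ** M ** transpose (V j)) $ i $ k\<bar> \<le> N" for i k
      proof -
        define y where "y = of_int_mat M *v x j"
        have yP: "y \<in> P3" using x M by (simp add: y_def isometry_P3)
        define v where "v = M *v (V j $ k)"
        have e: "(V j ** T1_gram ** M ** transpose (V j)) $ i $ k = form (V j $ i) v"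
        proof -
          have "(V j ** T1_gram ** M ** transpose (V j)) $ i $ k
              = (\<Sum>l\<in>UNIV. V j $ i $ l * (T1_gram ** (M ** transpose (V j))) $ l $ k)"
            by (simp add: matrix_mul_assoc[symmetric]) (simp add: matrix_matrix_mult_def)
          also have "\<dots> = form (V j $ i) v"
            by (simp add: bform_alt matrix_matrix_mult_def matrix_vector_mult_def transpose_def v_def)
          finally show ?thesis .
        qed
        \<comment> \<open>At the moved point \<open>y\<close> the image \<open>v\<close> has the
          same majorant as the original basis vector at \<open>x j\<close>; the comparison of nearby
          points brings the bound back to \<open>x j\<close>.\<close>
        have "majorant3 y (embed v) = majorant3 (x j) (embed (V j $ k))"
          using M unfolding y_def v_def embed_mult by (simp add: majorant_isometry T1_isometry_def)
        also have "\<dots> \<le> 2600" using V by (simp add: reduced_for_def)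
        finally have m: "majorant3 y (embed v) \<le> 2600" .
        have "majorant3 (x j) (embed v) \<le> 2600 + 8 * 1305\<^sup>2"
        proof (rule majorant_comparison[OF x yP _ _ m])
          show "neg_norm3 (x j) = neg_norm3 y"
            using M by (simp add: neg_norm_def y_def vcnj_mult bform_isometry T1_isometry_def)
          have "cmod (form y (x j)) \<le> \<rho> j * cmod (form y (vcnj (x j)))"
            using small by (simp add: y_def)
          also have "\<dots> \<le> 1/2 * cmod (form y (vcnj (x j)))"
            using rj by (intro mult_right_mono) auto
          also have "form y (vcnj (x j)) = cnj (form (x j) (vcnj y))"
            by (simp add: T1.bform_sym[of y] bform_vcnj_left)
          finally show "cmod (form (x j) y) \<le> 1/2 * cmod (form (x j) (vcnj y))"
            by (simp add: T1.bform_sym[of y])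
        qed
        moreover have "majorant3 (x j) (embed (V j $ i)) \<le> 2600"
          using V by (simp add: reduced_for_def)
        ultimately have "(majorant3 (x j) (embed (V j $ i)) + majorant3 (x j) (embed v)) / 2 \<le> of_int N"
          unfolding N_def by simp
        with T1.abs_bform_le_majorant[OF two_negative_T1 x]
        have "\<bar>form (embed (V j $ i)) (embed v) :: real\<bar> \<le> of_int N"
          by (rule order_trans)
        then show ?thesis unfolding e bform_embed by linarith
      qed
      ultimately show "lab j \<in> {A. \<forall>i k. A $ i $ k \<in> {-2600..2600}} \<times> {A. \<forall>i k. A $ i $ k \<in> {-N..N}}"
        by (simp add: lab_def abs_le_iff minus_le_iff)
    qed
  qed (intro finite_cartesian_product finite_matrices; simp)
  then obtain j0 where j0: "infinite {j \<in> {J..}. lab j = lab j0}"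
    using pigeonhole_infinite[of "{J..}" lab] infinite_Ici[of J] by auto
  define K where "K = reduced_vectors (V j0)"
  have KP: "K \<subseteq> P3" unfolding K_def by (rule reduced_vectors_subset[OF Vdet])
  have K: "compact K" unfolding K_def by (rule compact_reduced_vectors)
  define f g where "f = (\<lambda>z. cmod (form (of_int_mat M *v z) z))"
    and "g = (\<lambda>z. cmod (form (of_int_mat M *v z) (vcnj z)))"
  have mult: "continuous_on S (\<lambda>z :: complex^3. of_int_mat M *v z)" for S
    unfolding matrix_vector_mult_def by (intro continuous_intros)
  have cont: "continuous_on K f" "continuous_on K g"
    unfolding f_def g_def by (intro continuous_intros continuous_on_bform continuous_on_vcnj mult)+
  have close: "\<exists>z\<in>K. f z \<le> \<rho> j * g z" if j: "lab j = lab j0" for j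
  proof -
    have "V j ** T1_gram ** transpose (V j) = V j0 ** T1_gram ** transpose (V j0)"
      using j by (simp add: lab_def)
    then obtain H where H: "T1_isometry H" "V j0 = V j ** transpose H"
      using isometry_from_gram[OF Vdet[of j] Vdet[of j0]] by metis
    obtain W where W: "V j ** W = mat 1" "W ** V j = mat 1"
      using unimodular_inverse[OF Vdet] .
    obtain H' where H': "H ** H' = mat 1" "H' ** H = mat 1" "T1_isometry H'"
      using T1_isometry_inverse[OF H(1)] .
    have "V j ** (T1_gram ** M) ** transpose (V j) = V j ** (transpose H ** T1_gram ** M ** H) ** transpose (V j)"
      using j unfolding lab_def prod.inject H(2) by (simp add: matrix_transpose_mul matrix_mul_assoc)
    then have "(W ** V j) ** (T1_gram ** M) ** transpose (W ** V j)
        = (W ** V j) ** (transpose H ** T1_gram ** M ** H) ** transpose (W ** V j)"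
      by (simp only: matrix_transpose_mul matrix_mul_assoc) (simp only: matrix_mul_assoc[symmetric])
    then have "T1_gram ** M = transpose H ** T1_gram ** M ** H"
      by (simp add: W)
    also have "transpose H ** T1_gram = transpose H ** T1_gram ** (H ** H')"
      by (simp add: H')
    also have "\<dots> = T1_gram ** H'"
      using H(1) by (simp add: T1_isometry_def matrix_mul_assoc)
    finally have "T1_gram ** M = T1_gram ** (H' ** M ** H)"
      by (simp add: matrix_mul_assoc)
    then have "M = H' ** M ** H" by (rule T1_gram_cancel)
    then have "H ** M = (H ** H') ** M ** H"
      by (metis matrix_mul_assoc)
    then have comm: "H ** M = M ** H" by (simp add: H')
    \<comment> \<open>Because \<open>H\<close> commutes with \<open>M\<close>, moving
      \<open>x j\<close> by \<open>H\<close> into the compact set leaves its displacement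
      unchanged.\<close>
    define y where "y = of_int_mat H *v x j"
    have yP: "y \<in> P3" using x H by (simp add: y_def isometry_P3)
    have red: "reduced_for y (V j0)"
      unfolding y_def by (rule reduced_for_isometry[OF H(1) V Vdet H(2)])
    define z where "z = complex_of_real (inverse (norm y)) *s y"
    have "z \<in> K" unfolding K_def z_def by (rule reduced_vectors_normalize[OF yP red])
    have My: "of_int_mat M *v y = of_int_mat H *v (of_int_mat M *v x j)"
      by (simp add: y_def matrix_vector_mul_assoc comm flip: of_int_mat_mult)
    have "f y = cmod (form (of_int_mat M *v x j) (x j))" "g y = cmod (form (of_int_mat M *v x j) (vcnj (x j)))"
      using H(1) unfolding f_def g_def My unfolding y_def vcnj_mult
      by (simp_all add: bform_isometry T1_isometry_def)
    then have "f y \<le> \<rho> j * g y" using small by simp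
    moreover have "f z = (cmod (inverse (norm y)))\<^sup>2 * f y" "g z = (cmod (inverse (norm y)))\<^sup>2 * g y"
      unfolding f_def g_def z_def of_int_mat_scale vcnj_scale bform_linear
      by (simp_all add: norm_mult norm_inverse power2_eq_square)
    ultimately have "f z \<le> \<rho> j * g z"
      using mult_left_mono[of "f y" "\<rho> j * g y" "(cmod (inverse (norm y)))\<^sup>2"]
      by (simp add: mult.left_commute)
    with \<open>z \<in> K\<close> show ?thesis by blast
  qed
  have "K \<noteq> {}" using close[of j0] by blast
  obtain z where z: "z \<in> K" "\<And>u. u \<in> K \<Longrightarrow> f z \<le> f u"
    using continuous_attains_inf[OF K \<open>K \<noteq> {}\<close> cont(1)] by blast
  obtain B where B: "B \<in> K" "\<And>u. u \<in> K \<Longrightarrow> g u \<le> g B"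
    using continuous_attains_sup[OF K \<open>K \<noteq> {}\<close> cont(2)] by blast
  \<comment> \<open>A positive minimum of \<open>f\<close> on \<open>K\<close> would contradict the
    infinitely many \<open>j\<close> with the chosen label, since \<open>g\<close> is bounded on
    \<open>K\<close> and \<open>\<rho>\<close> tends to 0.\<close>
  have "f z \<le> 0"
  proof (rule ccontr)
    assume "\<not> f z \<le> 0"
    then have fz: "0 < f z" by simp
    have "(\<lambda>j. \<bar>\<rho> j\<bar> * g B) \<longlonglongrightarrow> \<bar>0\<bar> * g B"
      by (intro tendsto_intros \<rho>)
    then have "\<forall>\<^sub>F j in sequentially. \<bar>\<rho> j\<bar> * g B < f z"
      using fz by (intro order_tendstoD) auto
    then obtain n where n: "\<And>j. j \<ge> n \<Longrightarrow> \<bar>\<rho> j\<bar> * g B < f z"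
      by (auto simp: eventually_sequentially)
    obtain j where j: "j \<ge> n" "lab j = lab j0"
      using j0 unfolding infinite_nat_iff_unbounded_le by blast
    obtain u where u: "u \<in> K" "f u \<le> \<rho> j * g u" using close[OF j(2)] by blast
    have "f z \<le> \<rho> j * g u" using z(2)[OF u(1)] u(2) by simp
    also have "\<dots> \<le> \<bar>\<rho> j\<bar> * g B"
      using B(2)[OF u(1)] by (intro mult_mono) (auto simp: g_def)
    finally show False using n[OF j(1)] by simp
  qed
  then have "form (of_int_mat M *v z) z = 0"
    by (simp add: f_def)
  moreover have "z \<in> P3" using z KP by auto
  moreover have "of_int_mat M *v z \<in> P3" using \<open>z \<in> P3\<close> M by (simp add: isometry_P3)
  ultimately show ?thesis
    using orthogonal_imp_parallel that by metis
qed

section \<open>The Schwarz lemma on the upper half plane\<close>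

abbreviation UHP :: "complex set" where
  "UHP \<equiv> upper_half_plane"

text \<open>The Schwarz lemma of the disc, transported by the Cayley transform that sends
  \<open>z0\<close> to the centre.\<close>

lemma Schwarz_upper_half_plane:
  assumes u: "u holomorphic_on UHP" "\<And>z. z \<in> UHP \<Longrightarrow> cmod (u z) < 1"
    and z0: "z0 \<in> UHP" "u z0 = 0" and z: "z \<in> UHP"
  shows "cmod (u z) \<le> cmod (z - z0) / cmod (z - cnj z0)"
proof -
  \<comment> \<open>The inverse of the Cayley transform
    \<open>z \<mapsto> (z - z0) / (z - cnj z0)\<close>.\<close>
  define C where "C = (\<lambda>\<zeta>. (z0 - cnj z0 * \<zeta>) / (1 - \<zeta>))"
  have CH: "C \<zeta> \<in> UHP" if \<zeta>: "cmod \<zeta> < 1" for \<zeta>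
  proof -
    have n1: "1 - \<zeta> \<noteq> 0" using \<zeta> by auto
    have "Im (C \<zeta>) = Im ((z0 - cnj z0 * \<zeta>) * cnj (1 - \<zeta>)) / (cmod (1 - \<zeta>))\<^sup>2"
      unfolding C_def by (simp add: Im_divide cmod_power2)
    also have "Im ((z0 - cnj z0 * \<zeta>) * cnj (1 - \<zeta>)) = Im z0 * (1 - (cmod \<zeta>)\<^sup>2)"
      unfolding cmod_power2 by (simp add: power2_eq_square algebra_simps)
    finally have "Im (C \<zeta>) = Im z0 * (1 - (cmod \<zeta>)\<^sup>2) / (cmod (1 - \<zeta>))\<^sup>2" .
    moreover have "0 < Im z0 * (1 - (cmod \<zeta>)\<^sup>2)"
      using z0 \<zeta> by (simp add: upper_half_plane_def abs_square_less_1)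
    ultimately show ?thesis using n1 by (simp add: upper_half_plane_def)
  qed
  have "z - cnj z0 \<noteq> 0"
  proof
    assume "z - cnj z0 = 0"
    then have "Im z + Im z0 = 0" by (metis complex.sel(2) cnj.simps(2) minus_complex.simps(2) zero_complex.simps(2) diff_minus_eq_add)
    then show False using z z0 by (simp add: upper_half_plane_def)
  qed
  define \<xi> where "\<xi> = (z - z0) / (z - cnj z0)"
  have "cmod (z - z0) < cmod (z - cnj z0)"
  proof -
    have "(cmod (z - cnj z0))\<^sup>2 - (cmod (z - z0))\<^sup>2 = 4 * Im z * Im z0"
      unfolding cmod_power2 by (simp add: power2_eq_square algebra_simps)
    moreover have "0 < 4 * Im z * Im z0" using z z0 by (simp add: upper_half_plane_def)
    ultimately have "(cmod (z - z0))\<^sup>2 < (cmod (z - cnj z0))\<^sup>2" by linarith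
    then show ?thesis by (simp add: power2_less_imp_less)
  qed
  then have \<xi>: "cmod \<xi> < 1" using \<open>z - cnj z0 \<noteq> 0\<close> by (simp add: \<xi>_def norm_divide)
  have C\<xi>: "C \<xi> = z"
  proof -
    have "1 - \<xi> = (z0 - cnj z0) / (z - cnj z0)"
      using \<open>z - cnj z0 \<noteq> 0\<close> by (simp add: \<xi>_def field_simps)
    moreover have "z0 - cnj z0 * \<xi> = z * (z0 - cnj z0) / (z - cnj z0)"
      using \<open>z - cnj z0 \<noteq> 0\<close> by (simp add: \<xi>_def field_simps)
    moreover have "z0 - cnj z0 \<noteq> 0"
      using z0 by (auto simp: upper_half_plane_def complex_eq_iff)
    ultimately show ?thesis
      using \<open>z - cnj z0 \<noteq> 0\<close> by (simp add: C_def)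
  qed
  have "C holomorphic_on ball 0 1"
    unfolding C_def by (intro holomorphic_intros) auto
  then have "(u \<circ> C) holomorphic_on ball 0 1"
    by (rule holomorphic_on_compose_gen[OF _ u(1)]) (use CH in auto)
  moreover have "(u \<circ> C) 0 = 0" using z0 by (simp add: C_def)
  moreover have "cmod ((u \<circ> C) \<zeta>) < 1" if "cmod \<zeta> < 1" for \<zeta>
    using u(2) CH[OF that] by simp
  ultimately have "cmod ((u \<circ> C) \<xi>) \<le> cmod \<xi>"
    using Schwarz_Lemma(1)[of "u \<circ> C" \<xi>] \<xi> by blast
  then show ?thesis
    by (simp add: C\<xi>) (simp add: \<xi>_def norm_divide)
qed

section \<open>Parabolic elements of groups commensurable with \<open>PSL2_Z\<close>\<close>

lemma SL2_simps [simp]: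
  "carrier SL2 = {A. det A = 1}" "A \<otimes>\<^bsub>SL2\<^esub> B = A ** B" "\<one>\<^bsub>SL2\<^esub> = mat 1"
  by (simp_all add: SL2_def)

lemma SL2_inverse:
  fixes A :: "'a::comm_ring_1^2^2"
  assumes "det A = 1"
  obtains B where "det B = 1" "A ** B = mat 1" "B ** A = mat 1"
proof
  let ?B = "vector [vector [A$2$2, - A$1$2], vector [- A$2$1, A$1$1]] :: 'a^2^2"
  show "det ?B = 1" using assms by (simp add: det_2 vector_2 mult.commute)
  have "A$1$1 * A$2$2 - A$1$2 * A$2$1 = 1" using assms by (simp add: det_2)
  then show "A ** ?B = mat 1" "?B ** A = mat 1"
    by (simp_all add: vec_eq_iff forall_2 matrix_matrix_mult_def sum_2 vector_2 mat_def mult.commute)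
qed

lemma group_SL2: "group (SL2 :: ('a::comm_ring_1^2^2) monoid)"
proof (rule groupI)
  fix A :: "'a^2^2" assume "A \<in> carrier SL2"
  then obtain B where "det B = 1" "B ** A = mat 1" using SL2_inverse[of A] by auto
  then show "\<exists>B\<in>carrier SL2. B \<otimes>\<^bsub>SL2\<^esub> A = \<one>\<^bsub>SL2\<^esub>" by auto
qed (auto simp: det_mul matrix_mul_assoc)

lemma normal_SL2_center: "SL2_center \<lhd> (SL2 :: ('a::comm_ring_1^2^2) monoid)"
proof -
  interpret group "SL2 :: ('a^2^2) monoid" by (rule group_SL2)
  have inv: "inv\<^bsub>SL2\<^esub> A = B" if "det A = 1" "B ** A = mat 1" "det B = 1" for A B :: "'a^2^2"
    using that by (intro inv_equality) auto
  have mat_mult: "mat c ** mat d = (mat (c * d) :: 'a^2^2)" for c d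
    by (simp add: vec_eq_iff mat_mult_nth) (simp add: mat_def)
  have "subgroup SL2_center (SL2 :: ('a^2^2) monoid)"
  proof (rule subgroupI)
    show "SL2_center \<subseteq> carrier (SL2 :: ('a^2^2) monoid)" by (auto simp: SL2_center_def)
    have "(mat 1 :: 'a^2^2) \<in> SL2_center" by (auto simp: SL2_center_def)
    then show "(SL2_center :: ('a^2^2) set) \<noteq> {}" by blast
  next
    fix A :: "'a^2^2" assume "A \<in> SL2_center"
    then obtain c where c: "A = mat c" "det A = 1" by (auto simp: SL2_center_def)
    then have "c * c = 1" by (simp add: det_2 mat_def)
    then have "A ** A = mat 1" by (simp add: c mat_mult)
    then have "inv\<^bsub>SL2\<^esub> A = A" using c by (intro inv) auto
    then show "inv\<^bsub>SL2\<^esub> A \<in> SL2_center" using \<open>A \<in> SL2_center\<close> by simp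
  next
    fix A B :: "'a^2^2" assume "A \<in> SL2_center" "B \<in> SL2_center"
    then show "A \<otimes>\<^bsub>SL2\<^esub> B \<in> SL2_center" by (auto simp: SL2_center_def det_mul mat_mult)
  qed
  moreover have "A \<otimes>\<^bsub>SL2\<^esub> Z \<otimes>\<^bsub>SL2\<^esub> inv\<^bsub>SL2\<^esub> A \<in> SL2_center"
    if AZ: "A \<in> carrier SL2" "Z \<in> SL2_center" for A Z :: "'a^2^2"
  proof -
    obtain B where B: "det B = 1" "A ** B = mat 1" "B ** A = mat 1"
      using AZ SL2_inverse[of A] by auto
    obtain c where c: "Z = mat c" using AZ by (auto simp: SL2_center_def)
    have "A ** Z ** B = Z"
      using B unfolding c mat_mult_commute[of c A, symmetric] by (simp flip: matrix_mul_assoc)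
    then show ?thesis using AZ B inv[of A B] by simp
  qed
  ultimately show ?thesis by (simp add: normal_inv_iff)
qed

lemma group_PSL2: "group (PSL2 :: ('a::comm_ring_1^2^2) set monoid)"
  unfolding PSL2_def by (rule normal.factorgroup_is_group[OF normal_SL2_center])

lemma carrier_PSL2: "carrier PSL2 = {PSL2_class A | A. det A = 1}"
  by (auto simp: PSL2_def FactGroup_def RCOSETS_def PSL2_class_def)

lemma PSL2_class_mult:
  "det A = 1 \<Longrightarrow> det B = 1 \<Longrightarrow> PSL2_class A \<otimes>\<^bsub>PSL2\<^esub> PSL2_class B = PSL2_class (A ** B)"
  unfolding PSL2_def PSL2_class_def FactGroup_def
  using normal.rcos_sum[OF normal_SL2_center, of A B] by simp

lemma PSL2_class_one: "\<one>\<^bsub>PSL2\<^esub> = PSL2_class (mat 1)"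
proof -
  interpret group "PSL2 :: ('a^2^2) set monoid" by (rule group_PSL2)
  have "PSL2_class (mat 1) \<in> carrier (PSL2 :: ('a^2^2) set monoid)"
    by (auto simp: carrier_PSL2)
  moreover have "PSL2_class (mat 1) \<otimes>\<^bsub>PSL2\<^esub> PSL2_class (mat 1) = (PSL2_class (mat 1) :: ('a^2^2) set)"
    by (simp add: PSL2_class_mult)
  ultimately show ?thesis by (metis r_cancel_one)
qed

lemma PSL2_class_eqD:
  fixes A B :: "real^2^2"
  assumes "PSL2_class A = PSL2_class B" "det A = 1" "det B = 1"
  obtains c where "c \<noteq> 0" "A = mat c ** B"
proof -
  have "A \<in> PSL2_class A"
    unfolding PSL2_class_def
    by (intro group.rcos_self[OF group_SL2] normal_imp_subgroup normal_SL2_center) (use assms in simp)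
  then have "A \<in> SL2_center #>\<^bsub>SL2\<^esub> B" using assms(1) by (simp add: PSL2_class_def)
  then obtain c where c: "A = mat c ** B" by (auto simp: r_coset_def SL2_center_def)
  have "c \<noteq> 0"
  proof
    assume "c = 0"
    then have "A = 0" by (simp add: c vec_eq_iff mat_mult_nth)
    then show False using assms by (simp add: det_2)
  qed
  with c show ?thesis using that by blast
qed

definition translation :: "real \<Rightarrow> real^2^2" where
  "translation t = vector [vector [1, t], vector [0, 1]]"

lemma det_translation [simp]: "det (translation t) = 1"
  by (simp add: translation_def det_2 vector_2)

lemma translation_0 [simp]: "translation 0 = mat 1"
  by (simp add: translation_def mat_def vec_eq_iff forall_2 vector_2)

lemma translation_mult: "translation s ** translation t = translation (s + t)"
  by (simp add: translation_def vec_eq_iff forall_2 matrix_matrix_mult_def sum_2 vector_2 add.commute)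

lemma translation_in_PSL2_Z: "PSL2_class (translation (of_int n)) \<in> PSL2_Z"
proof -
  let ?A = "vector [vector [1, n], vector [0, 1]] :: int^2^2"
  have "translation (of_int n) = (\<chi> i j. real_of_int (?A $ i $ j))"
    by (simp add: translation_def vec_eq_iff forall_2 vector_2)
  then have "PSL2_class (translation (of_int n)) = PSL2_class (\<chi> i j. real_of_int (?A $ i $ j))"
    by (simp only:)
  moreover have "det ?A = 1" by (simp add: det_2 vector_2)
  ultimately show ?thesis unfolding PSL2_Z_def by (intro CollectI exI[of _ ?A] conjI)
qed

text \<open>Pigeonhole: infinitely many integral translations fall into finitely many cosets, and
  the quotient of two distinct ones in the same coset lies in \<open>H\<close>.\<close>

lemma translation_in_commensurable:
  assumes fin: "finite (rcosets\<^bsub>PSL2\<lparr>carrier := PSL2_Z\<rparr>\<^esub> (H \<inter> PSL2_Z))"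
    and H: "H \<subseteq> carrier PSL2" "\<one>\<^bsub>PSL2\<^esub> \<in> H"
  obtains k where "k \<noteq> 0" "PSL2_class (translation k) \<in> H"
proof -
  interpret group "PSL2 :: (real^2^2) set monoid" by (rule group_PSL2)
  define \<tau> where "\<tau> = (\<lambda>n :: int. PSL2_class (translation (of_int n)))"
  have \<tau>c: "\<tau> n \<in> carrier PSL2" for n by (auto simp: \<tau>_def carrier_PSL2)
  have \<tau>m: "\<tau> m \<otimes>\<^bsub>PSL2\<^esub> \<tau> n = \<tau> (m + n)" for m n
    by (simp add: \<tau>_def PSL2_class_mult translation_mult)
  define cos where "cos = (\<lambda>n. (H \<inter> PSL2_Z) #>\<^bsub>PSL2\<^esub> \<tau> n)"
  have "range cos \<subseteq> rcosets\<^bsub>PSL2\<lparr>carrier := PSL2_Z\<rparr>\<^esub> (H \<inter> PSL2_Z)"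
    using translation_in_PSL2_Z unfolding RCOSETS_def r_coset_def cos_def \<tau>_def by auto
  then have "finite (range cos)" using fin by (rule finite_subset)
  then have "\<not> inj cos" using finite_imageD infinite_UNIV_int by blast
  then obtain m n where mn: "m \<noteq> n" "cos m = cos n" by (auto simp: inj_def)
  have "\<one>\<^bsub>PSL2\<^esub> \<in> PSL2_Z"
    using translation_in_PSL2_Z[of 0] by (simp add: PSL2_class_one)
  then have "\<one>\<^bsub>PSL2\<^esub> \<otimes>\<^bsub>PSL2\<^esub> \<tau> m \<in> cos m"
    using H unfolding cos_def r_coset_def by blast
  then have "\<tau> m \<in> cos n" using mn \<tau>c by simp
  then obtain h where h: "h \<in> H" "\<tau> m = h \<otimes>\<^bsub>PSL2\<^esub> \<tau> n"
    unfolding cos_def r_coset_def by blast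
  have "\<tau> (m - n) \<otimes>\<^bsub>PSL2\<^esub> \<tau> n = h \<otimes>\<^bsub>PSL2\<^esub> \<tau> n"
    using h by (simp add: \<tau>m)
  moreover have "h \<in> carrier PSL2" using h H by blast
  ultimately have "\<tau> (m - n) = h" using right_cancel[of "\<tau> n" "\<tau> (m - n)" h] \<tau>c by simp
  then have "PSL2_class (translation (of_int (m - n))) \<in> H"
    using h by (simp add: \<tau>_def)
  moreover have "real_of_int (m - n) \<noteq> 0" using mn by simp
  ultimately show ?thesis using that by blast
qed

text \<open>Undoing the conjugation in the definition of isogeny turns a translation into a
  parabolic element of \<open>H\<close> itself.\<close>

lemma isogenous_translation:
  assumes iso: "isogenous H PSL2_Z" and H: "H \<subseteq> carrier PSL2" "\<one>\<^bsub>PSL2\<^esub> \<in> H"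
  obtains C C' k \<eta> where "det C = 1" "det C' = 1" "C ** C' = mat 1" "C' ** C = mat 1" "k \<noteq> 0" "\<eta> \<in> H"
    "PSL2_class (C' ** translation k ** C) = \<eta>"
proof -
  interpret group "PSL2 :: (real^2^2) set monoid" by (rule group_PSL2)
  obtain c where c: "c \<in> carrier PSL2"
    and com: "commensurable PSL2 (c <#\<^bsub>PSL2\<^esub> H #>\<^bsub>PSL2\<^esub> (inv\<^bsub>PSL2\<^esub> c)) PSL2_Z"
    using iso by (auto simp: isogenous_def)
  let ?cH = "c <#\<^bsub>PSL2\<^esub> H #>\<^bsub>PSL2\<^esub> (inv\<^bsub>PSL2\<^esub> c)"
  have cH: "?cH = {c \<otimes>\<^bsub>PSL2\<^esub> h \<otimes>\<^bsub>PSL2\<^esub> inv\<^bsub>PSL2\<^esub> c | h. h \<in> H}"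
    by (auto simp: l_coset_def r_coset_def)
  have "?cH \<subseteq> carrier PSL2" unfolding cH using H c by auto
  moreover have "c \<otimes>\<^bsub>PSL2\<^esub> \<one>\<^bsub>PSL2\<^esub> \<otimes>\<^bsub>PSL2\<^esub> inv\<^bsub>PSL2\<^esub> c \<in> ?cH"
    unfolding cH using H by blast
  then have "\<one>\<^bsub>PSL2\<^esub> \<in> ?cH" using c by simp
  ultimately obtain k where k: "k \<noteq> 0" "PSL2_class (translation k) \<in> ?cH"
    using translation_in_commensurable com unfolding commensurable_def by metis
  then obtain h where h: "h \<in> H" "PSL2_class (translation k) = c \<otimes>\<^bsub>PSL2\<^esub> h \<otimes>\<^bsub>PSL2\<^esub> inv\<^bsub>PSL2\<^esub> c"
    unfolding cH by blast
  obtain C where C: "c = PSL2_class C" "det C = 1" using c by (auto simp: carrier_PSL2)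
  obtain C' where C': "det C' = 1" "C ** C' = mat 1" "C' ** C = mat 1" using SL2_inverse[OF C(2)] .
  have inv: "inv\<^bsub>PSL2\<^esub> c = PSL2_class C'"
    using C C' by (intro inv_equality) (auto simp: PSL2_class_mult PSL2_class_one carrier_PSL2)
  have hc: "h \<in> carrier PSL2" using h H by auto
  have "PSL2_class (C' ** translation k ** C) = inv\<^bsub>PSL2\<^esub> c \<otimes>\<^bsub>PSL2\<^esub> PSL2_class (translation k) \<otimes>\<^bsub>PSL2\<^esub> c"
    unfolding inv unfolding C(1) using C C' by (simp add: PSL2_class_mult det_mul)
  also have "\<dots> = h"
  proof -
    have "inv\<^bsub>PSL2\<^esub> c \<otimes>\<^bsub>PSL2\<^esub> (c \<otimes>\<^bsub>PSL2\<^esub> h \<otimes>\<^bsub>PSL2\<^esub> inv\<^bsub>PSL2\<^esub> c) \<otimes>\<^bsub>PSL2\<^esub> c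
      = (inv\<^bsub>PSL2\<^esub> c \<otimes>\<^bsub>PSL2\<^esub> c) \<otimes>\<^bsub>PSL2\<^esub> h \<otimes>\<^bsub>PSL2\<^esub> (inv\<^bsub>PSL2\<^esub> c \<otimes>\<^bsub>PSL2\<^esub> c)"
      using c hc by (simp only: m_assoc inv_closed m_closed)
    then show ?thesis unfolding h(2) using c hc by simp
  qed
  finally show ?thesis using that[OF C(2) C'(1-3) k(1) h(1)] by blast
qed

section \<open>Moebius transformations\<close>

lemma moebius_denominator:
  fixes A :: "real^2^2"
  assumes "det A = 1" "z \<in> UHP"
  shows "of_real (A $ 2 $ 1) * z + of_real (A $ 2 $ 2) \<noteq> 0"
proof
  assume 0: "of_real (A $ 2 $ 1) * z + of_real (A $ 2 $ 2) = 0"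
  then have "A $ 2 $ 1 * Im z = 0"
    by (simp add: complex_eq_iff)
  then have "A $ 2 $ 1 = 0" using assms by (simp add: upper_half_plane_def)
  then show False using 0 assms by (simp add: det_2)
qed

lemma moebius_mult:
  assumes "det A = 1" "det B = 1" "z \<in> UHP"
  shows "moebius (A ** B) z = moebius A (moebius B z)"
proof -
  define p q where "p = of_real (B $ 1 $ 1) * z + of_real (B $ 1 $ 2)"
    and "q = of_real (B $ 2 $ 1) * z + of_real (B $ 2 $ 2)"
  have q: "q \<noteq> 0"
    using moebius_denominator assms by (simp add: q_def)
  have "moebius (A ** B) z = (of_real (A $ 1 $ 1) * p + of_real (A $ 1 $ 2) * q) /
      (of_real (A $ 2 $ 1) * p + of_real (A $ 2 $ 2) * q)"
    by (simp add: moebius_def matrix_matrix_mult_def sum_2 p_def q_def algebra_simps)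
  also have "of_real (A $ i $ 1) * p + of_real (A $ i $ 2) * q
      = (of_real (A $ i $ 1) * (p / q) + of_real (A $ i $ 2)) * q" for i
    using q by (simp add: distrib_right)
  then have "(of_real (A $ 1 $ 1) * p + of_real (A $ 1 $ 2) * q) /
      (of_real (A $ 2 $ 1) * p + of_real (A $ 2 $ 2) * q) = moebius A (p / q)"
    using q by (simp add: moebius_def)
  finally show ?thesis
    by (simp add: moebius_def[of B] p_def q_def)
qed

lemma moebius_scale: "c \<noteq> 0 \<Longrightarrow> moebius (mat c ** A) z = moebius A z"
proof -
  assume c: "c \<noteq> 0"
  have "moebius (mat c ** A) z = (of_real c * (of_real (A $ 1 $ 1) * z + of_real (A $ 1 $ 2))) /
      (of_real c * (of_real (A $ 2 $ 1) * z + of_real (A $ 2 $ 2)))"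
    by (simp add: moebius_def mat_mult_nth algebra_simps)
  then show ?thesis using c by (simp add: moebius_def)
qed

lemma moebius_translation [simp]: "moebius (translation t) z = z + of_real t"
  by (simp add: moebius_def translation_def vector_2)

lemma moebius_one [simp]: "moebius (mat 1) z = z"
  by (simp add: moebius_def mat_def)

lemma moebius_upper_half_plane:
  assumes A: "det A = 1" and z: "z \<in> UHP"
  shows "moebius A z \<in> UHP"
proof -
  define d where "d = of_real (A $ 2 $ 1) * z + of_real (A $ 2 $ 2)"
  define n where "n = of_real (A $ 1 $ 1) * z + of_real (A $ 1 $ 2)"
  have d: "d \<noteq> 0" using moebius_denominator[OF assms] by (simp add: d_def)
  have "Im (moebius A z) = Im (n * cnj d) / (cmod d)\<^sup>2"
    by (simp add: moebius_def n_def d_def Im_divide cmod_power2)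
  also have "Im (n * cnj d) = (A $ 1 $ 1 * A $ 2 $ 2 - A $ 1 $ 2 * A $ 2 $ 1) * Im z"
    by (simp add: n_def d_def algebra_simps)
  also have "\<dots> = Im z" using A by (simp add: det_2)
  finally show ?thesis using z d by (simp add: upper_half_plane_def)
qed

lemma moebius_holomorphic:
  assumes "det A = 1"
  shows "moebius A holomorphic_on UHP"
  unfolding moebius_def by (intro holomorphic_intros) (use moebius_denominator[OF assms] in auto)

lemma open_upper_half_plane: "open UHP"
  unfolding upper_half_plane_def by (simp add: open_halfspace_Im_gt)

section \<open>The quotient is not isogenous to the modular curve\<close>

context fixed_lattice
begin

lemma PSL2_image_subset: "PSL2_image L \<Gamma> \<psi> \<subseteq> carrier PSL2"
  by (auto simp: PSL2_image_def carrier_PSL2)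

theorem not_isogenous_PSL2_Z:
  assumes D1: "is_period_domain Q L D1" and \<psi>: "half_plane_iso Q L D1 \<psi>"
  shows "\<not> isogenous (PSL2_image L (Gamma_fixed Q D G) \<psi>) PSL2_Z"
proof
  assume iso: "isogenous (PSL2_image L (Gamma_fixed Q D G) \<psi>) PSL2_Z"
  let ?\<phi> = "\<lambda>y. line (lin_comb y)"
  let ?S = T1_gram
  obtain x0 where x0: "x0 \<in> P3" "\<And>y. y \<in> P3 \<Longrightarrow> ?\<phi> y \<in> D1 \<longleftrightarrow> 0 < orient ?S x0 y"
      "D1 = {?\<phi> y | y. y \<in> P3 \<and> 0 < orient ?S x0 y}"
    using period_domain_L[OF D1] by blast
  have "D1 \<subseteq> topspace (full_period_domain Q L)"
    using D1 unfolding is_period_domain_def by (rule connected_components_of_subset)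
  then have top: "topspace (period_domain_topology Q L D1) = D1"
    by (simp add: period_domain_topology_def Int_absorb1)
  have hom: "homeomorphic_map (top_of_set UHP) (period_domain_topology Q L D1) \<psi>"
    using \<psi> by (simp add: half_plane_iso_def)
  have surj: "\<psi> ` UHP = D1" and inj: "inj_on \<psi> UHP"
    using homeomorphic_imp_surjective_map[OF hom] homeomorphic_imp_injective_map[OF hom] top by simp_all
  have lift: "\<exists>y\<in>P3. 0 < orient ?S x0 y \<and> \<psi> z = ?\<phi> y" if "z \<in> UHP" for z
  proof -
    have "\<psi> z \<in> D1" using that surj by blast
    then show ?thesis using x0(3) by blast
  qed
  have one: "\<one>\<^bsub>PSL2\<^esub> \<in> PSL2_image L (Gamma_fixed Q D G) \<psi>"
  proof -
    obtain \<gamma> where \<gamma>: "\<gamma> \<in> carrier (Gamma_fixed Q D G)" "acts \<gamma> (mat 1)"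
      using matrix_Gamma_fixed[OF matrices_one] .
    have "\<psi> (moebius (mat 1) z) = line_action L \<gamma> (\<psi> z)" if z: "z \<in> UHP" for z
    proof -
      obtain y where "\<psi> z = ?\<phi> y" using lift[OF z] by blast
      then show ?thesis using line_action_lin_comb[OF \<gamma>(2), of y] by simp
    qed
    with \<gamma>(1) show ?thesis unfolding PSL2_image_def PSL2_class_one by force
  qed
  obtain C C' k \<eta> where C: "det C = 1" "det C' = 1" "C ** C' = mat 1" "C' ** C = mat 1" "k \<noteq> 0"
      "\<eta> \<in> PSL2_image L (Gamma_fixed Q D G) \<psi>" "PSL2_class (C' ** translation k ** C) = \<eta>"
    using isogenous_translation[OF iso PSL2_image_subset one] .
  obtain A \<gamma> where A: "\<eta> = PSL2_class A" "det A = 1" and \<gamma>: "\<gamma> \<in> carrier (Gamma_fixed Q D G)"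
      "\<And>z. z \<in> UHP \<Longrightarrow> \<psi> (moebius A z) = line_action L \<gamma> (\<psi> z)"
    using C(6) unfolding PSL2_image_def by blast
  obtain M where M: "M \<in> matrices" "acts \<gamma> M" using Gamma_fixed_matrix[OF \<gamma>(1)] .
  have Mi: "T1_isometry M" using M(1) by (rule matrices_isometry)
  obtain s where s: "s \<noteq> 0" "C' ** translation k ** C = mat s ** A"
    using PSL2_class_eqD[of "C' ** translation k ** C" A] C A by (auto simp: det_mul)
  \<comment> \<open>In this coordinate the isometry \<open>\<gamma>\<close> acts as the translation
    by \<open>k\<close>.\<close>
  define \<psi>' where "\<psi>' = (\<lambda>w. \<psi> (moebius C' w))"
  have shiftH: "w + of_real k \<in> UHP" if "w \<in> UHP" for w
    using that by (simp add: upper_half_plane_def)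
  have shift: "\<psi>' (w + of_real k) = line_action L \<gamma> (\<psi>' w)" if w: "w \<in> UHP" for w
  proof -
    have "moebius C' (w + of_real k) = moebius (C' ** translation k) w"
      using w C by (simp add: moebius_mult)
    also have "C' ** translation k = (C' ** translation k ** C) ** C'"
      using C by (simp flip: matrix_mul_assoc)
    also have "\<dots> = mat s ** (A ** C')"
      by (simp add: s matrix_mul_assoc)
    also have "moebius (mat s ** (A ** C')) w = moebius A (moebius C' w)"
      using s w A C by (simp add: moebius_scale moebius_mult)
    finally show ?thesis
      using \<gamma>(2) w C by (simp add: \<psi>'_def moebius_upper_half_plane)
  qed
  have "\<exists>y. y \<in> P3 \<and> 0 < orient ?S x0 y \<and> \<psi>' w = ?\<phi> y" if "w \<in> UHP" for w
    using lift[of "moebius C' w"] that C by (auto simp: \<psi>'_def moebius_upper_half_plane)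
  then obtain Y where Y: "\<And>w. w \<in> UHP \<Longrightarrow> Y w \<in> P3"
      "\<And>w. w \<in> UHP \<Longrightarrow> 0 < orient ?S x0 (Y w)"
      "\<And>w. w \<in> UHP \<Longrightarrow> \<psi>' w = ?\<phi> (Y w)" by metis
  \<comment> \<open>Points rising along the imaginary axis: the displacement of a translation tends
    to 0 there. \<open>Suc\<close> keeps \<open>w 0\<close> off the real axis.\<close>
  define w where "w = (\<lambda>j :: nat. \<i> * of_nat (Suc j))"
  define x where "x = (\<lambda>j. Y (w j))"
  have wH: "w j \<in> UHP" for j by (simp add: w_def upper_half_plane_def)
  have xP: "x j \<in> P3" for j using Y wH by (simp add: x_def)
  have less: "cmod (bform ?S (Y z) (x j)) < cmod (bform ?S (Y z) (vcnj (x j)))" if z: "z \<in> UHP" for z j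
  proof -
    have "0 < orient ?S (Y z) x0" using Y(2)[OF z] by (simp add: T1.orient_commute)
    then have "0 < orient ?S (Y z) (x j)"
      using T1.orient_trans[OF two_negative_T1 Y(1)[OF z] x0(1) xP[of j]] Y(2)[OF wH[of j]] by (simp add: x_def)
    then show ?thesis by (simp add: orient_def power2_less_imp_less)
  qed
  \<comment> \<open>The lift \<open>Y\<close> is chosen pointwise and need not be continuous, but
    this ratio does not change when \<open>Y z\<close> is rescaled, so the local holomorphic lifts
    of \<open>\<psi>\<close> compute it. It vanishes at \<open>w j\<close>, and \<open>less\<close>
    bounds its modulus by 1.\<close>
  define u where "u = (\<lambda>j z. bform ?S (Y z) (x j) / bform ?S (Y z) (vcnj (x j)))"
  have hol: "u j holomorphic_on UHP" for j
  proof -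
    have "u j field_differentiable at z" if z: "z \<in> UHP" for z
    proof -
      have C'z: "moebius C' z \<in> UHP" using z C by (simp add: moebius_upper_half_plane)
      obtain U f where Uf: "open U \<and> moebius C' z \<in> U \<and> U \<subseteq> UHP \<and>
          (\<forall>i. (\<lambda>w. f w $ i) holomorphic_on U) \<and> (\<forall>w\<in>U. f w \<noteq> 0 \<and> \<psi> w = line (f w))"
        using \<psi>[unfolded half_plane_iso_def, THEN conjunct2, THEN bspec, OF C'z] by (elim exE)
      then have U: "open U" "moebius C' z \<in> U" "(\<lambda>w. f w $ i) holomorphic_on U"
          "w \<in> U \<Longrightarrow> f w \<noteq> 0" "w \<in> U \<Longrightarrow> \<psi> w = line (f w)" for i w
        by blast+
      define N where "N = UHP \<inter> moebius C' -` U"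
      have mc: "continuous_on UHP (moebius C')"
        using moebius_holomorphic[OF C(2)] by (rule holomorphic_on_imp_continuous_on)
      have N: "open N" "z \<in> N" "N \<subseteq> UHP"
        using continuous_open_preimage[OF mc open_upper_half_plane U(1)] z U(2) by (auto simp: N_def)
      define F where "F = (\<lambda>w. f (moebius C' w))"
      have Fi: "(\<lambda>w. F w $ i) holomorphic_on N" for i
      proof -
        have "(\<lambda>w. f w $ i) \<circ> moebius C' holomorphic_on N"
          by (rule holomorphic_on_compose_gen[OF _ U(3)])
             (auto simp: N_def intro: holomorphic_on_subset[OF moebius_holomorphic[OF C(2)]])
        then show ?thesis by (simp add: F_def comp_def)
      qed
      have bh: "(\<lambda>w. bform Q (F w) v) holomorphic_on N" for v
        unfolding bform_def by (intro holomorphic_intros Fi)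
      have ratio: "bform Q (F y) (lin_comb (x j)) / bform Q (F y) (lin_comb (vcnj (x j))) = u j y
          \<and> bform Q (F y) (lin_comb (vcnj (x j))) \<noteq> 0" if y: "y \<in> N" for y
      proof -
        have yH: "y \<in> UHP" and yU: "moebius C' y \<in> U" using y by (auto simp: N_def)
        have "line (F y) = line (lin_comb (Y y))" "F y \<noteq> 0"
          using U(4,5)[OF yU] Y(3)[OF yH] by (simp_all add: F_def \<psi>'_def)
        then obtain c where c: "c \<noteq> 0" "F y = c *s lin_comb (Y y)" by (rule line_eq_lineE)
        have "bform ?S (Y y) (vcnj (x j)) \<noteq> 0" using less[OF yH, of j] by auto
        with c show ?thesis by (simp add: bform_linear bform_lin_comb_lin_comb u_def)
      qed
      have "(\<lambda>w. bform Q (F w) (lin_comb (x j)) / bform Q (F w) (lin_comb (vcnj (x j)))) holomorphic_on N"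
        using ratio by (intro holomorphic_intros bh) auto
      then have "u j holomorphic_on N"
        by (rule holomorphic_transform) (use ratio in auto)
      then show ?thesis
        using N by (simp add: holomorphic_on_open field_differentiable_def)
    qed
    then show ?thesis
      unfolding holomorphic_on_def by (blast intro: field_differentiable_at_within)
  qed
  define \<rho> where "\<rho> = (\<lambda>j. \<bar>k\<bar> / 2 * inverse (real (Suc j)))"
  have \<rho>: "\<rho> \<longlonglongrightarrow> 0"
    unfolding \<rho>_def using tendsto_mult[OF tendsto_const LIMSEQ_inverse_real_of_nat] by simp
  have small: "cmod (bform ?S (of_int_mat M *v x j) (x j)) \<le> \<rho> j * cmod (bform ?S (of_int_mat M *v x j) (vcnj (x j)))" for j
  proof -
    let ?z = "w j + of_real k"
    have zH: "?z \<in> UHP" using shiftH wH .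
    have "u j (w j) = 0"
      using xP[of j] by (simp add: u_def x_def period_vectors_def)
    moreover have "cmod (u j z) < 1" if "z \<in> UHP" for z
      using less[OF that, of j] by (auto simp: u_def norm_divide divide_less_eq)
    ultimately have "cmod (u j ?z) \<le> cmod (?z - w j) / cmod (?z - cnj (w j))"
      using Schwarz_upper_half_plane[OF hol _ wH _ zH] by blast
    also have "\<dots> \<le> \<bar>k\<bar> / (2 * real (Suc j))"
    proof (intro frac_le)
      have "Im (?z - cnj (w j)) = 2 * real (Suc j)" by (simp add: w_def)
      then show "2 * real (Suc j) \<le> cmod (?z - cnj (w j))"
        using abs_Im_le_cmod[of "?z - cnj (w j)"] by linarith
    qed simp_all
    also have "\<dots> = \<rho> j" by (simp add: \<rho>_def field_simps)
    finally have "cmod (u j ?z) \<le> \<rho> j" .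
    then have le: "cmod (bform ?S (Y ?z) (x j)) \<le> \<rho> j * cmod (bform ?S (Y ?z) (vcnj (x j)))"
      using less[OF zH, of j] by (simp add: u_def norm_divide divide_le_eq split: if_splits)
    have "?\<phi> (Y ?z) = line_action L \<gamma> (\<psi>' (w j))"
      using shift[OF wH] Y(3)[OF zH] by simp
    also have "\<dots> = ?\<phi> (of_int_mat M *v x j)"
      using line_action_lin_comb[OF M(2)] Y(3)[OF wH] by (simp add: x_def)
    finally have "?\<phi> (Y ?z) = ?\<phi> (of_int_mat M *v x j)" .
    moreover have "lin_comb (Y ?z) \<noteq> 0"
      using Y(1)[OF zH] lin_comb_period_vectors period_vectors_nonzero by blast
    ultimately obtain c where c: "c \<noteq> 0" "lin_comb (Y ?z) = c *s lin_comb (of_int_mat M *v x j)"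
      by (rule line_eq_lineE)
    then have "Y ?z = c *s (of_int_mat M *v x j)"
      by (simp add: lin_comb_inject flip: lin_comb_scale)
    then have "cmod c * cmod (bform ?S (of_int_mat M *v x j) (x j))
        \<le> cmod c * (\<rho> j * cmod (bform ?S (of_int_mat M *v x j) (vcnj (x j))))"
      using le by (simp add: bform_linear norm_mult mult.left_commute)
    then show ?thesis using c(1) by simp
  qed
  obtain z \<alpha> where z: "z \<in> P3" "\<alpha> \<noteq> 0" "of_int_mat M *v z = \<alpha> *s z"
    using small_displacement_fixed_point[OF Mi xP \<rho> small] .
  \<comment> \<open>The fixed vector may lie over the other component; as \<open>M\<close> is real,
    its conjugate is then fixed too and lies over \<open>D1\<close>.\<close>
  obtain z' \<alpha>' where z': "z' \<in> P3" "\<alpha>' \<noteq> 0" "of_int_mat M *v z' = \<alpha>' *s z'" "0 < orient ?S x0 z'"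
  proof (cases "0 < orient ?S x0 z")
    case True
    then show ?thesis using that z by blast
  next
    case False
    then have "0 < orient ?S x0 (vcnj z)"
      using T1.orient_nonzero[OF two_negative_T1 x0(1) z(1)]
      by (simp add: T1.orient_commute[of x0] orient_vcnj_left)
    moreover have "vcnj z \<in> P3"
      using z(1) by (simp add: period_vectors_def bform_vcnj T1.bform_sym[of "vcnj z" z])
    moreover have "of_int_mat M *v vcnj z = cnj \<alpha> *s vcnj z"
      by (metis vcnj_mult vcnj_scale z(3))
    moreover have "cnj \<alpha> \<noteq> 0" using z by simp
    ultimately show ?thesis using that by blast
  qed
  \<comment> \<open>Pulled back to the half plane, the fixed line gives a point fixed by the
    translation by \<open>k\<close>, which is nonzero.\<close>
  have "?\<phi> z' \<in> D1" using x0(2) z' by simp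
  then obtain v where v: "v \<in> UHP" "\<psi> v = ?\<phi> z'" using surj by (metis imageE)
  define v' where "v' = moebius C v"
  have v'H: "v' \<in> UHP" using v C by (simp add: v'_def moebius_upper_half_plane)
  have C'v': "moebius C' v' = v"
    using moebius_mult[of C' C v] v C by (simp add: v'_def)
  have "\<psi>' (v' + of_real k) = line_action L \<gamma> (?\<phi> z')"
    using shift[OF v'H] by (simp add: \<psi>'_def C'v' v)
  also have "\<dots> = ?\<phi> z'"
    unfolding line_action_lin_comb[OF M(2)] z'(3) lin_comb_scale by (rule line_scale[OF z'(2)])
  finally have "\<psi> (moebius C' (v' + of_real k)) = \<psi> v"
    using v by (simp add: \<psi>'_def)
  then have eq: "moebius C' (v' + of_real k) = v"
    by (rule inj_onD[OF inj]) (use v shiftH[OF v'H] C in \<open>simp_all add: moebius_upper_half_plane\<close>)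
  have "v' + of_real k = moebius C (moebius C' (v' + of_real k))"
    using moebius_mult[of C C' "v' + of_real k"] shiftH[OF v'H] C by simp
  then have "v' + of_real k = v'" unfolding eq by (simp add: v'_def)
  then show False using C(5) by simp
qed

end

theorem proposition1p5:
  fixes D D1 :: "(complex^prim_index) set set"
    and G :: "(int^prim_index \<Rightarrow> int^prim_index) set"
    and T1 :: "(int^prim_index) set"
    and b :: "int^prim_index^3"
    and \<Gamma>1 :: "(int^prim_index \<Rightarrow> int^prim_index) monoid"
  assumes "is_period_domain prim_gram UNIV D"
    and "subgroup G (Gamma_hat prim_gram D)"
    and "(Gamma_hat prim_gram D)\<lparr>carrier := G\<rparr> \<cong> (PSL2 :: (7^2^2) set monoid)"
    and "T1 = fixed_sublattice G"
    and "integral_basis b T1"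
    and "\<And>i j. bform prim_gram (b $ i) (b $ j) = T1_gram $ i $ j"
    and "is_period_domain prim_gram T1 D1"
    and "\<Gamma>1 = Gamma_fixed prim_gram D G"
  shows "compact_space (quotient_curve prim_gram T1 \<Gamma>1 D1) \<and>
    (\<forall>\<psi>. half_plane_iso prim_gram T1 D1 \<psi> \<longrightarrow>
         \<not> isogenous (PSL2_image T1 \<Gamma>1 \<psi>) PSL2_Z)"
proof -
  interpret fixed_lattice prim_gram b D G
    using assms prim_gram_symmetric two_negative_prim_gram
    by (intro fixed_lattice.intro sublattice.intro period_space.intro sublattice_axioms.intro
        fixed_lattice_axioms.intro) simp_all
  show ?thesis
    using compact_quotient_curve not_isogenous_PSL2_Z assms by blast
qed

end
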